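(* Let $\mathcal{M}^{BGGG}_{P_1}$ be the moduli space of irreducible $SU(2)^2\times U(1)$-invariant $G_2$-instantons with gauge group $SU(2)$ on $\mathbb{R}^4\times S^3$ with the BGGG $G_2$-structure which extend smoothly over $\{0\}\times S^3$ on $P_1$. Then $\mathcal{M}^{BGGG}_{P_1}$ contains a nonempty, unbounded open set $U\subset\mathbb{R}^2$ (instantons being parametrized by $(f_1^+,g_1^+)\in\mathbb{R}^2$). Moreover: (a) the instantons in $U$ have quadratically decaying curvature, i.e. $|F_A|=O(t^{-2})$ as $t\to\infty$; (b) the map $Hol_\infty:U\to U(1)\subset SU(2)$, which evaluates the holonomy of the $G_2$-instanton along the finite size circle at $+\infty$, is surjective.
   Context: Conventions: $SU(2)$ is identified with the unit quaternions; $\{T_i\}_{i=1}^3$ is a basis of $\mathfrak{su}(2)$ with $[T_i,T_j]=2\epsilon_{ijk}T_k$; $T_i^{\pm}=(T_i,\pm T_i)$; $\{\eta_i^{\pm}\}$ are the left-invariant 1-forms on $SU(2)^2$ dual to $\{T_i^{\pm}\}$. Manifold: $\mathbb{R}^4\times S^3\subset\mathbb{H}\times\mathbb{H}$ with $SU(2)^2$ acting by $(a_1,a_2)\cdot(p,q)=(a_1p,a_1q\bar a_2)$; the complement of the singular orbit $\{0\}\times S^3\cong SU(2)^2/\Delta SU(2)$ is identified with $\mathbb{R}^+_t\times SU(2)^2$ via $(t,a_1,a_2)\mapsto(ta_1,a_1\bar a_2)$. The extra $U(1)$ acts on $SU(2)^2$ by right multiplication by the diagonal one-parameter subgroup generated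 by $T_1^+$. BGGG structure: define $r\in[9/4,\infty)$ by $t(r)=\int_{9/4}^r\frac{\sqrt{(s-3/4)(s+3/4)}}{\sqrt{(s-9/4)(s+9/4)}}ds$ and $$A_1=\frac{\sqrt{(r-9/4)(r+9/4)}}{\sqrt{(r-3/4)(r+3/4)}},\quad A_2=A_3=\sqrt{\tfrac{(r-9/4)(r+3/4)}{3}},\quad B_1=\tfrac{2r}{3},\quad B_2=B_3=\sqrt{\tfrac{(r-3/4)(r+9/4)}{3}}.$$ With $\omega=4\sum_iA_iB_i\eta_i^-\wedge\eta_i^+$, $\Omega_1=8B_1B_2B_3\eta_{123}^--4\sum\epsilon_{ijk}A_iA_jB_k\eta_i^+\wedge\eta_j^+\wedge\eta_k^-$, $\Omega_2=-8A_1A_2A_3\eta_{123}^++4\sum\epsilon_{ijk}B_iB_jA_k\eta_i^-\wedge\eta_j^-\wedge\eta_k^+$, the $G_2$-structure is $\varphi=dt\wedge\omega+\Omega_1$, $\psi=*\varphi=\frac12\omega^2-dt\wedge\Omega_2$, with metric $g=dt^2+\sum_i(2A_i)^2(\eta_i^+)^2+(2B_i)^2(\eta_i^-)^2$. Here $A_1\to1$ as $t\to\infty$. A $G_2$-instanton is a connection with $F_A\wedge\psi=0$. $P_1=SU(2)^2\times_{(\Delta SU(2),1)}SU(2)$ (trivial isotropy homomorphism), pulled back from $S^3$ to $\mathbb{R}^4\times S^3$; over $\mathbb{R}^+\times SU(2)^2$ it is canonically trivial. Any $SU(2)^2\times U(1)$-invariant $G_2$-instanton with gauge group $SU(2)$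 near $\{0\}\times S^3$ extending smoothly on $P_1$ is, up to invariant gauge transformation, of the form $A=A_1f^+T_1\otimes\eta_1^++A_2g^+(T_2\otimes\eta_2^++T_3\otimes\eta_3^+)$ with $$\dot f^++\tfrac12\Big(\tfrac{A_1}{B_2^2}-\tfrac{A_1}{A_2^2}\Big)f^+=-(g^+)^2,\qquad \dot g^++\tfrac12\Big(\tfrac{A_2^2+B_1^2+B_2^2}{A_2B_1B_2}-\tfrac{A_1^2+2A_2^2}{A_1A_2^2}\Big)g^+=-f^+g^+,$$ $f^+=f_1^+t+O(t^3)$, $g^+=g_1^+t+O(t^3)$, and is uniquely determined by $(f_1^+,g_1^+)\in\mathbb{R}^2$ (with $(f_1^+,g_1^+)$ and $(f_1^+,-g_1^+)$ gauge equivalent); this is the parametrization by $\mathbb{R}^2$. Elements of the moduli space are globally defined on $\mathbb{R}^4\times S^3$. $Hol_\infty(A)=\lim_{t\to\infty}Hol_A(\gamma_t)$, where $\gamma_t(\theta)=(t,\exp_{(1,1)}(2\pi\theta T_1^+))\in\mathbb{R}^+_t\times SU(2)^2$, $\theta\in[0,1]$; explicitly $Hol_A(\gamma_t)=\exp\left(\int_{\gamma_t}A\right)=\exp(2\pi A_1(t)f^+(t)T_1)$, lying in $U(1)=\{\exp(\theta T_1)\}$. *)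

theory Defs
  imports
    "HOL-Analysis.Analysis"
    "HOL-Library.Landau_Symbols"
    "HOL-Combinatorics.Permutations"
begin

section \<open>Quaternions, \<open>SU(2)\<close> and \<open>su(2)\<close>\<close>

text \<open>
  The pair \<open>(z, w)\<close> stands for the quaternion \<open>z + w j\<close>. The product type then carries
  the standard Euclidean inner product and norm of the quaternions.
\<close>

type_synonym quat = "complex \<times> complex"

definition qmult :: "quat \<Rightarrow> quat \<Rightarrow> quat" (infixl "\<odot>" 70) where
  "a \<odot> b = (fst a * fst b - snd a * cnj (snd b), fst a * snd b + snd a * cnj (fst b))"

definition qcnj :: "quat \<Rightarrow> quat" where
  "qcnj a = (cnj (fst a), - snd a)"

definition qone :: quat where
  "qone = (1, 0)"

definition SU2 :: "quat set" where
  "SU2 = {a. norm a = 1}"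

definition su2 :: "quat set" where
  "su2 = {\<xi>. Re (fst \<xi>) = 0}"

definition su2_bracket :: "quat \<Rightarrow> quat \<Rightarrow> quat" where
  "su2_bracket \<xi> \<eta> = \<xi> \<odot> \<eta> - \<eta> \<odot> \<xi>"

text \<open>The basis \<open>i, j, k\<close>, indexed by \<open>1, 2, 3\<close>; it satisfies \<open>[T 1, T 2] = 2 T 3\<close> and cyclically.\<close>

definition T :: "nat \<Rightarrow> quat" where
  "T i = (if i = 1 then (\<i>, 0) else if i = 2 then (0, 1) else (0, \<i>))"

lemma qmult_assoc: "a \<odot> b \<odot> c = a \<odot> (b \<odot> c)"
  by (simp add: qmult_def algebra_simps)

lemma qmult_scaleR [simp]: "(r *\<^sub>R a) \<odot> b = r *\<^sub>R (a \<odot> b)" "a \<odot> (r *\<^sub>R b) = r *\<^sub>R (a \<odot> b)"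
  by (simp_all add: qmult_def scaleR_prod_def algebra_simps)

lemma qmult_minus [simp]: "(- a) \<odot> b = - (a \<odot> b)" "a \<odot> (- b) = - (a \<odot> b)"
  by (simp_all add: qmult_def)

lemma qmult_add: "(a + b) \<odot> c = a \<odot> c + b \<odot> c" "a \<odot> (b + c) = a \<odot> b + a \<odot> c"
  by (simp_all add: qmult_def algebra_simps)

lemma qmult_qone [simp]: "qone \<odot> a = a" "a \<odot> qone = a"
  by (simp_all add: qmult_def qone_def)

lemma qcnj_qmult [simp]: "qcnj (a \<odot> b) = qcnj b \<odot> qcnj a"
  by (simp add: qmult_def qcnj_def algebra_simps)

lemma qcnj_scaleR [simp]: "qcnj (r *\<^sub>R a) = r *\<^sub>R qcnj a"
  by (simp add: qcnj_def scaleR_prod_def)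

lemma qcnj_qcnj [simp]: "qcnj (qcnj a) = a"
  by (simp add: qcnj_def)

lemma norm_quat_sq: "(norm (a :: quat))\<^sup>2 = (Re (fst a))\<^sup>2 + (Im (fst a))\<^sup>2 + (Re (snd a))\<^sup>2 + (Im (snd a))\<^sup>2"
  by (cases a) (simp add: norm_Pair cmod_power2)

lemma SU2_inverse:
  assumes "a \<in> SU2"
  shows "qcnj a \<odot> a = qone" and "a \<odot> qcnj a = qone"
proof -
  have "(Re (fst a))\<^sup>2 + (Im (fst a))\<^sup>2 + (Re (snd a))\<^sup>2 + (Im (snd a))\<^sup>2 = 1"
    using assms norm_quat_sq [of a] by (simp add: SU2_def)
  then show "qcnj a \<odot> a = qone" and "a \<odot> qcnj a = qone"
    by (simp_all add: qmult_def qcnj_def qone_def complex_eq_iff power2_eq_square algebra_simps)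
qed

lemma SU2_qcnj: "a \<in> SU2 \<Longrightarrow> qcnj a \<in> SU2"
  by (simp add: SU2_def qcnj_def norm_prod_def)

lemma SU2_cancel:
  assumes "a \<in> SU2"
  shows "qcnj a \<odot> (a \<odot> b) = b" and "a \<odot> (qcnj a \<odot> b) = b"
  using SU2_inverse [OF assms] by (simp_all add: qmult_assoc [symmetric])

lemma qcnj_T [simp]: "qcnj (T i) = - T i"
  by (simp add: T_def qcnj_def)

lemma T_bracket:
  "su2_bracket (T 1) (T 2) = 2 *\<^sub>R T 3"
  "su2_bracket (T 2) (T 3) = 2 *\<^sub>R T 1"
  "su2_bracket (T 3) (T 1) = 2 *\<^sub>R T 2"
  by (simp_all add: su2_bracket_def T_def qmult_def complex_eq_iff)

lemma inner_T:
  "i \<in> {1..3} \<Longrightarrow> j \<in> {1..3} \<Longrightarrow> inner (T i) (T j) = (if i = j then 1 else 0)"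
  by (auto simp: T_def inner_complex_def)

lemma inner_qmult_T [simp]: "inner p (p \<odot> T i) = 0"
  by (simp add: T_def qmult_def inner_prod_def inner_complex_def algebra_simps)

text \<open>The exponential \<open>exp (\<theta> T\<^sub>1)\<close>, and the subgroup \<open>U(1)\<close> of \<open>SU(2)\<close> consisting of its values.\<close>

definition expT1 :: "real \<Rightarrow> quat" where
  "expT1 \<theta> = (cis \<theta>, 0)"

definition U1 :: "quat set" where
  "U1 = range expT1"


section \<open>The manifold \<open>\<real>\<^sup>4 \<times> S\<^sup>3\<close>\<close>

type_synonym point = "quat \<times> quat"

definition M :: "point set" where
  "M = UNIV \<times> SU2"

definition tangent :: "point \<Rightarrow> point set" where
  "tangent x = {X. inner (snd x) (snd X) = 0}"

definition orbit_chart :: "real \<Rightarrow> quat \<Rightarrow> quat \<Rightarrow> point" where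
  "orbit_chart t a1 a2 = (t *\<^sub>R a1, a1 \<odot> qcnj a2)"

text \<open>
  The coordinates \<open>t, a\<^sub>1, a\<^sub>2\<close> of a point off the singular orbit (inverse of \<open>orbit_chart\<close>), and
  the differentials of these functions.
\<close>

definition rad :: "point \<Rightarrow> real" where
  "rad x = norm (fst x)"

definition fib1 :: "point \<Rightarrow> quat" where
  "fib1 x = (1 / rad x) *\<^sub>R fst x"

definition fib2 :: "point \<Rightarrow> quat" where
  "fib2 x = qcnj (snd x) \<odot> fib1 x"

definition d_rad :: "point \<Rightarrow> point \<Rightarrow> real" where
  "d_rad x X = inner (fst x) (fst X) / rad x"

definition d_fib1 :: "point \<Rightarrow> point \<Rightarrow> quat" where
  "d_fib1 x X = (1 / rad x) *\<^sub>R (fst X - d_rad x X *\<^sub>R fib1 x)"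

definition d_fib2 :: "point \<Rightarrow> point \<Rightarrow> quat" where
  "d_fib2 x X = qcnj (snd X) \<odot> fib1 x + qcnj (snd x) \<odot> d_fib1 x X"

text \<open>
  The left-invariant Maurer--Cartan form of \<open>SU(2)\<^sup>2\<close> is \<open>(\<theta>\<^sub>1, \<theta>\<^sub>2)\<close> with
  \<open>\<theta>\<^sub>l = a\<^sub>l\<^sup>-\<^sup>1 da\<^sub>l\<close>. As \<open>T\<^sub>i\<^sup>\<plusminus> = (T\<^sub>i, \<plusminus> T\<^sub>i)\<close>, the dual forms \<open>\<eta>\<^sub>i\<^sup>\<plusminus>\<close> are the
  \<open>T\<^sub>i\<close>-components of \<open>(\<theta>\<^sub>1 \<plusminus> \<theta>\<^sub>2) / 2\<close>.
\<close>

definition maurer_cartan1 :: "point \<Rightarrow> point \<Rightarrow> quat" where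
  "maurer_cartan1 x X = qcnj (fib1 x) \<odot> d_fib1 x X"

definition maurer_cartan2 :: "point \<Rightarrow> point \<Rightarrow> quat" where
  "maurer_cartan2 x X = qcnj (fib2 x) \<odot> d_fib2 x X"

definition eta_plus :: "nat \<Rightarrow> point \<Rightarrow> point \<Rightarrow> real" where
  "eta_plus i x X = inner (maurer_cartan1 x X + maurer_cartan2 x X) (T i) / 2"

definition eta_minus :: "nat \<Rightarrow> point \<Rightarrow> point \<Rightarrow> real" where
  "eta_minus i x X = inner (maurer_cartan1 x X - maurer_cartan2 x X) (T i) / 2"

text \<open>
  The left-invariant vector fields generated by \<open>T\<^sub>i\<^sup>\<plusminus>\<close>: at \<open>(t, a\<^sub>1, a\<^sub>2)\<close>, the derivative at
  \<open>s = 0\<close> of the curve \<open>(t a\<^sub>1 exp (s T\<^sub>i), a\<^sub>1 exp (s T\<^sub>i) exp (\<mp> s T\<^sub>i) qcnj a\<^sub>2)\<close>.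
\<close>

definition field_plus :: "nat \<Rightarrow> point \<Rightarrow> point" where
  "field_plus i x = (fst x \<odot> T i, 0)"

definition field_minus :: "nat \<Rightarrow> point \<Rightarrow> point" where
  "field_minus i x = (fst x \<odot> T i, 2 *\<^sub>R (fib1 x \<odot> T i \<odot> qcnj (fib2 x)))"

lemma fib1_SU2: "fst x \<noteq> 0 \<Longrightarrow> fib1 x \<in> SU2"
  by (simp add: fib1_def SU2_def rad_def)

lemma qmult_SU2:
  assumes "a \<in> SU2" and "b \<in> SU2"
  shows "a \<odot> b \<in> SU2"
proof -
  have "(norm (a \<odot> b))\<^sup>2 = (norm a)\<^sup>2 * (norm b)\<^sup>2"
    unfolding norm_quat_sq by (simp add: qmult_def power2_eq_square algebra_simps)
  then show ?thesis
    using assms by (simp add: SU2_def norm_eq_sqrt_inner power2_norm_eq_inner)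
qed

lemma fib2_SU2: "x \<in> M \<Longrightarrow> fst x \<noteq> 0 \<Longrightarrow> fib2 x \<in> SU2"
  unfolding fib2_def by (intro qmult_SU2 SU2_qcnj fib1_SU2) (auto simp: M_def)

lemma orbit_chart_inverse:
  assumes "x \<in> M" and "fst x \<noteq> 0"
  shows "orbit_chart (rad x) (fib1 x) (fib2 x) = x"
proof -
  have "rad x *\<^sub>R fib1 x = fst x"
    using assms by (simp add: fib1_def rad_def)
  moreover have "fib1 x \<odot> qcnj (fib2 x) = snd x"
    using assms by (simp add: fib2_def SU2_cancel fib1_SU2)
  ultimately show ?thesis
    by (simp add: orbit_chart_def)
qed

lemma maurer_cartan_field:
  assumes "x \<in> M" and "fst x \<noteq> 0"
  shows "maurer_cartan1 x (field_plus i x) = T i" and "maurer_cartan2 x (field_plus i x) = T i"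
    and "maurer_cartan1 x (field_minus i x) = T i" and "maurer_cartan2 x (field_minus i x) = - T i"
proof -
  have r: "rad x \<noteq> 0" using assms by (simp add: rad_def)
  have a: "fib1 x \<in> SU2" and b: "fib2 x \<in> SU2"
    using assms fib1_SU2 fib2_SU2 by auto
  have d: "d_rad x (field_plus i x) = 0" "d_rad x (field_minus i x) = 0"
    by (simp_all add: d_rad_def field_plus_def field_minus_def)
  have d1: "d_fib1 x (field_plus i x) = fib1 x \<odot> T i" "d_fib1 x (field_minus i x) = fib1 x \<odot> T i"
    by (simp_all only: d_fib1_def d) (simp_all add: field_plus_def field_minus_def fib1_def)
  have e: "qcnj (snd x) \<odot> (fib1 x \<odot> T i) = fib2 x \<odot> T i"
    by (simp add: fib2_def qmult_assoc)
  have z: "qcnj 0 \<odot> c = 0" for c by (simp add: qcnj_def qmult_def zero_prod_def)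
  have d2: "d_fib2 x (field_plus i x) = fib2 x \<odot> T i"
    by (simp only: d_fib2_def d1 e) (simp add: field_plus_def z)
  have "qcnj (snd (field_minus i x)) \<odot> fib1 x = - 2 *\<^sub>R (fib2 x \<odot> T i)"
    by (simp add: field_minus_def qmult_assoc SU2_inverse [OF a])
  then have d3: "d_fib2 x (field_minus i x) = - (fib2 x \<odot> T i)"
    by (simp only: d_fib2_def d1 e) (simp add: scaleR_2)
  show "maurer_cartan1 x (field_plus i x) = T i" "maurer_cartan2 x (field_plus i x) = T i"
    "maurer_cartan1 x (field_minus i x) = T i" "maurer_cartan2 x (field_minus i x) = - T i"
    by (simp_all add: maurer_cartan1_def maurer_cartan2_def d1 d2 d3 SU2_cancel a b)
qed

lemma eta_dual:
  assumes "x \<in> M" and "fst x \<noteq> 0" and "i \<in> {1..3}" and "j \<in> {1..3}"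
  shows "eta_plus i x (field_plus j x) = (if i = j then 1 else 0)" 
    and "eta_plus i x (field_minus j x) = 0"
    and "eta_minus i x (field_plus j x) = 0" 
    and "eta_minus i x (field_minus j x) = (if i = j then 1 else 0)"
  using assms inner_T [of j i]
  by (simp_all add: eta_plus_def eta_minus_def maurer_cartan_field inner_add_left)


section \<open>Exterior algebra\<close>

text \<open>
  A \<open>k\<close>-form at a point is a function of a sequence of tangent vectors that uses the entries
  \<open>0, \<dots>, k - 1\<close> only. The normalisation is \<open>(\<alpha> \<and> \<beta>) (v, w) = \<alpha> v \<beta> w - \<alpha> w \<beta> v\<close> for one-forms.
\<close>

definition wedge ::
  "nat \<Rightarrow> nat \<Rightarrow> ((nat \<Rightarrow> 'v) \<Rightarrow> 'w::real_vector) \<Rightarrow> ((nat \<Rightarrow> 'v) \<Rightarrow> real) \<Rightarrow> (nat \<Rightarrow> 'v) \<Rightarrow> 'w" where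
  "wedge k l \<alpha> \<beta> V =
     (1 / (fact k * fact l)) *\<^sub>R
       (\<Sum>\<sigma> | \<sigma> permutes {..<k + l}.
          (of_int (sign \<sigma>) * \<beta> (\<lambda>i. V (\<sigma> (k + i)))) *\<^sub>R \<alpha> (\<lambda>i. V (\<sigma> i)))"

definition one_form :: "('v \<Rightarrow> real) \<Rightarrow> (nat \<Rightarrow> 'v) \<Rightarrow> real" where
  "one_form \<alpha> V = \<alpha> (V 0)"

definition wedge3 :: "('v \<Rightarrow> real) \<Rightarrow> ('v \<Rightarrow> real) \<Rightarrow> ('v \<Rightarrow> real) \<Rightarrow> (nat \<Rightarrow> 'v) \<Rightarrow> real" where
  "wedge3 \<alpha> \<beta> \<gamma> = wedge 2 1 (wedge 1 1 (one_form \<alpha>) (one_form \<beta>)) (one_form \<gamma>)"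

text \<open>On indices \<open>1, 2, 3\<close> this polynomial takes the values of the Levi-Civita symbol.\<close>

definition levi_civita :: "nat \<Rightarrow> nat \<Rightarrow> nat \<Rightarrow> real" where
  "levi_civita i j k = (real i - real j) * (real j - real k) * (real k - real i) / 2"


section \<open>The BGGG \<open>G\<^sub>2\<close>-structure\<close>

definition bggg_t :: "real \<Rightarrow> real" where
  "bggg_t r = integral {9/4..r} (\<lambda>s. sqrt ((s - 3/4) * (s + 3/4)) / sqrt ((s - 9/4) * (s + 9/4)))"

definition bggg_r :: "real \<Rightarrow> real" where
  "bggg_r t = (THE r. 9/4 \<le> r \<and> bggg_t r = t)"

definition bggg_A :: "nat \<Rightarrow> real \<Rightarrow> real" where
  "bggg_A i t = (let r = bggg_r t in
     if i = 1 then sqrt ((r - 9/4) * (r + 9/4)) / sqrt ((r - 3/4) * (r + 3/4))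
     else sqrt ((r - 9/4) * (r + 3/4) / 3))"

definition bggg_B :: "nat \<Rightarrow> real \<Rightarrow> real" where
  "bggg_B i t = (let r = bggg_r t in
     if i = 1 then 2 * r / 3 else sqrt ((r - 3/4) * (r + 9/4) / 3))"

definition bggg_omega :: "point \<Rightarrow> (nat \<Rightarrow> point) \<Rightarrow> real" where
  "bggg_omega x V = 4 * (\<Sum>i = 1..3. bggg_A i (rad x) * bggg_B i (rad x) *
     wedge 1 1 (one_form (eta_minus i x)) (one_form (eta_plus i x)) V)"

definition bggg_Omega2 :: "point \<Rightarrow> (nat \<Rightarrow> point) \<Rightarrow> real" where
  "bggg_Omega2 x V =
     - 8 * bggg_A 1 (rad x) * bggg_A 2 (rad x) * bggg_A 3 (rad x) *
         wedge3 (eta_plus 1 x) (eta_plus 2 x) (eta_plus 3 x) V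
     + 4 * (\<Sum>i = 1..3. \<Sum>j = 1..3. \<Sum>k = 1..3. levi_civita i j k *
         bggg_B i (rad x) * bggg_B j (rad x) * bggg_A k (rad x) *
         wedge3 (eta_minus i x) (eta_minus j x) (eta_plus k x) V)"

text \<open>The coassociative four-form \<open>\<psi> = *\<phi>\<close>, off the singular orbit.\<close>

definition bggg_psi :: "point \<Rightarrow> (nat \<Rightarrow> point) \<Rightarrow> real" where
  "bggg_psi x V =
     wedge 2 2 (bggg_omega x) (bggg_omega x) V / 2
     - wedge 1 3 (one_form (d_rad x)) (bggg_Omega2 x) V"

definition bggg_metric :: "point \<Rightarrow> point \<Rightarrow> point \<Rightarrow> real" where
  "bggg_metric x X Y = d_rad x X * d_rad x Y
     + (\<Sum>i = 1..3. (2 * bggg_A i (rad x))\<^sup>2 * eta_plus i x X * eta_plus i x Y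
                  + (2 * bggg_B i (rad x))\<^sup>2 * eta_minus i x X * eta_minus i x Y)"

text \<open>An orthonormal frame \<open>e 0, \<dots>, e 6\<close> for the metric.\<close>

definition bggg_frame :: "point \<Rightarrow> nat \<Rightarrow> point" where
  "bggg_frame x i =
     (if i = 0 then (fib1 x, 0)
      else if i \<le> 3 then (1 / (2 * bggg_A i (rad x))) *\<^sub>R field_plus i x
      else (1 / (2 * bggg_B (i - 3) (rad x))) *\<^sub>R field_minus (i - 3) x)"

lemma bggg_frame_orthonormal:
  assumes "x \<in> M" and "fst x \<noteq> 0" and "i < 7" and "j < 7"
    and "\<And>k. bggg_A k (rad x) \<noteq> 0" and "\<And>k. bggg_B k (rad x) \<noteq> 0"
  shows "bggg_metric x (bggg_frame x i) (bggg_frame x j) = (if i = j then 1 else 0)"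
proof -
  have r: "rad x \<noteq> 0" using assms by (simp add: rad_def)
  have a: "fib1 x \<in> SU2" using assms fib1_SU2 by auto
  have x: "rad x *\<^sub>R fib1 x = fst x" using r by (simp add: fib1_def)
  have dr: "d_rad x (fib1 x, 0) = 1"
    using r by (simp add: d_rad_def fib1_def rad_def dot_square_norm power2_eq_square)
  have d0: "d_rad x (c *\<^sub>R field_plus k x) = 0" "d_rad x (c *\<^sub>R field_minus k x) = 0" for c k
    by (simp_all add: d_rad_def field_plus_def field_minus_def)
  have z: "qcnj 0 = 0" "0 \<odot> c = 0" "c \<odot> 0 = 0" for c
    by (simp_all add: qcnj_def qmult_def zero_prod_def)
  have mc0: "maurer_cartan1 x (fib1 x, 0) = 0" "maurer_cartan2 x (fib1 x, 0) = 0"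
    by (simp_all add: maurer_cartan1_def maurer_cartan2_def d_fib1_def d_fib2_def dr z)
  have e0: "eta_plus k x (fib1 x, 0) = 0" "eta_minus k x (fib1 x, 0) = 0" for k
    by (simp_all add: eta_plus_def eta_minus_def mc0)
  have scd: "d_rad x (c *\<^sub>R X) = c * d_rad x X" for c X
    by (simp add: d_rad_def)
  have sc1: "d_fib1 x (c *\<^sub>R X) = c *\<^sub>R d_fib1 x X" for c X
    by (simp add: d_fib1_def scd scaleR_diff_right)
  have sc2: "d_fib2 x (c *\<^sub>R X) = c *\<^sub>R d_fib2 x X" for c X
    by (simp add: d_fib2_def sc1 scaleR_add_right)
  have sc: "eta_plus k x (c *\<^sub>R X) = c * eta_plus k x X"
    "eta_minus k x (c *\<^sub>R X) = c * eta_minus k x X" for k c X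
    by (simp_all add: eta_plus_def eta_minus_def maurer_cartan1_def maurer_cartan2_def sc1 sc2
        inner_add_left inner_diff_left algebra_simps)
  have I: "k \<in> {0, 1, 2, 3, 4, 5, 6 :: nat}" if "k < 7" for k using that by auto
  have S: "(\<Sum>k = 1..3. h k) = h 1 + h 2 + h (3 :: nat)" for h :: "nat \<Rightarrow> real"
    by (simp add: numeral_3_eq_3 numeral_2_eq_2)
  note ed = eta_dual [OF assms(1,2)]
  show ?thesis
    using I [OF assms(3)] I [OF assms(4)] assms(5,6)
    unfolding bggg_metric_def S
    by (elim insertE emptyE) (simp_all add: bggg_frame_def dr d0 e0 sc ed power2_eq_square)
qed


section \<open>Connections\<close>

primrec Ck_on :: "nat \<Rightarrow> 'a::real_normed_vector set \<Rightarrow> ('a \<Rightarrow> 'b::real_normed_vector) \<Rightarrow> bool" where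
  "Ck_on 0 S f \<longleftrightarrow> continuous_on S f"
| "Ck_on (Suc k) S f \<longleftrightarrow> (\<forall>x\<in>S. f differentiable at x) \<and>
     (\<forall>v. Ck_on k S (\<lambda>x. frechet_derivative f (at x) v))"

definition smooth_near :: "'a::real_normed_vector set \<Rightarrow> ('a \<Rightarrow> 'b::real_normed_vector) \<Rightarrow> bool" where
  "smooth_near S f \<longleftrightarrow> (\<exists>N. open N \<and> S \<subseteq> N \<and> (\<forall>k. Ck_on k N f))"

text \<open>
  The homomorphism defining \<open>P\<^sub>1\<close> is trivial on the isotropy group, so \<open>P\<^sub>1\<close> is the product bundle
  with \<open>SU(2)\<^sup>2\<close> acting trivially on the fibres, and a connection on its pullback to \<open>\<real>\<^sup>4 \<times> S\<^sup>3\<close>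
  is a smooth one-form with values in \<open>su(2)\<close>. It is represented by a one-form on a neighbourhood in
  the ambient space; only its restriction to vectors tangent to \<open>M\<close> matters.
\<close>

type_synonym conn = "point \<Rightarrow> point \<Rightarrow> quat"

definition connection_P1 :: "conn \<Rightarrow> bool" where
  "connection_P1 A \<longleftrightarrow>
     (\<forall>X. smooth_near M (\<lambda>x. A x X)) \<and>
     (\<forall>x\<in>M. linear (A x) \<and> (\<forall>X\<in>tangent x. A x X \<in> su2))"

text \<open>
  \<open>F\<^sub>A = dA + [A \<and> A] / 2\<close>. For vectors tangent to \<open>M\<close> the value does not depend on the extension of
  \<open>A\<close> off \<open>M\<close>.
\<close>

definition curvature :: "conn \<Rightarrow> point \<Rightarrow> point \<Rightarrow> point \<Rightarrow> quat" where
  "curvature A x X Y =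
     frechet_derivative (\<lambda>y. A y Y) (at x) X - frechet_derivative (\<lambda>y. A y X) (at x) Y
     + su2_bracket (A x X) (A x Y)"

definition curvature_norm :: "conn \<Rightarrow> point \<Rightarrow> real" where
  "curvature_norm A x =
     sqrt (\<Sum>j<7. \<Sum>i<j. (norm (curvature A x (bggg_frame x i) (bggg_frame x j)))\<^sup>2)"

text \<open>
  The complement of the singular orbit is dense, so imposing \<open>F\<^sub>A \<and> \<psi> = 0\<close> there imposes it everywhere.
\<close>

definition bggg_instanton :: "conn \<Rightarrow> bool" where
  "bggg_instanton A \<longleftrightarrow>
     (\<forall>x\<in>M. fst x \<noteq> 0 \<longrightarrow> (\<forall>V. (\<forall>i<6. V i \<in> tangent x) \<longrightarrow>
        wedge 2 4 (\<lambda>W. curvature A x (W 0) (W 1)) (bggg_psi x) V = 0))"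

text \<open>
  Right multiplication by \<open>(c, c)\<close>, \<open>c \<in> U(1)\<close>, is \<open>(p, q) \<mapsto> (p c, q)\<close>. Its lift to \<open>P\<^sub>1\<close> acts on the
  fibres through the inclusion of \<open>U(1)\<close> in \<open>SU(2)\<close>, whence the conjugation by \<open>c\<close>.
\<close>

definition invariant_connection :: "conn \<Rightarrow> bool" where
  "invariant_connection A \<longleftrightarrow>
     (\<forall>p q v w. (p, q) \<in> M \<longrightarrow> (v, w) \<in> tangent (p, q) \<longrightarrow>
        (\<forall>a1\<in>SU2. \<forall>a2\<in>SU2.
           A (a1 \<odot> p, a1 \<odot> q \<odot> qcnj a2) (a1 \<odot> v, a1 \<odot> w \<odot> qcnj a2) = A (p, q) (v, w)) \<and>
        (\<forall>c\<in>U1. A (p \<odot> c, q) (v \<odot> c, w) = qcnj c \<odot> A (p, q) (v, w) \<odot> c))"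

definition invariant_instanton :: "conn \<Rightarrow> bool" where
  "invariant_instanton A \<longleftrightarrow> connection_P1 A \<and> invariant_connection A \<and> bggg_instanton A"


section \<open>Holonomy and irreducibility\<close>

text \<open>
  The order of the factors is the one compatible with \<open>F\<^sub>A = dA + [A \<and> A] / 2\<close>, and the sign is such
  that the holonomy is \<open>exp (\<integral> A)\<close> when \<open>A\<close> takes commuting values along the path.
\<close>

definition transport :: "conn \<Rightarrow> (real \<Rightarrow> point) \<Rightarrow> (real \<Rightarrow> quat) \<Rightarrow> bool" where
  "transport A \<gamma> u \<longleftrightarrow> u 0 = qone \<and> continuous_on {0..1} u \<and>
     (\<exists>S. finite S \<and> (\<forall>s\<in>{0..1} - S. \<gamma> differentiable at s \<and>
        (u has_vector_derivative (u s \<odot> A (\<gamma> s) (vector_derivative \<gamma> (at s)))) (at s within {0..1})))"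

definition holonomy :: "conn \<Rightarrow> (real \<Rightarrow> point) \<Rightarrow> quat" where
  "holonomy A \<gamma> = (THE h. \<exists>u. transport A \<gamma> u \<and> h = u 1)"

definition holonomy_group :: "conn \<Rightarrow> point \<Rightarrow> quat set" where
  "holonomy_group A x = {h. \<exists>\<gamma> u. valid_path \<gamma> \<and> path_image \<gamma> \<subseteq> M \<and>
     pathstart \<gamma> = x \<and> pathfinish \<gamma> = x \<and> transport A \<gamma> u \<and> h = u 1}"

definition irreducible_connection :: "conn \<Rightarrow> bool" where
  "irreducible_connection A \<longleftrightarrow> (\<forall>x\<in>M. holonomy_group A x = SU2)"

text \<open>The circle \<open>\<gamma>\<^sub>t (\<theta>) = (t, exp (2 \<pi> \<theta> T\<^sub>1\<^sup>+))\<close>.\<close>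

definition circle_at :: "real \<Rightarrow> real \<Rightarrow> point" where
  "circle_at t \<theta> = orbit_chart t (expT1 (2 * pi * \<theta>)) (expT1 (2 * pi * \<theta>))"


section \<open>The moduli space and its parametrization\<close>

definition invariant_gauge :: "(point \<Rightarrow> quat) \<Rightarrow> bool" where
  "invariant_gauge u \<longleftrightarrow> smooth_near M u \<and> (\<forall>x\<in>M. u x \<in> SU2) \<and>
     (\<forall>p q. (p, q) \<in> M \<longrightarrow>
        (\<forall>a1\<in>SU2. \<forall>a2\<in>SU2. u (a1 \<odot> p, a1 \<odot> q \<odot> qcnj a2) = u (p, q)) \<and>
        (\<forall>c\<in>U1. u (p \<odot> c, q) = qcnj c \<odot> u (p, q) \<odot> c))"

definition gauge_equivalent :: "conn \<Rightarrow> conn \<Rightarrow> bool" where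
  "gauge_equivalent A B \<longleftrightarrow> (\<exists>u. invariant_gauge u \<and>
     (\<forall>x\<in>M. \<forall>X\<in>tangent x.
        B x X = qcnj (u x) \<odot> A x X \<odot> u x + qcnj (u x) \<odot> frechet_derivative u (at x) X))"

definition irreducible_instantons :: "conn set" where
  "irreducible_instantons = {A. invariant_instanton A \<and> irreducible_connection A}"

definition gauge_rel :: "(conn \<times> conn) set" where
  "gauge_rel = {(A, B). A \<in> irreducible_instantons \<and> B \<in> irreducible_instantons \<and> gauge_equivalent A B}"

definition moduli_space :: "conn set set" where
  "moduli_space = irreducible_instantons // gauge_rel"

text \<open>
  The invariant instanton with parameters \<open>(f\<^sub>1\<^sup>+, g\<^sub>1\<^sup>+) = \<pi>\<close>, in the normal form
  \<open>A\<^sub>1 f\<^sup>+ T\<^sub>1 \<otimes> \<eta>\<^sub>1\<^sup>+ + A\<^sub>2 g\<^sup>+ (T\<^sub>2 \<otimes> \<eta>\<^sub>2\<^sup>+ + T\<^sub>3 \<otimes> \<eta>\<^sub>3\<^sup>+)\<close>. The differential equations for \<open>f\<^sup>+\<close> and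
  \<open>g\<^sup>+\<close> are not repeated, being the instanton equation for a connection of this form.
\<close>

definition instanton_at :: "real \<times> real \<Rightarrow> conn \<Rightarrow> bool" where
  "instanton_at \<pi> A \<longleftrightarrow> invariant_instanton A \<and>
     (\<exists>f g :: real \<Rightarrow> real.
        (\<lambda>t. f t - fst \<pi> * t) \<in> O[at_right 0](\<lambda>t. t ^ 3) \<and>
        (\<lambda>t. g t - snd \<pi> * t) \<in> O[at_right 0](\<lambda>t. t ^ 3) \<and>
        (\<forall>x\<in>M. fst x \<noteq> 0 \<longrightarrow> (\<forall>X\<in>tangent x.
           A x X = (bggg_A 1 (rad x) * f (rad x) * eta_plus 1 x X) *\<^sub>R T 1
                 + (bggg_A 2 (rad x) * g (rad x)) *\<^sub>R
                     (eta_plus 2 x X *\<^sub>R T 2 + eta_plus 3 x X *\<^sub>R T 3))))"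

definition gauge_class_at :: "real \<times> real \<Rightarrow> conn set" where
  "gauge_class_at \<pi> = {B. \<exists>A. instanton_at \<pi> A \<and> (A, B) \<in> gauge_rel}"

definition quadratic_curvature_decay :: "conn \<Rightarrow> bool" where
  "quadratic_curvature_decay A \<longleftrightarrow>
     (\<exists>C R. \<forall>x\<in>M. R \<le> rad x \<longrightarrow> curvature_norm A x \<le> C / (rad x)\<^sup>2)"

end

theory Submission
  imports Defs "HOL-Real_Asymp.Real_Asymp"
begin

text \<open>
  In the coordinate \<open>z = 4/3 r - 3\<close> and after dividing \<open>f\<^sup>+\<close> and \<open>g\<^sup>+\<close> by suitable weights, the instanton equations
  are a regular system \<open>\<phi>' = - \<kappa>(z) w\<^sup>2\<close>, \<open>w' = - 3/4 \<phi> w\<close> with \<open>\<phi>(0) = 2 f\<^sub>1\<^sup>+\<close>, \<open>w(0)\<close> proportional to \<open>g\<^sub>1\<^sup>+\<close>,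
  and \<open>0 \<le> \<kappa>(z) \<le> exp (3 z / 2)\<close>. As long as \<open>\<phi> \<ge> 2\<close>, \<open>w\<close> decays like \<open>exp (- 3 z / 2)\<close>, so that
  \<open>\<kappa> w\<^sup>2\<close> is integrable. Hence for \<open>\<phi>(0) > 3\<close> and small \<open>w(0)\<close> the integral equation for \<open>\<phi>\<close> is a contraction on bounded
  functions on the half-line; its fixed point gives an instanton on all of \<open>\<real>\<^sup>4 \<times> S\<^sup>3\<close>. There
  \<open>f\<^sup>+\<close> stays bounded and \<open>g\<^sup>+\<close> decays exponentially, which yields quadratic curvature decay. The
  holonomy at infinity is \<open>exp (2 \<pi> \<phi>(\<infinity>) T\<^sub>1)\<close>, where \<open>\<phi>(\<infinity>)\<close> depends continuously on \<open>\<phi>(0)\<close> and differs from it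
  by at most \<open>1\<close>; so it takes all values in an interval of length \<open>1\<close>.
\<close>

section \<open>Smooth functions\<close>

text \<open>A connection on the bundle must be smooth on an open set around \<open>M\<close>, also
  across the singular orbit, which \<open>t\<close> and \<open>z\<close> approach from one side
  only. Its coefficients are therefore treated as functions of \<open>s = t\<^sup>2\<close>, which
  is smooth and increasing in \<open>z\<close> even for slightly negative \<open>z\<close>, and the
  flow is solved on an interval reaching below 0. The theorem speaks of every instanton with given
  parameters, not only of the constructed one, so uniqueness matters as much as existence:
  \<open>instanton_at\<close> assumes no regularity of \<open>f\<close> and \<open>g\<close>, hence
  their differentiability is read off from the connection, and connections that agree on vectors
  tangent to \<open>M\<close> must be shown to have equal curvature. The thresholds come from one
  balance: \<open>\<phi> \<ge> 2\<close> gives \<open>L z \<ge> 2 z\<close> for the antiderivative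
  \<open>L\<close>, so that \<open>exp (- 3/2 * L z)\<close> beats the growth
  \<open>exp (3 z / 2)\<close> of the coefficient, and \<open>w(0)\<^sup>2 \<le> 1/8\<close> keeps
  the change of \<open>\<phi>\<close> on the half-line below 1 and the contraction constant below
  1/2.\<close>

lemma Ck_on_cong:
  assumes "open S" "\<And>x. x \<in> S \<Longrightarrow> f x = g x" "Ck_on k S f"
  shows "Ck_on k S g"
  using assms(2,3)
proof (induction k arbitrary: f g)
  case 0
  then show ?case using continuous_on_eq by auto
next
  case (Suc k)
  have d: "\<forall>x\<in>S. f differentiable at x" using Suc.prems by simp
  then have "\<forall>x\<in>S. g differentiable at x"
    using has_derivative_transform_within_open[OF _ assms(1) _ Suc.prems(1)]
    unfolding differentiable_def by fast
  moreover have "Ck_on k S (\<lambda>x. frechet_derivative g (at x) v)" for v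
  proof (rule Suc.IH)
    show "Ck_on k S (\<lambda>x. frechet_derivative f (at x) v)" using Suc.prems(2) by simp
    show "frechet_derivative f (at x) v = frechet_derivative g (at x) v" if "x \<in> S" for x
      using frechet_derivative_transform_within_open[of f x S g] d assms(1) that Suc.prems(1) by auto
  qed
  ultimately show ?case by simp
qed

text \<open>\<open>Ck_on\<close> is phrased with \<open>frechet_derivative\<close>; this rule
  accepts any explicit derivative instead, so that each closure property below is one induction on
  the order.\<close>

lemma Ck_on_SucI:
  assumes "open S" "\<And>x. x \<in> S \<Longrightarrow> (f has_derivative f' x) (at x)" "\<And>v. Ck_on k S (\<lambda>x. f' x v)"
  shows "Ck_on (Suc k) S f"
proof -
  have "f' x = frechet_derivative f (at x)" if "x \<in> S" for x
    by (rule frechet_derivative_at[OF assms(2)[OF that]])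
  note e = this
  have "Ck_on k S (\<lambda>x. frechet_derivative f (at x) v)" for v
    by (rule Ck_on_cong[OF assms(1) _ assms(3)[of v]]) (simp add: e)
  moreover have "\<forall>x\<in>S. f differentiable at x" using differentiableI[OF assms(2)] by simp
  ultimately show ?thesis by simp
qed

lemma Ck_on_SucD:
  assumes "Ck_on (Suc k) S f"
  shows "x \<in> S \<Longrightarrow> (f has_derivative frechet_derivative f (at x)) (at x)"
    and "Ck_on k S (\<lambda>x. frechet_derivative f (at x) v)"
  using assms by (simp_all add: frechet_derivative_works[symmetric])

lemma Ck_on_Suc_imp: "Ck_on (Suc k) S f \<Longrightarrow> Ck_on k S f"
proof (induction k arbitrary: f)
  case 0
  then show ?case
    by (auto intro!: continuous_at_imp_continuous_on differentiable_imp_continuous_within)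
next
  case (Suc k)
  show ?case
    using Suc.prems Suc.IH unfolding Ck_on.simps(2)[of "Suc k"] Ck_on.simps(2)[of k] by blast
qed

lemma Ck_on_const: "Ck_on k S (\<lambda>x. c)"
  by (induction k arbitrary: c) (auto simp: frechet_derivative_const)

lemma (in bounded_linear) Ck_on_linear: "open S \<Longrightarrow> Ck_on k S f"
proof (cases k)
  case 0 then show ?thesis by (simp add: linear_continuous_on bounded_linear_axioms)
next
  case (Suc n)
  assume "open S"
  then show ?thesis unfolding Suc
    by (rule Ck_on_SucI[OF _ bounded_linear_imp_has_derivative[OF bounded_linear_axioms] Ck_on_const])
qed

lemma Ck_on_add:
  assumes "open S"
  shows "Ck_on k S f \<Longrightarrow> Ck_on k S g \<Longrightarrow> Ck_on k S (\<lambda>x. f x + g x)"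
proof (induction k arbitrary: f g)
  case 0 then show ?case by (simp add: continuous_on_add)
next
  case (Suc k)
  show ?case
  proof (rule Ck_on_SucI[OF assms, of _ "\<lambda>x v. frechet_derivative f (at x) v + frechet_derivative g (at x) v"])
    show "((\<lambda>x. f x + g x) has_derivative (\<lambda>v. frechet_derivative f (at x) v + frechet_derivative g (at x) v)) (at x)"
      if "x \<in> S" for x
      by (rule has_derivative_add[OF Ck_on_SucD(1)[OF Suc.prems(1) that] Ck_on_SucD(1)[OF Suc.prems(2) that]])
    show "Ck_on k S (\<lambda>x. frechet_derivative f (at x) v + frechet_derivative g (at x) v)" for v
      by (rule Suc.IH[OF Ck_on_SucD(2)[OF Suc.prems(1)] Ck_on_SucD(2)[OF Suc.prems(2)]])
  qed
qed

text \<open>One product rule serves real products, scaling, inner products and quaternion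
  multiplication. Both factors stay arbitrary in the induction because the derivative pairs each
  function with the derivative of the other.\<close>

lemma (in bounded_bilinear) Ck_on_bilinear:
  assumes "open S"
  shows "Ck_on k S f \<Longrightarrow> Ck_on k S g \<Longrightarrow> Ck_on k S (\<lambda>x. prod (f x) (g x))"
proof (induction k arbitrary: f g)
  case 0 then show ?case by (simp add: continuous_on)
next
  case (Suc k)
  show ?case
  proof (rule Ck_on_SucI[OF assms, of _ "\<lambda>x v. prod (f x) (frechet_derivative g (at x) v) + prod (frechet_derivative f (at x) v) (g x)"])
    show "((\<lambda>x. prod (f x) (g x)) has_derivative
       (\<lambda>v. prod (f x) (frechet_derivative g (at x) v) + prod (frechet_derivative f (at x) v) (g x))) (at x)" if "x \<in> S" for x
      by (rule FDERIV[OF Ck_on_SucD(1)[OF Suc.prems(1) that] Ck_on_SucD(1)[OF Suc.prems(2) that]])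
    show "Ck_on k S (\<lambda>x. prod (f x) (frechet_derivative g (at x) v) + prod (frechet_derivative f (at x) v) (g x))" for v
      by (rule Ck_on_add[OF assms Suc.IH[OF Ck_on_Suc_imp[OF Suc.prems(1)] Ck_on_SucD(2)[OF Suc.prems(2)]]
            Suc.IH[OF Ck_on_SucD(2)[OF Suc.prems(1)] Ck_on_Suc_imp[OF Suc.prems(2)]]])
  qed
qed

lemmas Ck_on_mult = bounded_bilinear.Ck_on_bilinear[OF bounded_bilinear_mult]
lemmas Ck_on_scaleR = bounded_bilinear.Ck_on_bilinear[OF bounded_bilinear_scaleR]
lemmas Ck_on_inner = bounded_bilinear.Ck_on_bilinear[OF bounded_bilinear_inner]

lemma Ck_on_minus:
  assumes "open S" "Ck_on k S f" shows "Ck_on k S (\<lambda>x. - f x)"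
  using Ck_on_scaleR[OF assms(1) Ck_on_const[of k S "-1::real"] assms(2)] by simp

lemma Ck_on_ident: "open S \<Longrightarrow> Ck_on k S (\<lambda>x. x)"
  by (rule bounded_linear.Ck_on_linear[OF bounded_linear_ident])

lemma Ck_on_subset: "Ck_on k R f \<Longrightarrow> S \<subseteq> R \<Longrightarrow> Ck_on k S f"
proof (induction k arbitrary: f)
  case 0 then show ?case by (simp add: continuous_on_subset)
next
  case (Suc k)
  then show ?case unfolding Ck_on.simps(2) by blast
qed

text \<open>With a real outer function the chain rule is a product of the inner derivative with
  \<open>g'\<close> composed with \<open>f\<close>, so the induction stays within composites of the
  same shape.\<close>

lemma Ck_on_compose:
  fixes g :: "real \<Rightarrow> real"
  assumes "open S" "open R"
  shows "Ck_on k R g \<Longrightarrow> Ck_on k S f \<Longrightarrow> (\<And>x. x \<in> S \<Longrightarrow> f x \<in> R) \<Longrightarrow> Ck_on k S (\<lambda>x. g (f x))"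
proof (induction k arbitrary: g)
  case 0
  then show ?case by (auto intro!: continuous_on_compose2[of R g S f])
next
  case (Suc k)
  show ?case
  proof (rule Ck_on_SucI[OF assms(1), of _ "\<lambda>x v. frechet_derivative f (at x) v * frechet_derivative g (at (f x)) 1"])
    fix x assume x: "x \<in> S"
    have 1: "(g has_derivative frechet_derivative g (at (f x))) (at (f x))"
      using Ck_on_SucD(1)[OF Suc.prems(1)] Suc.prems(3)[OF x] by auto
    have "((\<lambda>x. g (f x)) has_derivative (\<lambda>v. frechet_derivative g (at (f x)) (frechet_derivative f (at x) v))) (at x)"
      by (rule has_derivative_compose[OF Ck_on_SucD(1)[OF Suc.prems(2) x] 1])
    moreover have "(\<lambda>v. frechet_derivative g (at (f x)) (frechet_derivative f (at x) v)) =
        (\<lambda>v. frechet_derivative f (at x) v * frechet_derivative g (at (f x)) 1)"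
    proof (rule ext)
      fix v show "frechet_derivative g (at (f x)) (frechet_derivative f (at x) v) =
          frechet_derivative f (at x) v * frechet_derivative g (at (f x)) 1"
        using linear_cmul[OF has_derivative_linear[OF 1], of "frechet_derivative f (at x) v" 1] by simp
    qed
    ultimately show "((\<lambda>x. g (f x)) has_derivative (\<lambda>v. frechet_derivative f (at x) v * frechet_derivative g (at (f x)) 1)) (at x)"
      by (rule subst[rotated, where P = "\<lambda>h. (_ has_derivative h) _"])
  next
    show "Ck_on k S (\<lambda>x. frechet_derivative f (at x) v * frechet_derivative g (at (f x)) 1)" for v
      by (rule Ck_on_mult[OF assms(1) Ck_on_SucD(2)[OF Suc.prems(2)]
            Suc.IH[OF Ck_on_SucD(2)[OF Suc.prems(1)] Ck_on_Suc_imp[OF Suc.prems(2)] Suc.prems(3)]])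
  qed
qed

lemma Ck_on_Suc_realI:
  fixes f :: "real \<Rightarrow> real"
  assumes "open S" "\<And>x. x \<in> S \<Longrightarrow> (f has_real_derivative f' x) (at x)" "Ck_on k S f'"
  shows "Ck_on (Suc k) S f"
proof (rule Ck_on_SucI[OF assms(1), of _ "\<lambda>x v. f' x * v"])
  show "(f has_derivative (\<lambda>v. f' x * v)) (at x)" if "x \<in> S" for x
    using assms(2)[OF that] by (simp add: has_field_derivative_def)
  show "Ck_on k S (\<lambda>x. f' x * v)" for v
    by (rule Ck_on_mult[OF assms(1,3) Ck_on_const])
qed

lemma Ck_on_Suc_realD:
  fixes f :: "real \<Rightarrow> real"
  assumes "Ck_on (Suc k) S f"
  shows "x \<in> S \<Longrightarrow> (f has_real_derivative frechet_derivative f (at x) 1) (at x)"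
proof -
  assume x: "x \<in> S"
  note 1 = Ck_on_SucD(1)[OF assms x]
  have "frechet_derivative f (at x) u = frechet_derivative f (at x) 1 * u" for u
    using linear_cmul[OF has_derivative_linear[OF 1], of u 1] by (simp add: mult.commute)
  then have "frechet_derivative f (at x) = (*) (frechet_derivative f (at x) 1)" by (rule ext)
  from subst[OF this, where P = "\<lambda>h. (_ has_derivative h) _", OF 1] show ?thesis unfolding has_field_derivative_def .
qed

text \<open>The derivative is an expression in the function itself, so smoothness lifts itself by
  one order at each step; \<open>sqrt\<close> and \<open>exp\<close> follow the same
  pattern.\<close>

lemma Ck_on_inverse_real: "Ck_on k ({0<..} :: real set) inverse"
proof (induction k)
  case 0 show ?case by (auto intro!: continuous_intros)
next
  case (Suc k)
  have "Ck_on k {0<..} (\<lambda>x::real. - (inverse x * inverse x))"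
    by (rule Ck_on_minus[OF _ Ck_on_mult[OF _ Suc Suc]]) auto
  moreover have "(inverse has_real_derivative - (inverse x * inverse x)) (at x)" if "x \<in> {0<..}" for x :: real
    using that by (auto intro!: derivative_eq_intros)
  ultimately show ?case by (intro Ck_on_Suc_realI[OF open_greaterThan]) auto
qed

lemma Ck_on_inverse: fixes f :: "'a::real_normed_vector \<Rightarrow> real"
  assumes "open S" "Ck_on k S f" "\<And>x. x \<in> S \<Longrightarrow> 0 < f x"
  shows "Ck_on k S (\<lambda>x. inverse (f x))"
  using Ck_on_compose[OF assms(1) open_greaterThan Ck_on_inverse_real assms(2)] assms(3) by simp

lemma Ck_on_sqrt_real: "Ck_on k ({0<..} :: real set) sqrt"
proof (induction k)
  case 0 show ?case by (auto intro!: continuous_intros)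
next
  case (Suc k)
  have "Ck_on k {0<..} (\<lambda>x::real. inverse (sqrt x) * (1/2))"
    by (rule Ck_on_mult[OF _ Ck_on_inverse[OF _ Suc] Ck_on_const]) auto
  moreover have "(sqrt has_real_derivative inverse (sqrt x) * (1/2)) (at x)" if "x \<in> {0<..}" for x :: real
    using that by (auto intro!: derivative_eq_intros)
  ultimately show ?case by (intro Ck_on_Suc_realI[OF open_greaterThan]) auto
qed

lemma Ck_on_exp_real: "Ck_on k (UNIV :: real set) exp"
proof (induction k)
  case 0 show ?case by (auto intro!: continuous_intros)
next
  case (Suc k)
  show ?case by (rule Ck_on_Suc_realI[OF open_UNIV DERIV_exp Suc])
qed

lemma Ck_on_exp: fixes f :: "'a::real_normed_vector \<Rightarrow> real"
  assumes "open S" "Ck_on k S f" shows "Ck_on k S (\<lambda>x. exp (f x))"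
  using Ck_on_compose[OF assms(1) open_UNIV Ck_on_exp_real assms(2)] by simp

lemma Ck_on_sqrt: fixes f :: "'a::real_normed_vector \<Rightarrow> real"
  assumes "open S" "Ck_on k S f" "\<And>x. x \<in> S \<Longrightarrow> 0 < f x"
  shows "Ck_on k S (\<lambda>x. sqrt (f x))"
  using Ck_on_compose[OF assms(1) open_greaterThan Ck_on_sqrt_real assms(2)] assms(3) by simp

lemma Ck_on_divide: fixes f :: "'a::real_normed_vector \<Rightarrow> real"
  assumes "open S" "Ck_on k S f" "Ck_on k S g" "\<And>x. x \<in> S \<Longrightarrow> 0 < g x"
  shows "Ck_on k S (\<lambda>x. f x / g x)"
  unfolding divide_inverse by (rule Ck_on_mult[OF assms(1,2) Ck_on_inverse[OF assms(1,3,4)]])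

lemma Ck_on_power: fixes f :: "'a::real_normed_vector \<Rightarrow> real"
  assumes "open S" "Ck_on k S f" shows "Ck_on k S (\<lambda>x. f x ^ n)"
proof (induction n)
  case 0 show ?case by (simp add: Ck_on_const)
next
  case (Suc n) show ?case using Ck_on_mult[OF assms Suc] by simp
qed

section \<open>Wedge products of one-forms\<close>

text \<open>The Leibniz formula for the determinant of the matrix of values of the one-forms on the
  vectors. It represents an iterated wedge product by a list, so that \<open>wedge\<close> becomes
  concatenation.\<close>

definition det_form :: "('v \<Rightarrow> real) list \<Rightarrow> (nat \<Rightarrow> 'v) \<Rightarrow> real" where
  "det_form as V = (\<Sum>\<sigma> | \<sigma> permutes {..<length as}. of_int (sign \<sigma>) * (\<Prod>i<length as. (as ! i) (V (\<sigma> i))))"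

lemma det_form_single: "one_form a = det_form [a]"
  by (rule ext) (auto simp: one_form_def det_form_def lessThan_Suc)

text \<open>
  For fixed \<open>\<tau>\<close> and \<open>\<rho>\<close> in the inner sums, reindex the outer sum by the permutation \<open>\<tau> \<oplus> \<rho>\<close>.
\<close>

lemma wedge_det_form:
  "wedge (length as) (length bs) (det_form as) (det_form bs) V = det_form (as @ bs) V"
proof -
  let ?k = "length as" and ?l = "length bs"
  define P where "P n = {\<sigma>. \<sigma> permutes {..<n::nat}}" for n
  define j where "j \<rho> = map_permutation {..<?l} ((+) ?k) \<rho>" for \<rho>
  have bij: "bij_betw ((+) ?k) {..<?l} {?k..<?k + ?l}"
    by (simp add: bij_betw_def lessThan_atLeast0 add.commute)
  have inj: "inj_on ((+) ?k) {..<?l}" by simp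
  have jp: "j \<rho> permutes {?k..<?k + ?l}" if "\<rho> \<in> P ?l" for \<rho>
    unfolding j_def using map_permutation_permutes[OF bij] that by (auto simp: P_def)
  have jP: "j \<rho> permutes {..<?k + ?l}" if "\<rho> \<in> P ?l" for \<rho>
    using jp[OF that] by (rule permutes_subset) auto
  have tP: "\<tau> permutes {..<?k + ?l}" if "\<tau> \<in> P ?k" for \<tau>
    using that by (auto simp: P_def intro: permutes_subset)
  have sj: "sign (j \<rho>) = sign \<rho>" if "\<rho> \<in> P ?l" for \<rho>
    unfolding j_def using that by (intro sign_map_permutation) (auto simp: P_def)
  have jlt: "j \<rho> i = i" if "\<rho> \<in> P ?l" "i < ?k" for \<rho> i
    using permutes_not_in[OF jp[OF that(1)]] that(2) by auto
  have jge: "j \<rho> (?k + i) = ?k + \<rho> i" if "i < ?l" for \<rho> i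
    unfolding j_def using that by (intro map_permutation_apply) auto
  have tge: "\<tau> (?k + i) = ?k + i" if "\<tau> \<in> P ?k" for \<tau> i
    using that permutes_not_in[of \<tau> "{..<?k}" "?k + i"] by (auto simp: P_def)
  define t where "t \<sigma> = of_int (sign \<sigma>) * (\<Prod>i<?k + ?l. ((as @ bs) ! i) (V (\<sigma> i)))" for \<sigma>
  have key: "of_int (sign \<sigma>) * (of_int (sign \<rho>) * (\<Prod>i<?l. (bs ! i) (V (\<sigma> (?k + \<rho> i))))) *
       (of_int (sign \<tau>) * (\<Prod>i<?k. (as ! i) (V (\<sigma> (\<tau> i))))) = t (\<sigma> \<circ> (\<tau> \<circ> j \<rho>))"
    if s: "\<sigma> \<in> P (?k + ?l)" and t: "\<tau> \<in> P ?k" and r: "\<rho> \<in> P ?l" for \<sigma> \<tau> \<rho>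
  proof -
    have perm: "permutation \<sigma>" "permutation \<tau>" "permutation (j \<rho>)"
      using s t jP[OF r] by (auto simp: P_def intro: permutes_imp_permutation[rotated])
    have sg: "sign (\<sigma> \<circ> (\<tau> \<circ> j \<rho>)) = sign \<sigma> * (sign \<tau> * sign \<rho>)"
      using perm sj[OF r] by (simp add: sign_compose permutation_compose)
    have "(\<Prod>i<?k + ?l. ((as @ bs) ! i) (V ((\<sigma> \<circ> (\<tau> \<circ> j \<rho>)) i))) =
      (\<Prod>i<?k. ((as @ bs) ! i) (V ((\<sigma> \<circ> (\<tau> \<circ> j \<rho>)) i))) * (\<Prod>i<?l. ((as @ bs) ! (?k + i)) (V ((\<sigma> \<circ> (\<tau> \<circ> j \<rho>)) (?k + i))))"
    proof -
      have "{..<?k + ?l} = {..<?k} \<union> (+) ?k ` {..<?l}" using bij by (auto simp: bij_betw_def)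
      moreover have "{..<?k} \<inter> (+) ?k ` {..<?l} = {}" by auto
      ultimately show ?thesis
        using prod.union_disjoint[of "{..<?k}" "(+) ?k ` {..<?l}" "\<lambda>i. ((as @ bs) ! i) (V ((\<sigma> \<circ> (\<tau> \<circ> j \<rho>)) i))"]
        by (simp add: prod.reindex[OF inj] o_def)
    qed
    also have "\<dots> = (\<Prod>i<?k. (as ! i) (V (\<sigma> (\<tau> i)))) * (\<Prod>i<?l. (bs ! i) (V (\<sigma> (?k + \<rho> i))))"
      using jlt[OF r] jge tge[OF t] by (auto simp: nth_append intro!: arg_cong2[of _ _ _ _ "(*)"] prod.cong)
    finally show ?thesis by (simp add: t_def sg)
  qed
  have re: "(\<Sum>\<sigma>\<in>P (?k + ?l). t (\<sigma> \<circ> \<kappa>)) = (\<Sum>\<sigma>\<in>P (?k + ?l). t \<sigma>)" if "\<kappa> permutes {..<?k + ?l}" for \<kappa>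
    unfolding P_def by (rule sum.reindex_bij_betw[OF bij_betw_byWitness[where f' = "\<lambda>\<sigma>. \<sigma> \<circ> inv \<kappa>"]])
     (use that in \<open>auto simp: comp_assoc permutes_inv_o simp del: comp_apply intro!: permutes_compose permutes_inv\<close>)
  have cP: "card (P n) = fact n" for n unfolding P_def by (rule card_permutations) auto
  define c :: real where "c = 1 / (fact ?k * fact ?l)"
  have "wedge ?k ?l (det_form as) (det_form bs) V = c *
     (\<Sum>\<sigma>\<in>P (?k + ?l). \<Sum>\<rho>\<in>P ?l. \<Sum>\<tau>\<in>P ?k. of_int (sign \<sigma>) * (of_int (sign \<rho>) * (\<Prod>i<?l. (bs ! i) (V (\<sigma> (?k + \<rho> i))))) *
       (of_int (sign \<tau>) * (\<Prod>i<?k. (as ! i) (V (\<sigma> (\<tau> i))))))"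
    unfolding wedge_def det_form_def P_def c_def[symmetric]
    by (simp add: sum_distrib_left sum_distrib_right mult_ac)
  also have "\<dots> = c * (\<Sum>\<sigma>\<in>P (?k + ?l). \<Sum>\<rho>\<in>P ?l. \<Sum>\<tau>\<in>P ?k. t (\<sigma> \<circ> (\<tau> \<circ> j \<rho>)))"
    by (intro arg_cong2[of _ _ _ _ "(*)"] sum.cong refl key)
  also have "\<dots> = c * (\<Sum>\<rho>\<in>P ?l. \<Sum>\<sigma>\<in>P (?k + ?l). \<Sum>\<tau>\<in>P ?k. t (\<sigma> \<circ> (\<tau> \<circ> j \<rho>)))"
    by (intro arg_cong2[of _ _ _ _ "(*)"] refl sum.swap)
  also have "\<dots> = c * (\<Sum>\<rho>\<in>P ?l. \<Sum>\<tau>\<in>P ?k. \<Sum>\<sigma>\<in>P (?k + ?l). t (\<sigma> \<circ> (\<tau> \<circ> j \<rho>)))"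
    by (intro arg_cong2[of _ _ _ _ "(*)"] refl sum.cong sum.swap)
  also have "\<dots> = c * (\<Sum>\<rho>\<in>P ?l. \<Sum>\<tau>\<in>P ?k. \<Sum>\<sigma>\<in>P (?k + ?l). t \<sigma>)"
    by (intro arg_cong2[of _ _ _ _ "(*)"] sum.cong refl re permutes_compose jP tP)
  \<comment> \<open>The two outer sums now have \<open>k! * l!\<close> equal terms, which cancels
    the normalisation in \<open>wedge\<close>.\<close>
  also have "\<dots> = (\<Sum>\<sigma>\<in>P (?k + ?l). t \<sigma>)" by (simp add: cP c_def)
  finally show ?thesis by (simp add: t_def det_form_def P_def)
qed

text \<open>Composing with the transposition of the two neighbouring positions flips every sign and
  exchanges the two factors. Adjacent swaps are enough to sort lists of indices by
  rewriting.\<close>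

lemma det_form_swap:
  "det_form (xs @ a # b # ys) V = - det_form (xs @ b # a # ys) V"
proof -
  define n where "n = length (xs @ a # b # ys)"
  define i where "i = length xs"
  define \<kappa> where "\<kappa> = Transposition.transpose i (Suc i)"
  have lt: "i < n" "Suc i < n" by (auto simp: n_def i_def)
  have kp: "\<kappa> permutes {..<n}" unfolding \<kappa>_def using lt by (intro permutes_swap_id) auto
  have sk: "sign \<kappa> = -1" by (simp add: \<kappa>_def sign_swap_id)
  have kk: "\<kappa> \<circ> \<kappa> = id" by (simp add: \<kappa>_def)
  define h where "h zs \<sigma> = real_of_int (sign \<sigma>) * (\<Prod>i<n. (zs ! i) (V (\<sigma> i)))" for zs :: "('a \<Rightarrow> real) list" and \<sigma>
  have nk: "(xs @ b # a # ys) ! (\<kappa> m) = (xs @ a # b # ys) ! m" for m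
  proof -
    consider "m = i" | "m = Suc i" | "m \<noteq> i" "m \<noteq> Suc i" by blast
    then show ?thesis
    proof cases
      case 3
      then have "m < i \<or> m - i > 1" by auto
      then show ?thesis using 3 by (auto simp: \<kappa>_def i_def nth_append nth_Cons' transpose_apply_other)
    qed (simp_all add: \<kappa>_def i_def nth_append)
  qed
  have "h (xs @ a # b # ys) (\<sigma> \<circ> \<kappa>) = - h (xs @ b # a # ys) \<sigma>" if "\<sigma> permutes {..<n}" for \<sigma>
  proof -
    have "sign (\<sigma> \<circ> \<kappa>) = - sign \<sigma>"
      using sk kp that by (subst sign_compose) (auto intro: permutes_imp_permutation[rotated])
    moreover have "(\<Prod>m<n. ((xs @ a # b # ys) ! m) (V ((\<sigma> \<circ> \<kappa>) m))) = (\<Prod>m<n. ((xs @ b # a # ys) ! m) (V (\<sigma> m)))"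
      by (subst (2) prod.permute[OF kp]) (simp add: nk o_def)
    ultimately show ?thesis by (simp add: h_def)
  qed
  moreover have "(\<Sum>\<sigma> | \<sigma> permutes {..<n}. h (xs @ a # b # ys) (\<sigma> \<circ> \<kappa>)) = (\<Sum>\<sigma> | \<sigma> permutes {..<n}. h (xs @ a # b # ys) \<sigma>)"
    by (rule sum.reindex_bij_betw[OF bij_betw_byWitness[where f' = "\<lambda>\<sigma>. \<sigma> \<circ> \<kappa>"]])
      (use kp in \<open>auto intro!: permutes_compose simp: comp_assoc kk simp del: comp_apply\<close>)
  ultimately have "(\<Sum>\<sigma> | \<sigma> permutes {..<n}. h (xs @ a # b # ys) \<sigma>) = - (\<Sum>\<sigma> | \<sigma> permutes {..<n}. h (xs @ b # a # ys) \<sigma>)"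
    by (simp add: sum_negf[symmetric])
  then show ?thesis by (simp add: det_form_def h_def n_def)
qed

lemma wedge_add_left: "wedge k l (\<lambda>V. \<alpha> V + \<beta> V) \<gamma> W = wedge k l \<alpha> \<gamma> W + wedge k l \<beta> \<gamma> W"
  by (simp add: wedge_def scaleR_add_right sum.distrib)

lemma wedge_scale_left: "wedge k l (\<lambda>V. c *\<^sub>R \<alpha> V) \<gamma> W = c *\<^sub>R wedge k l \<alpha> \<gamma> W"
  by (simp add: wedge_def scaleR_sum_right mult_ac)

lemma wedge_vector_left: "wedge k l (\<lambda>V. \<alpha> V *\<^sub>R x) \<gamma> W = wedge k l \<alpha> \<gamma> W *\<^sub>R x"
  by (simp add: wedge_def scaleR_sum_left[symmetric] scaleR_sum_right[symmetric] mult_ac)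

lemma wedge_add_right: "wedge k l \<gamma> (\<lambda>V. \<alpha> V + \<beta> V) W = wedge k l \<gamma> \<alpha> W + wedge k l \<gamma> \<beta> W"
  by (simp add: wedge_def scaleR_add_right sum.distrib algebra_simps)

lemma wedge_scale_right: "wedge k l \<gamma> (\<lambda>V. c * \<alpha> V) W = c *\<^sub>R wedge k l \<gamma> \<alpha> W"
  by (simp add: wedge_def scaleR_sum_right mult_ac)

text \<open>Allows the curvature to be replaced by its explicit formula, which holds for tangent
  vectors only.\<close>

lemma wedge_cong_left:
  assumes "\<And>\<sigma>. \<sigma> permutes {..<k + l} \<Longrightarrow> \<alpha> (\<lambda>i. V (\<sigma> i)) = \<beta> (\<lambda>i. V (\<sigma> i))"
  shows "wedge k l \<alpha> \<gamma> V = wedge k l \<beta> \<gamma> V"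
  unfolding wedge_def using assms by (intro arg_cong2[of _ _ _ _ scaleR] sum.cong) auto

lemma det_form_pair: "det_form [a, b] V = a (V 0) * b (V 1) - a (V 1) * b (V 0)"
proof -
  have "det_form [a, b] V = wedge 1 1 (det_form [a]) (det_form [b]) V"
    using wedge_det_form[of "[a]" "[b]" V] by simp
  also have "\<dots> = a (V 0) * b (V 1) - a (V 1) * b (V 0)"
  proof -
    have e: "{\<sigma>. \<sigma> permutes {..<2::nat}} = {id, Transposition.transpose 0 1}"
    proof -
      have "{..<2::nat} = insert 1 {0}" by auto
      then show ?thesis by (auto simp: permutes_doubleton_iff Transposition.transpose_commute)
    qed
    have ne: "id \<noteq> Transposition.transpose (0::nat) 1" by (metis id_apply transpose_apply_first zero_neq_one)
    show ?thesis
      unfolding wedge_def one_add_one e using ne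
      by (simp add: sign_swap_id det_form_single[symmetric] one_form_def mult.commute)
  qed
  finally show ?thesis .
qed

text \<open>Only the identity permutation survives on a dual basis. This is what later separates the
  coefficients of the curvature wedged with \<open>bggg_psi\<close>.\<close>

lemma det_form_dual:
  assumes "\<And>i j. i < length as \<Longrightarrow> j < length as \<Longrightarrow> (as ! i) (V j) = (if i = j then 1 else 0)"
  shows "det_form as V = 1"
proof -
  have "(\<Prod>i<length as. (as ! i) (V (\<sigma> i))) = (if \<sigma> = id then 1 else 0)" if "\<sigma> permutes {..<length as}" for \<sigma>
  proof (cases "\<sigma> = id")
    case True then show ?thesis using assms by simp
  next
    case False
    then obtain i where i: "\<sigma> i \<noteq> i" by (auto simp: fun_eq_iff)
    then have il: "i < length as" using permutes_not_in[OF that, of i] by auto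
    then have "\<sigma> i < length as" using permutes_in_image[OF that, of i] by auto
    then have "(as ! i) (V (\<sigma> i)) = 0" using assms[OF il, of "\<sigma> i"] i by auto
    then show ?thesis using False il by (auto intro!: prod_zero)
  qed
  then have "det_form as V = (\<Sum>\<sigma> | \<sigma> permutes {..<length as}. if \<sigma> = id then 1 else 0)"
    unfolding det_form_def by (intro sum.cong) auto
  also have "\<dots> = 1" by (subst sum.delta) (auto simp: finite_permutations permutes_id)
  finally show ?thesis .
qed

section \<open>The regularised instanton equations\<close>

text \<open>
  Put \<open>z = 4/3 r - 3\<close>, \<open>f\<^sup>+ = A\<^sub>1 \<phi>\<close> and \<open>A\<^sub>2 g\<^sup>+ = g_weight z w\<close>, where \<open>g_weight\<close> (defined below) solves the
  equation of \<open>A\<^sub>2 g\<^sup>+\<close> for \<open>f\<^sup>+ = 0\<close>. The instanton equations, singular at \<open>t = 0\<close>, then become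
  \<open>\<phi>' = - flow_coeff z w\<^sup>2\<close> and \<open>w' = - 3/4 \<phi> w\<close>, which are regular at \<open>z = 0\<close>.
\<close>

definition flow_coeff :: "real \<Rightarrow> real" where
  "flow_coeff z = 4 * (z + 2) * exp (3 * z / 2) / ((z + 3) * (z + 6) ^ 5)"

lemma flow_coeff_bounds:
  assumes "-1 < z"
  shows "0 \<le> flow_coeff z" "flow_coeff z \<le> exp (3 * z / 2)"
proof -
  show "0 \<le> flow_coeff z" using assms by (simp add: flow_coeff_def)
  have "(5::real) ^ 5 \<le> (z + 6) ^ 5" using assms by (intro power_mono) auto
  then have "4 * 1 \<le> (z + 6) ^ 5" by simp
  then have "4 * (z + 2) \<le> (z + 3) * (z + 6) ^ 5"
    using mult_mono[of "z + 2" "z + 3" 4 "(z + 6) ^ 5"] assms by (simp add: mult.commute)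
  then have "4 * (z + 2) * exp (3 * z / 2) \<le> exp (3 * z / 2) * ((z + 3) * (z + 6) ^ 5)"
    by (simp add: mult.commute)
  then show "flow_coeff z \<le> exp (3 * z / 2)"
    unfolding flow_coeff_def using assms by (subst pos_divide_le_eq) auto
qed

lemma continuous_on_flow_coeff: "continuous_on {-1<..} flow_coeff"
  unfolding flow_coeff_def by (intro continuous_intros) auto

lemma exp_diff_le:
  fixes a b :: real
  assumes "m \<le> a" "m \<le> b"
  shows "\<bar>exp (- a) - exp (- b)\<bar> \<le> exp (- m) * \<bar>a - b\<bar>"
proof -
  have *: "exp (- a) - exp (- b) \<le> exp (- m) * (b - a)" if "a \<le> b" "m \<le> a" for a b
  proof -
    have "1 - exp (- (b - a)) \<le> b - a" using exp_ge_add_one_self[of "-(b - a)"] by linarith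
    then have "exp (- a) * (1 - exp (- (b - a))) \<le> exp (- a) * (b - a)" by (intro mult_left_mono) auto
    also have "\<dots> \<le> exp (- m) * (b - a)" using that by (intro mult_right_mono) auto
    finally show ?thesis by (simp add: right_diff_distrib mult_exp_exp)
  qed
  consider "a \<le> b" | "b \<le> a" by linarith
  then show ?thesis
  proof cases
    case 1 then show ?thesis using *[OF 1 assms(1)] by simp
  next
    case 2 then show ?thesis using *[OF 2 assms(2)] by simp
  qed
qed

lemma DERIV_bound_interval:
  fixes f g f' g' :: "real \<Rightarrow> real"
  assumes "a \<le> b" "continuous_on {a..b} f" "continuous_on {a..b} g"
    and "\<And>x. a < x \<Longrightarrow> x < b \<Longrightarrow> (f has_real_derivative f' x) (at x)"
    and "\<And>x. a < x \<Longrightarrow> x < b \<Longrightarrow> (g has_real_derivative g' x) (at x)"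
    and "\<And>x. a < x \<Longrightarrow> x < b \<Longrightarrow> \<bar>f' x\<bar> \<le> g' x"
  shows "\<bar>f b - f a\<bar> \<le> g b - g a"
proof (cases "a = b")
  case False
  then show ?thesis
    using differentiable_bound_general[of a b f g f' g'] assms
    by (simp add: has_real_derivative_iff_has_vector_derivative)
qed simp

section \<open>Existence of the flow by contraction\<close>

text \<open>The base point \<open>b \<le> 0\<close> allows negative arguments.\<close>

definition antider :: "real \<Rightarrow> (real \<Rightarrow> real) \<Rightarrow> real \<Rightarrow> real" where
  "antider b g z = integral {b..z} g - integral {b..0} g"

lemma antider_0 [simp]: "antider b g 0 = 0"
  by (simp add: antider_def)

lemma antider_cont:
  assumes "continuous_on {b..} g"
  shows "continuous_on {b..} (antider b g)"
proof -
  have "continuous (at z within {b..}) (\<lambda>z. integral {b..z} g)" if "z \<in> {b..}" for z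
  proof -
    have "continuous_on {b..z+1} (\<lambda>z. integral {b..z} g)"
      using assms by (intro indefinite_integral_continuous_1 integrable_continuous_real)
        (auto intro: continuous_on_subset)
    then have "continuous (at z within {b..z+1}) (\<lambda>z. integral {b..z} g)"
      using that by (simp add: continuous_on_eq_continuous_within)
    moreover have "at z within {b..z+1} = at z within {b..}"
      by (rule at_within_nhd[of _ "{..<z+1}"]) auto
    ultimately show ?thesis by simp
  qed
  then have "continuous_on {b..} (\<lambda>z. integral {b..z} g)"
    by (simp add: continuous_on_eq_continuous_within)
  then show ?thesis unfolding antider_def by (intro continuous_intros)
qed

lemma antider_deriv:
  assumes "continuous_on {b..} g" "b < z"
  shows "(antider b g has_real_derivative g z) (at z)"
proof -
  have "((\<lambda>z. integral {b..z} g) has_real_derivative g z) (at z within {b..z+1})"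
    using assms by (intro integral_has_real_derivative) (auto intro: continuous_on_subset)
  then have "((\<lambda>z. integral {b..z} g) has_real_derivative g z) (at z)"
    using assms(2) at_within_Icc_at[of b z "z+1"] by simp
  then show ?thesis unfolding antider_def[abs_def]
    by (auto intro!: derivative_eq_intros)
qed

text \<open>The bound 2 gives \<open>L1 y, L2 y \<ge> 2 * y\<close>, so the two exponentials differ
  by at most \<open>exp (- (3 * y)) * (3/2 * (D * y))\<close>, and the coefficient costs
  \<open>exp (3 * y / 2)\<close>; what is left is integrable with total \<open>3 * c * D\<close>. It
  yields both the contraction and the dependence on the initial value.\<close>

lemma flow_diff:
  fixes f1 f2 L1 L2 u1 u2 :: "real \<Rightarrow> real"
  assumes "0 \<le> c" "0 \<le> z"
    and L: "continuous_on {0..} L1" "continuous_on {0..} L2" "L1 0 = 0" "L2 0 = 0"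
      "\<And>y. 0 < y \<Longrightarrow> (L1 has_real_derivative f1 y) (at y)"
      "\<And>y. 0 < y \<Longrightarrow> (L2 has_real_derivative f2 y) (at y)"
    and f: "\<And>y. 0 < y \<Longrightarrow> 2 \<le> f1 y" "\<And>y. 0 < y \<Longrightarrow> 2 \<le> f2 y"
      "\<And>y. 0 < y \<Longrightarrow> \<bar>f1 y - f2 y\<bar> \<le> D"
    and u: "continuous_on {0..} u1" "continuous_on {0..} u2"
      "\<And>y. 0 < y \<Longrightarrow> (u1 has_real_derivative - c * flow_coeff y * exp (- (3/2 * L1 y))) (at y)"
      "\<And>y. 0 < y \<Longrightarrow> (u2 has_real_derivative - c * flow_coeff y * exp (- (3/2 * L2 y))) (at y)"
  shows "\<bar>(u1 z - u2 z) - (u1 0 - u2 0)\<bar> \<le> 3 * c * D"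
proof -
  have D: "0 \<le> D" using f(3)[of 1] by linarith
  have Lge: "2 * y \<le> L y" if "0 \<le> y" "continuous_on {0..} L" "L 0 = 0"
     "\<And>y. 0 < y \<Longrightarrow> (L has_real_derivative f y) (at y)" "\<And>y. 0 < y \<Longrightarrow> 2 \<le> f y" for L f y
  proof -
    have "L 0 - 2 * 0 \<le> L y - 2 * y"
    proof (rule DERIV_nonneg_imp_increasing_open[of 0 y "\<lambda>y. L y - 2 * y"])
      show "\<exists>d. ((\<lambda>y. L y - 2 * y) has_real_derivative d) (at x) \<and> 0 \<le> d" if "0 < x" "x < y" for x
        using \<open>\<And>y. 0 < y \<Longrightarrow> (L has_real_derivative f y) (at y)\<close>[OF that(1)] \<open>\<And>y. 0 < y \<Longrightarrow> 2 \<le> f y\<close>[OF that(1)]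
        by (intro exI[of _ "f x - 2"]) (auto intro!: derivative_eq_intros)
      show "continuous_on {0..y} (\<lambda>y. L y - 2 * y)"
        by (intro continuous_intros continuous_on_subset[OF that(2)]) auto
    qed (use that in auto)
    then show ?thesis using that by simp
  qed
  have Ldiff: "\<bar>L1 y - L2 y\<bar> \<le> D * y" if "0 \<le> y" for y
  proof -
    have "\<bar>(L1 y - L2 y) - (L1 0 - L2 0)\<bar> \<le> D * y - D * 0"
    proof (rule DERIV_bound_interval[where f' = "\<lambda>y. f1 y - f2 y" and g' = "\<lambda>y. D" and f = "\<lambda>y. L1 y - L2 y"])
      show "continuous_on {0..y} (\<lambda>y. L1 y - L2 y)"
        by (intro continuous_intros continuous_on_subset[OF L(1)] continuous_on_subset[OF L(2)]) auto
    qed (use that f L in \<open>auto intro!: derivative_eq_intros continuous_intros\<close>)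
    then show ?thesis using L by simp
  qed
  have "\<bar>(u1 z - u2 z) - (u1 0 - u2 0)\<bar> \<le> - (3 * c * D) * exp (- z / 2) - (- (3 * c * D) * exp (- 0 / 2))"
  proof (rule DERIV_bound_interval[where f' = "\<lambda>y. - c * flow_coeff y * exp (- (3/2 * L1 y)) - (- c * flow_coeff y * exp (- (3/2 * L2 y)))"
        and g' = "\<lambda>y. (3/2 * c * D) * exp (- y / 2)" and f = "\<lambda>y. u1 y - u2 y"])
    show "continuous_on {0..z} (\<lambda>y. u1 y - u2 y)"
      by (intro continuous_intros continuous_on_subset[OF u(1)] continuous_on_subset[OF u(2)]) auto
    show "((\<lambda>y. u1 y - u2 y) has_real_derivative - c * flow_coeff y * exp (- (3/2 * L1 y)) - (- c * flow_coeff y * exp (- (3/2 * L2 y)))) (at y)" if "0 < y" for y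
      by (intro DERIV_diff u that)
    show "((\<lambda>y. - (3 * c * D) * exp (- y / 2)) has_real_derivative (3/2 * c * D) * exp (- y / 2)) (at y)" for y
      by (auto intro!: derivative_eq_intros)
    fix y :: real assume y: "0 < y"
    have l: "2 * y \<le> L1 y" "2 * y \<le> L2 y"
      using Lge[of y L1 f1] Lge[of y L2 f2] y L f by auto
    have "\<bar>exp (- (3/2 * L1 y)) - exp (- (3/2 * L2 y))\<bar> \<le> exp (- (3 * y)) * \<bar>3/2 * L1 y - 3/2 * L2 y\<bar>"
      using l by (intro exp_diff_le) auto
    also have "\<dots> \<le> exp (- (3 * y)) * (3/2 * (D * y))"
      using Ldiff[of y] y by (intro mult_left_mono, linarith) simp
    \<comment> \<open>The linear factor is paid for with one \<open>exp y\<close>, which still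
      leaves \<open>exp (- y / 2)\<close> to integrate.\<close>
    also have "y \<le> exp y" using exp_ge_add_one_self[of y] by linarith
    then have "exp (- (3 * y)) * (3/2 * (D * y)) \<le> exp (- (3 * y)) * (3/2 * (D * exp y))"
      using D by (intro mult_left_mono) auto
    finally have 1: "\<bar>exp (- (3/2 * L1 y)) - exp (- (3/2 * L2 y))\<bar> \<le> exp (- (3 * y)) * (3/2 * (D * exp y))" .
    have "\<bar>- c * flow_coeff y * exp (- (3/2 * L1 y)) - (- c * flow_coeff y * exp (- (3/2 * L2 y)))\<bar>
       = c * (flow_coeff y * \<bar>exp (- (3/2 * L1 y)) - exp (- (3/2 * L2 y))\<bar>)"
    proof -
      have "- c * flow_coeff y * exp (- (3/2 * L1 y)) - (- c * flow_coeff y * exp (- (3/2 * L2 y)))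
         = - (c * flow_coeff y * (exp (- (3/2 * L1 y)) - exp (- (3/2 * L2 y))))" by (simp add: algebra_simps)
      then show ?thesis using assms(1) flow_coeff_bounds(1)[of y] y by (simp only: abs_minus_cancel abs_mult) simp
    qed
    also have "\<dots> \<le> c * (exp (3 * y / 2) * (exp (- (3 * y)) * (3/2 * (D * exp y))))"
      using assms(1) flow_coeff_bounds[of y] y 1 by (intro mult_left_mono mult_mono) auto
    also have "\<dots> = (3/2 * c * D) * (exp (3 * y / 2) * (exp (- (3 * y)) * exp y))" by simp
    also have "exp (3 * y / 2) * (exp (- (3 * y)) * exp y) = exp (- y / 2)"
      by (simp add: mult_exp_exp)
    finally show "\<bar>- c * flow_coeff y * exp (- (3/2 * L1 y)) - (- c * flow_coeff y * exp (- (3/2 * L2 y)))\<bar> \<le> (3/2 * c * D) * exp (- y / 2)" .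
  qed (use assms in \<open>auto intro!: continuous_intros\<close>)
  also have "\<dots> \<le> 3 * c * D" using assms(1) D by simp
  finally show ?thesis .
qed

text \<open>
  A solution of the regular initial value problem to which the instanton equations reduce,
  on an interval \<open>(b, \<infinity>)\<close> containing \<open>0\<close>.
\<close>

definition flow :: "real \<Rightarrow> real \<Rightarrow> real \<Rightarrow> (real \<Rightarrow> real) \<Rightarrow> (real \<Rightarrow> real) \<Rightarrow> bool" where
  "flow p0 w0 b \<phi> L \<longleftrightarrow> -1 < b \<and> b < 0 \<and> \<phi> 0 = p0 \<and> L 0 = 0 \<and>
    (\<forall>z>b. (\<phi> has_real_derivative - (w0\<^sup>2) * flow_coeff z * exp (- (3/2 * L z))) (at z)) \<and>
    (\<forall>z>b. (L has_real_derivative \<phi> z) (at z)) \<and>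
    (\<forall>z>b. 2 \<le> \<phi> z \<and> \<phi> z \<le> p0 + 1) \<and> (\<forall>z\<ge>0. p0 - 1 \<le> \<phi> z)"

text \<open>Solving the equation of \<open>w\<close> by an exponential of the antiderivative
  \<open>L\<close> of \<open>\<phi>\<close> leaves one integral equation for \<open>\<phi>\<close>;
  the map \<open>Q\<close> is its right-hand side, iterated on functions with values in
  \<open>{2..p0+1}\<close>.\<close>

lemma flow_exists:
  fixes p0 w0 :: real
  assumes p0: "3 \<le> p0" and w0: "w0\<^sup>2 \<le> 1/8"
  shows "\<exists>b \<phi> L. flow p0 w0 b \<phi> L"
proof -
  \<comment> \<open>A function bounded by \<open>p0 + 1\<close> that vanishes at 0 after integration
    is then at least -1 on \<open>[b, 0]\<close>, and \<open>p0 \<ge> 3\<close> makes this interval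
    no longer than 1/4.\<close>
  define b where "b = - 1 / (p0 + 1)"
  have b: "-1 < b" "b < 0" "- b * (p0 + 1) = 1" "- b \<le> 1/4" using p0 by (auto simp: b_def field_simps)
  define c where "c = w0\<^sup>2"
  have c: "0 \<le> c" "c \<le> 1/8" using w0 by (auto simp: c_def)
  define h where "h f y = c * flow_coeff y * exp (- (3/2 * antider b f y))" for f y
  define S where "S = {f :: real \<Rightarrow>\<^sub>C real. \<forall>x. apply_bcontfun f x \<in> {2..p0+1}}"
  \<comment> \<open>\<open>max b z\<close> freezes the function to the left of \<open>b\<close>, so
    that the iteration takes place in the complete space of bounded continuous functions on the
    whole line.\<close>
  define Q where "Q f z = p0 - antider b (h f) (max b z)" for f z
  define P where "P f = Bcontfun (Q (apply_bcontfun f))" for f :: "real \<Rightarrow>\<^sub>C real"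
  have kc: "continuous_on {b..} flow_coeff"
    using b(1) by (intro continuous_on_subset[OF continuous_on_flow_coeff]) auto
  have hc: "continuous_on {b..} (h f)" if "continuous_on {b..} f" for f
    unfolding h_def[abs_def] using antider_cont[OF that] kc by (intro continuous_intros)
  have Qc: "continuous_on UNIV (Q f)" if "continuous_on {b..} f" for f
  proof -
    have "continuous_on UNIV (\<lambda>z. antider b (h f) (max b z))"
      by (rule continuous_on_compose2[OF antider_cont[OF hc[OF that]]]) (auto intro!: continuous_intros)
    then show ?thesis unfolding Q_def[abs_def] by (intro continuous_intros)
  qed
  have Qd: "(Q f has_real_derivative - h f z) (at z)" if "continuous_on {b..} f" "b < z" for f z
  proof -
    have "((\<lambda>z. p0 - antider b (h f) z) has_real_derivative - h f z) (at z)"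
      using antider_deriv[OF hc[OF that(1)] that(2)] by (auto intro!: derivative_eq_intros)
    then show ?thesis
      by (rule has_field_derivative_transform_within_open[where S = "{b<..}"]) (use that in \<open>auto simp: Q_def\<close>)
  qed
  have Q0: "Q f 0 = p0" for f using b by (simp add: Q_def)
  have e32: "exp (3/2 :: real) \<le> 9"
  proof -
    have "exp (3/2 :: real) \<le> exp 1 * exp 1" by (simp add: mult_exp_exp)
    also have "\<dots> \<le> 3 * 3" using exp_le by (intro mult_mono) auto
    finally show ?thesis by simp
  qed
  have Lpos: "2 * y \<le> antider b f y" if "continuous_on {b..} f" "\<And>y. 2 \<le> f y" "0 \<le> y" for f y
  proof -
    have "antider b f 0 - 2 * 0 \<le> antider b f y - 2 * y"
    proof (rule DERIV_nonneg_imp_increasing_open[of 0 y "\<lambda>y. antider b f y - 2 * y"])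
      show "\<exists>d. ((\<lambda>y. antider b f y - 2 * y) has_real_derivative d) (at x) \<and> 0 \<le> d" if "0 < x" for x
        using antider_deriv[OF \<open>continuous_on {b..} f\<close>, of x] that b \<open>\<And>y. 2 \<le> f y\<close>[of x]
        by (intro exI[of _ "f x - 2"]) (auto intro!: derivative_eq_intros)
      show "continuous_on {0..y} (\<lambda>y. antider b f y - 2 * y)"
        using b by (intro continuous_intros continuous_on_subset[OF antider_cont[OF that(1)]]) auto
    qed (use that in auto)
    then show ?thesis by simp
  qed
  have Lneg: "- 1 \<le> antider b f y" if "continuous_on {b..} f" "\<And>y. 2 \<le> f y" "\<And>y. f y \<le> p0 + 1" "b \<le> y" "y \<le> 0" for f y
  proof -
    have "\<bar>antider b f 0 - antider b f y\<bar> \<le> (p0 + 1) * 0 - (p0 + 1) * y"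
    proof (rule DERIV_bound_interval[where f' = f and g' = "\<lambda>_. p0 + 1"])
      show "continuous_on {y..0} (antider b f)"
        using that by (intro continuous_on_subset[OF antider_cont[OF that(1)]]) auto
      show "(antider b f has_real_derivative f x) (at x)" if "y < x" for x
        using that \<open>b \<le> y\<close> by (intro antider_deriv \<open>continuous_on {b..} f\<close>) auto
      show "\<bar>f x\<bar> \<le> p0 + 1" for x using that(2,3)[of x] by auto
    qed (use that in \<open>auto intro!: continuous_intros derivative_eq_intros\<close>)
    also have "\<dots> = (p0 + 1) * - y" by simp
    also have "\<dots> \<le> (p0 + 1) * - b" using that p0 by (intro mult_left_mono) auto
    also have "\<dots> = 1" using b(3) by (simp add: mult.commute)
    finally show ?thesis by simp
  qed
  \<comment> \<open>On \<open>[b, 0]\<close> the coefficient is at most 1 and the exponential at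
    most \<open>exp (3/2) \<le> 9\<close>, so the slope is at most 9/8 over a length of at most
    1/4.\<close>
  have Qbound_neg: "\<bar>Q f z - p0\<bar> \<le> 9/32" if f: "continuous_on {b..} f" "\<And>y. 2 \<le> f y" "\<And>y. f y \<le> p0 + 1" and z: "z \<le> 0" for f z
  proof -
    let ?z = "max b z"
    have "\<bar>Q f 0 - Q f ?z\<bar> \<le> 9/8 * 0 - 9/8 * ?z"
    proof (rule DERIV_bound_interval[where f' = "\<lambda>y. - h f y" and g' = "\<lambda>_. 9/8"])
      show "continuous_on {?z..0} (Q f)" using continuous_on_subset[OF Qc[OF f(1)]] by auto
      show "(Q f has_real_derivative - h f x) (at x)" if "?z < x" for x
        using that by (intro Qd f) auto
      fix x assume x: "?z < x" "x < 0"
      have "exp (- (3/2 * antider b f x)) \<le> exp (3/2)" using Lneg[OF f, of x] x by auto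
      then have e: "exp (- (3/2 * antider b f x)) \<le> 9" using e32 by linarith
      have "flow_coeff x \<le> exp (3 * x / 2)" using flow_coeff_bounds[of x] x b by auto
      also have "\<dots> \<le> 1" using x by simp
      finally have k: "0 \<le> flow_coeff x" "flow_coeff x \<le> 1" using flow_coeff_bounds[of x] x b by auto
      have "h f x \<le> (1/8 * 1) * 9" unfolding h_def using k e c by (intro mult_mono) auto
      moreover have "0 \<le> h f x" using k c by (simp add: h_def)
      ultimately show "\<bar>- h f x\<bar> \<le> 9/8" by simp
    qed (use z b in \<open>auto intro!: continuous_intros derivative_eq_intros\<close>)
    also have "\<dots> \<le> 9/8 * (1/4)" using b by auto
    finally show ?thesis using Q0[of f] by (simp add: Q_def)
  qed
  \<comment> \<open>The slope is at most \<open>exp (- x)\<close>, so the total change on the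
    half-line is at most 1 and the value stays above \<open>p0 - 1 \<ge> 2\<close>.\<close>
  have Qbound_pos: "\<bar>Q f z - p0\<bar> \<le> 1" if f: "continuous_on {b..} f" "\<And>y. 2 \<le> f y" and z: "0 \<le> z" for f z
  proof -
    have "\<bar>Q f z - Q f 0\<bar> \<le> - exp (- z) - (- exp (- 0))"
    proof (rule DERIV_bound_interval[where f' = "\<lambda>y. - h f y" and g' = "\<lambda>y. exp (- y)"])
      show "continuous_on {0..z} (Q f)" using continuous_on_subset[OF Qc[OF f(1)]] by auto
      show "(Q f has_real_derivative - h f x) (at x)" if "0 < x" for x
        using that b by (intro Qd f) auto
      fix x :: real assume x: "0 < x"
      have "exp (- (3/2 * antider b f x)) \<le> exp (- (3 * x))" using Lpos[OF f, of x] x by auto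
      then have "flow_coeff x * exp (- (3/2 * antider b f x)) \<le> exp (3 * x / 2) * exp (- (3 * x))"
        using flow_coeff_bounds[of x] x by (intro mult_mono) auto
      also have "\<dots> \<le> exp (- x)" using x by (simp add: mult_exp_exp)
      finally have "c * (flow_coeff x * exp (- (3/2 * antider b f x))) \<le> 1 * exp (- x)"
        using c flow_coeff_bounds[of x] x by (intro mult_mono) auto
      moreover have "0 \<le> c * (flow_coeff x * exp (- (3/2 * antider b f x)))" using c flow_coeff_bounds[of x] x by simp
      ultimately show "\<bar>- h f x\<bar> \<le> exp (- x)" by (simp add: h_def mult.assoc)
    qed (use z in \<open>auto intro!: continuous_intros derivative_eq_intros\<close>)
    then show ?thesis using Q0[of f] by simp (smt (verit) exp_ge_zero)
  qed
  have Qbound: "Q f z \<in> {2..p0+1}" if f: "continuous_on {b..} f" "\<And>y. 2 \<le> f y" "\<And>y. f y \<le> p0 + 1" for f z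
    using Qbound_neg[OF f, of z] Qbound_pos[OF f(1,2), of z] p0 by (cases "0 \<le> z") auto
  have S: "continuous_on {b..} f" "2 \<le> apply_bcontfun f y" "apply_bcontfun f y \<le> p0 + 1" if "f \<in> S" for f y
    using that continuous_on_subset[OF continuous_on_apply_bcontfun] by (auto simp: S_def)
  have PQ: "apply_bcontfun (P f) z = Q f z" if "f \<in> S" for f z
  proof -
    have "\<bar>Q f x\<bar> \<le> p0 + 1" for x
      using Qbound[OF S[OF that], of x] by auto
    then have "Q f \<in> bcontfun"
      using Qc[OF S(1)[OF that]] by (auto simp: bcontfun_def intro!: boundedI[of _ "p0 + 1"])
    then show ?thesis by (simp add: P_def Bcontfun_inverse)
  qed
  \<comment> \<open>The factors are \<open>3 * c \<le> 3/8\<close> on the half-line, and on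
    \<open>[b, 0]\<close> the slope \<open>1/8 * 9 * 3/2 = 27/16\<close> times the length 1/4, that
    is 27/64.\<close>
  have Qdiff: "\<bar>Q f z - Q g z\<bar> \<le> 1/2 * D"
    if f: "continuous_on {b..} f" "\<And>y. 2 \<le> f y" "\<And>y. f y \<le> p0 + 1"
      and g: "continuous_on {b..} g" "\<And>y. 2 \<le> g y" "\<And>y. g y \<le> p0 + 1"
      and D: "\<And>y. \<bar>f y - g y\<bar> \<le> D" for f g D z
  proof (cases "0 \<le> z")
    case True
    have "\<bar>(Q f z - Q g z) - (Q f 0 - Q g 0)\<bar> \<le> 3 * c * D"
    proof (rule flow_diff[OF c(1) True])
      show "continuous_on {0..} (antider b f)" "continuous_on {0..} (antider b g)"
        using b by (auto intro: continuous_on_subset[OF antider_cont[OF f(1)]] continuous_on_subset[OF antider_cont[OF g(1)]])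
      show "(antider b f has_real_derivative f y) (at y)" "(antider b g has_real_derivative g y) (at y)" if "0 < y" for y
        using that b f g by (auto intro: antider_deriv)
      show "continuous_on {0..} (Q f)" "continuous_on {0..} (Q g)"
        using continuous_on_subset[OF Qc] f g by auto
      show "(Q f has_real_derivative - c * flow_coeff y * exp (- (3 / 2 * antider b f y))) (at y)"
           "(Q g has_real_derivative - c * flow_coeff y * exp (- (3 / 2 * antider b g y))) (at y)" if "0 < y" for y
        using Qd[OF f(1), of y] Qd[OF g(1), of y] that b by (auto simp: h_def)
    qed (use f g D in auto)
    moreover have "3 * c * D \<le> 1/2 * D" using c D[of 0] by (intro mult_right_mono) auto
    ultimately show ?thesis by (simp add: Q0)
  next
    case False
    let ?z = "max b z"
    have z: "b \<le> ?z" "?z \<le> 0" using False b by auto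
    have D0: "0 \<le> D" using D[of 0] by linarith
    have Ld: "\<bar>antider b f y - antider b g y\<bar> \<le> D" if "b \<le> y" "y \<le> 0" for y
    proof -
      have "\<bar>(antider b f 0 - antider b g 0) - (antider b f y - antider b g y)\<bar> \<le> D * 0 - D * y"
      proof (rule DERIV_bound_interval[where f' = "\<lambda>y. f y - g y" and g' = "\<lambda>y. D" and f = "\<lambda>y. antider b f y - antider b g y"])
        show "continuous_on {y..0} (\<lambda>y. antider b f y - antider b g y)"
          using that by (intro continuous_intros continuous_on_subset[OF antider_cont[OF f(1)]] continuous_on_subset[OF antider_cont[OF g(1)]]) auto
        show "((\<lambda>y. antider b f y - antider b g y) has_real_derivative f x - g x) (at x)" if "y < x" for x
          using that \<open>b \<le> y\<close> f g by (intro DERIV_diff antider_deriv) auto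
      qed (use that D in \<open>auto intro!: derivative_eq_intros continuous_intros\<close>)
      also have "\<dots> = D * - y" by simp
      also have "\<dots> \<le> D * 1" using that b D0 by (intro mult_left_mono) auto
      finally show ?thesis by simp
    qed
    have "\<bar>(Q f 0 - Q g 0) - (Q f ?z - Q g ?z)\<bar> \<le> (27/16 * D) * 0 - (27/16 * D) * ?z"
    proof (rule DERIV_bound_interval[where f' = "\<lambda>y. - h f y - - h g y" and g' = "\<lambda>y. 27/16 * D" and f = "\<lambda>y. Q f y - Q g y"])
      show "continuous_on {?z..0} (\<lambda>y. Q f y - Q g y)"
        using continuous_on_subset[OF Qc] f g by (intro continuous_intros) auto
      show "((\<lambda>y. Q f y - Q g y) has_real_derivative - h f y - - h g y) (at y)" if "?z < y" for y
        using that f g by (intro DERIV_diff Qd) auto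
      fix y assume y: "?z < y" "y < 0"
      have yb: "b \<le> y" "y \<le> 0" using y by auto
      have "\<bar>exp (- (3/2 * antider b f y)) - exp (- (3/2 * antider b g y))\<bar> \<le> exp (- (- (3/2))) * \<bar>3/2 * antider b f y - 3/2 * antider b g y\<bar>"
        using Lneg[OF f yb] Lneg[OF g yb] by (intro exp_diff_le) auto
      also have "\<dots> \<le> 9 * (3/2 * D)"
        using e32 Ld[OF yb] D0 by (intro mult_mono) (simp, linarith, auto)
      finally have 1: "\<bar>exp (- (3/2 * antider b f y)) - exp (- (3/2 * antider b g y))\<bar> \<le> 9 * (3/2 * D)" .
      have "flow_coeff y \<le> exp (3 * y / 2)" using flow_coeff_bounds[of y] y b by auto
      also have "\<dots> \<le> 1" using y by simp
      finally have k: "0 \<le> flow_coeff y" "flow_coeff y \<le> 1" using flow_coeff_bounds[of y] y b by auto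
      have "\<bar>- h f y - - h g y\<bar> = (c * flow_coeff y) * \<bar>exp (- (3/2 * antider b f y)) - exp (- (3/2 * antider b g y))\<bar>"
      proof -
        have "- h f y - - h g y = - ((c * flow_coeff y) * (exp (- (3/2 * antider b f y)) - exp (- (3/2 * antider b g y))))"
          by (simp add: h_def algebra_simps)
        then show ?thesis using c k by (simp only: abs_minus_cancel abs_mult)
      qed
      also have "\<dots> \<le> (1/8 * 1) * (9 * (3/2 * D))" using c k 1 by (intro mult_mono) auto
      finally show "\<bar>- h f y - - h g y\<bar> \<le> 27/16 * D" by simp
    qed (use z in \<open>auto intro!: derivative_eq_intros continuous_intros\<close>)
    also have "\<dots> = 27/16 * D * - ?z" by simp
    also have "\<dots> \<le> 27/16 * D * (1/4)" using z b D0 by (intro mult_left_mono) auto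
    finally have "\<bar>Q f ?z - Q g ?z\<bar> \<le> 1/2 * D" using Q0[of f] Q0[of g] D0 by linarith
    then show ?thesis by (simp add: Q_def)
  qed
  have "\<exists>!f\<in>S. P f = f"
  proof (rule Banach_fix[where c = "1/2"])
    have "S = PiC UNIV (\<lambda>_. {2..p0+1})" by (auto simp: S_def mem_PiC_iff Pi_def)
    then show "complete S" using closed_PiC[of UNIV "\<lambda>_. {2..p0+1}"] complete_eq_closed by auto
    have "const_bcontfun 2 \<in> S" using p0 by (auto simp: S_def const_bcontfun.rep_eq)
    then show "S \<noteq> {}" by auto
    show "P ` S \<subseteq> S"
    proof (rule image_subsetI)
      fix f assume f: "f \<in> S"
      have "apply_bcontfun (P f) x \<in> {2..p0+1}" for x
        unfolding PQ[OF f] by (rule Qbound[OF S[OF f]])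
      then show "P f \<in> S" unfolding S_def by blast
    qed
    show "dist (P f) (P g) \<le> 1/2 * dist f g" if "f \<in> S" "g \<in> S" for f g
    proof (rule dist_bound)
      fix x
      have "\<bar>Q f x - Q g x\<bar> \<le> 1/2 * dist f g"
        using that by (intro Qdiff S) (auto simp: dist_real_def[symmetric] intro: dist_bounded)
      then show "dist (apply_bcontfun (P f) x) (apply_bcontfun (P g) x) \<le> 1/2 * dist f g"
        using that by (simp add: PQ dist_real_def)
    qed
  qed auto
  then obtain F where F: "F \<in> S" "P F = F" by auto
  then have FQ: "apply_bcontfun F z = Q F z" for z using PQ[of F z] by simp
  then have FQ': "apply_bcontfun F = Q F" by auto
  have "(apply_bcontfun F has_real_derivative - (w0\<^sup>2) * flow_coeff z * exp (- (3/2 * antider b F z))) (at z)" if "b < z" for z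
    using Qd[OF S(1)[OF F(1)] that] by (simp add: h_def FQ'[symmetric] c_def)
  moreover have "(antider b F has_real_derivative F z) (at z)" if "b < z" for z
    by (rule antider_deriv[OF S(1)[OF F(1)] that])
  moreover have "p0 - 1 \<le> F z" if "0 \<le> z" for z
    using Qbound_pos[OF S(1,2)[OF F(1)] that] FQ[of z] by simp
  moreover have "apply_bcontfun F 0 = p0" using Q0 FQ by simp
  ultimately have "flow p0 w0 b F (antider b F)"
    unfolding flow_def using b(1,2) S(2,3)[OF F(1)] by simp
  then show ?thesis by blast
qed

text \<open>Gronwall for the squared distance \<open>E\<close> of two solutions. Derivatives are
  assumed only for \<open>z > 0\<close>, with continuity at 0, because this is what will be
  extracted from an arbitrary instanton.\<close>

lemma flow_unique:
  fixes p1 p2 w1 w2 :: "real \<Rightarrow> real"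
  assumes c: "continuous_on {0..} p1" "continuous_on {0..} p2" "continuous_on {0..} w1" "continuous_on {0..} w2"
    and i: "p1 0 = p2 0" "w1 0 = w2 0"
    and d: "\<And>z. 0 < z \<Longrightarrow> (p1 has_real_derivative - flow_coeff z * (w1 z)\<^sup>2) (at z)"
      "\<And>z. 0 < z \<Longrightarrow> (p2 has_real_derivative - flow_coeff z * (w2 z)\<^sup>2) (at z)"
      "\<And>z. 0 < z \<Longrightarrow> (w1 has_real_derivative - (3/4) * p1 z * w1 z) (at z)"
      "\<And>z. 0 < z \<Longrightarrow> (w2 has_real_derivative - (3/4) * p2 z * w2 z) (at z)"
    and z: "0 \<le> z"
  shows "p1 z = p2 z \<and> w1 z = w2 z"
proof -
  have bd: "\<exists>B. \<forall>y\<in>{0..z}. \<bar>f y\<bar> \<le> B" if "continuous_on {0..} f" for f :: "real \<Rightarrow> real"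
  proof -
    have "bounded (f ` {0..z})"
      by (intro compact_imp_bounded compact_continuous_image continuous_on_subset[OF that]) auto
    then show ?thesis by (auto simp: bounded_iff)
  qed
  have "continuous_on {0..} flow_coeff" by (rule continuous_on_subset[OF continuous_on_flow_coeff]) auto
  then have "continuous_on {0..} (\<lambda>y. flow_coeff y * (w1 y + w2 y))" using c by (intro continuous_intros)
  from bd[OF this] obtain K where K: "\<And>y. y \<in> {0..z} \<Longrightarrow> \<bar>flow_coeff y * (w1 y + w2 y)\<bar> \<le> K"
    by blast
  obtain B where B: "\<And>y. y \<in> {0..z} \<Longrightarrow> \<bar>p1 y\<bar> \<le> B" using bd[OF c(1)] by blast
  obtain C where C: "\<And>y. y \<in> {0..z} \<Longrightarrow> \<bar>w2 y\<bar> \<le> C" using bd[OF c(4)] by blast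
  define N where "N = K + 2 * B + C"
  define E where "E y = (p1 y - p2 y)\<^sup>2 + (w1 y - w2 y)\<^sup>2" for y
  define E' where "E' y = 2 * (p1 y - p2 y) * (- flow_coeff y * (w1 y)\<^sup>2 + flow_coeff y * (w2 y)\<^sup>2)
     + 2 * (w1 y - w2 y) * (- (3/4) * p1 y * w1 y + (3/4) * p2 y * w2 y)" for y
  have Ed: "(E has_real_derivative E' y) (at y)" if "0 < y" for y
    unfolding E_def[abs_def] E'_def
    by (rule derivative_eq_intros d that refl | simp add: algebra_simps)+
  have Ele: "E' y \<le> N * E y" if y: "y \<in> {0..z}" for y
  proof -
    define a where "a = p1 y - p2 y"
    define e where "e = w1 y - w2 y"
    \<comment> \<open>Splitting \<open>w1\<^sup>2 - w2\<^sup>2 = (w1 + w2) * e\<close> and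
      \<open>p1 * w1 - p2 * w2 = p1 * e + w2 * a\<close> makes every term quadratic in the
      differences \<open>a\<close> and \<open>e\<close>.\<close>
    have "E' y = - 2 * (flow_coeff y * (w1 y + w2 y)) * (a * e) - (3/2) * p1 y * e\<^sup>2 - (3/2) * w2 y * (a * e)"
      by (simp add: E'_def a_def e_def field_simps power2_eq_square)
    also have "\<dots> \<le> \<bar>flow_coeff y * (w1 y + w2 y)\<bar> * (2 * \<bar>a * e\<bar>) + 2 * \<bar>p1 y\<bar> * e\<^sup>2 + \<bar>w2 y\<bar> * (2 * \<bar>a * e\<bar>)"
    proof -
      have gen: "- 2 * m * x \<le> \<bar>m\<bar> * (2 * \<bar>x\<bar>)" for m x :: real
        using abs_ge_minus_self[of "m * x"] by (simp add: abs_mult mult_ac)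
      have gen2: "- (3/2) * m * x \<le> \<bar>m\<bar> * (2 * \<bar>x\<bar>)" for m x :: real
      proof -
        have "- (3/2) * (m * x) \<le> 2 * \<bar>m * x\<bar>" by linarith
        then show ?thesis by (simp only: abs_mult mult_ac)
      qed
      have "- 2 * (flow_coeff y * (w1 y + w2 y)) * (a * e) \<le> \<bar>flow_coeff y * (w1 y + w2 y)\<bar> * (2 * \<bar>a * e\<bar>)"
        using gen .
      moreover have "- (3/2) * p1 y * e\<^sup>2 \<le> 2 * \<bar>p1 y\<bar> * e\<^sup>2"
        by (intro mult_right_mono) auto
      moreover have "- (3/2) * w2 y * (a * e) \<le> \<bar>w2 y\<bar> * (2 * \<bar>a * e\<bar>)"
        using gen2 .
      ultimately show ?thesis by linarith
    qed
    also have "\<dots> \<le> K * E y + 2 * B * E y + C * E y"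
    proof -
      have ae: "2 * \<bar>a * e\<bar> \<le> E y"
        using sum_squares_bound[of "\<bar>a\<bar>" "\<bar>e\<bar>"] by (simp add: E_def a_def e_def abs_mult)
      have "e\<^sup>2 \<le> E y" by (simp add: E_def e_def)
      then show ?thesis using ae K[OF y] B[OF y] C[OF y] by (intro add_mono mult_mono) auto
    qed
    finally show ?thesis by (simp add: N_def algebra_simps)
  qed
  have "E z * exp (- N * z) \<le> E 0 * exp (- N * 0)"
  proof (rule DERIV_nonpos_imp_decreasing_open[OF z, of "\<lambda>y. E y * exp (- N * y)"])
    fix y assume y: "0 < y" "y < z"
    have "((\<lambda>y. E y * exp (- N * y)) has_real_derivative (E' y - N * E y) * exp (- N * y)) (at y)"
      by (rule derivative_eq_intros Ed y refl | simp add: algebra_simps)+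
    moreover have "(E' y - N * E y) * exp (- N * y) \<le> 0"
      using Ele[of y] y by (intro mult_nonpos_nonneg) auto
    ultimately show "\<exists>d. ((\<lambda>y. E y * exp (- N * y)) has_real_derivative d) (at y) \<and> d \<le> 0" by blast
  next
    show "continuous_on {0..z} (\<lambda>y. E y * exp (- N * y))"
      unfolding E_def by (intro continuous_intros continuous_on_subset[OF c(1)] continuous_on_subset[OF c(2)]
          continuous_on_subset[OF c(3)] continuous_on_subset[OF c(4)]) auto
  qed
  then have "E z \<le> 0" using i by (simp add: E_def mult_le_0_iff)
  then show ?thesis by (simp add: E_def sum_power2_le_zero_iff)
qed

section \<open>Limit of the flow and its dependence on the initial value\<close>

lemma flow_cont:
  assumes "flow p0 w0 b \<phi> L"
  shows "continuous_on {b<..} \<phi>" "continuous_on {b<..} L"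
  using assms by (auto simp: flow_def at_within_open[OF _ open_greaterThan] intro!: DERIV_continuous_on)

lemma flow_decreasing:
  assumes "flow p0 w0 b \<phi> L" "0 \<le> x" "x \<le> y"
  shows "\<phi> y \<le> \<phi> x"
proof (rule DERIV_nonpos_imp_nonincreasing[OF assms(3)])
  fix z assume "x \<le> z" "z \<le> y"
  then have "b < z" "-1 < z" using assms by (auto simp: flow_def)
  then have "(\<phi> has_real_derivative - (w0\<^sup>2) * flow_coeff z * exp (- (3/2 * L z))) (at z)"
    and "- (w0\<^sup>2) * flow_coeff z * exp (- (3/2 * L z)) \<le> 0"
    using assms(1) flow_coeff_bounds(1)[of z] by (auto simp: flow_def)
  then show "\<exists>d. (\<phi> has_real_derivative d) (at z) \<and> d \<le> 0" by blast
qed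

text \<open>\<open>\<phi>\<close> is decreasing and bounded below on the half-line. The limit will
  be the holonomy angle at infinity divided by \<open>2 * pi\<close>.\<close>

lemma flow_lim:
  assumes "flow p0 w0 b \<phi> L"
  shows "\<exists>l. (\<phi> \<longlongrightarrow> l) at_top \<and> p0 - 1 \<le> l \<and> l \<le> p0"
proof -
  define l where "l = Inf (\<phi> ` {0..})"
  have bb: "bdd_below (\<phi> ` {0..})" using assms by (auto simp: flow_def intro!: bdd_belowI2[of _ "p0 - 1"])
  have "(\<phi> \<longlongrightarrow> l) at_top"
  proof (rule decreasing_tendsto)
    show "\<forall>\<^sub>F z in at_top. l \<le> \<phi> z"
      using eventually_ge_at_top[of 0] by eventually_elim (auto simp: l_def intro!: cInf_lower bb)
    fix x assume "l < x"
    then obtain z where z: "0 \<le> z" "\<phi> z < x" unfolding l_def by (subst (asm) cInf_less_iff) (auto simp: bb)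
    show "\<forall>\<^sub>F z in at_top. \<phi> z < x"
      using eventually_ge_at_top[of z] by eventually_elim (use flow_decreasing[OF assms z(1)] z in fastforce)
  qed
  moreover have "p0 - 1 \<le> l" unfolding l_def using assms by (intro cInf_greatest) (auto simp: flow_def)
  moreover have "l \<le> p0" unfolding l_def using assms by (intro cInf_lower bb) (auto simp: flow_def)
  ultimately show ?thesis by blast
qed

lemma flow_L_ge:
  assumes "flow p0 w0 b \<phi> L" "0 \<le> z"
  shows "2 * z \<le> L z"
proof -
  have "L 0 - 2 * 0 \<le> L z - 2 * z"
  proof (rule DERIV_nonneg_imp_nondecreasing[OF assms(2)])
    fix x :: real assume "0 \<le> x"
    then have "((\<lambda>z. L z - 2 * z) has_real_derivative \<phi> x - 2) (at x)" "0 \<le> \<phi> x - 2"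
      using assms(1) by (auto simp: flow_def intro!: derivative_eq_intros)
    then show "\<exists>y. ((\<lambda>z. L z - 2 * z) has_real_derivative y) (at x) \<and> 0 \<le> y" by blast
  qed
  then show ?thesis using assms by (simp add: flow_def)
qed

text \<open>With \<open>D\<close> the supremum of the difference, finite because both solutions are
  bounded, \<open>flow_diff\<close> gives \<open>D \<le> \<bar>p0 - p1\<bar> + D / 2\<close>, and
  the last term is absorbed.\<close>

lemma flow_lipschitz:
  assumes w: "w0\<^sup>2 \<le> 1/8" and f: "flow p0 w0 b \<phi> L" "flow p1 w0 b' \<phi>' L'" and z: "0 \<le> z"
  shows "\<bar>\<phi> z - \<phi>' z\<bar> \<le> 2 * \<bar>p0 - p1\<bar>"
proof -
  define D where "D = Sup ((\<lambda>z. \<bar>\<phi> z - \<phi>' z\<bar>) ` {0..})"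
  have "\<bar>\<phi> z - \<phi>' z\<bar> \<le> p0 + p1 + 2" if "0 \<le> z" for z
  proof -
    have "2 \<le> \<phi> z" "\<phi> z \<le> p0 + 1" "2 \<le> \<phi>' z" "\<phi>' z \<le> p1 + 1" using f that by (auto simp: flow_def)
    then show ?thesis by linarith
  qed
  then have ba: "bdd_above ((\<lambda>z. \<bar>\<phi> z - \<phi>' z\<bar>) ` {0..})" by (auto intro!: bdd_aboveI2)
  have D: "\<bar>\<phi> z - \<phi>' z\<bar> \<le> D" if "0 \<le> z" for z
    unfolding D_def using that by (intro cSup_upper ba) auto
  have D0: "0 \<le> D" using D[of 0] by linarith
  have "\<bar>\<phi> z - \<phi>' z\<bar> \<le> \<bar>p0 - p1\<bar> + 1/2 * D" if "0 \<le> z" for z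
  proof -
    have "\<bar>(\<phi> z - \<phi>' z) - (\<phi> 0 - \<phi>' 0)\<bar> \<le> 3 * (w0\<^sup>2) * D"
    proof (rule flow_diff[where ?f1.0 = \<phi> and ?f2.0 = \<phi>' and ?L1.0 = L and ?L2.0 = L', OF _ that])
      show "continuous_on {0..} L" "continuous_on {0..} L'" "continuous_on {0..} \<phi>" "continuous_on {0..} \<phi>'"
        using f by (auto intro!: continuous_on_subset[OF flow_cont(2)[OF f(1)]] continuous_on_subset[OF flow_cont(2)[OF f(2)]]
          continuous_on_subset[OF flow_cont(1)[OF f(1)]] continuous_on_subset[OF flow_cont(1)[OF f(2)]] simp: flow_def)
      have b: "b < y" "b' < y" if "0 < y" for y using f that by (auto simp: flow_def)
      show "(L has_real_derivative \<phi> y) (at y)" "(L' has_real_derivative \<phi>' y) (at y)"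
        "2 \<le> \<phi> y" "2 \<le> \<phi>' y" "\<bar>\<phi> y - \<phi>' y\<bar> \<le> D"
        "(\<phi> has_real_derivative - (w0\<^sup>2) * flow_coeff y * exp (- (3/2 * L y))) (at y)"
        "(\<phi>' has_real_derivative - (w0\<^sup>2) * flow_coeff y * exp (- (3/2 * L' y))) (at y)"
        if "0 < y" for y
        using f b[OF that] D[of y] that by (auto simp: flow_def)
    qed (use f in \<open>auto simp: flow_def\<close>)
    moreover have "3 * (w0\<^sup>2) * D \<le> 1/2 * D" using w D0 by (intro mult_right_mono) auto
    moreover have "\<phi> 0 = p0" "\<phi>' 0 = p1" using f by (auto simp: flow_def)
    ultimately show ?thesis by linarith
  qed
  then have "D \<le> \<bar>p0 - p1\<bar> + 1/2 * D" unfolding D_def by (intro cSup_least) (auto simp: D_def)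
  then have "D \<le> 2 * \<bar>p0 - p1\<bar>" by simp
  with D[OF z] show ?thesis by (rule order_trans)
qed

section \<open>The radial coordinate\<close>

text \<open>
  Substituting \<open>s = 3/4 (z u\<^sup>2 + 3)\<close> in the integral defining \<open>t\<close> removes the singularity at \<open>s = 9/4\<close> and gives
  \<open>t = sqrt z * t_ratio z\<close>, with \<open>t_ratio\<close> smooth and positive.
\<close>

definition dt_factor :: "real \<Rightarrow> real" where
  "dt_factor z = sqrt ((z + 2) * (z + 4) / (z + 6))"

definition t_ratio :: "real \<Rightarrow> real" where
  "t_ratio z = 3/2 * integral {0..1} (\<lambda>u. dt_factor (z * u\<^sup>2))"

lemma Ck_on_dt_factor: "Ck_on k {-2<..} dt_factor"
  unfolding dt_factor_def
  by (intro Ck_on_sqrt Ck_on_divide Ck_on_mult Ck_on_add Ck_on_ident Ck_on_const open_greaterThan) auto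

lemma dt_factor_pos: "-2 < z \<Longrightarrow> 0 < dt_factor z"
  by (simp add: dt_factor_def)

lemma scaled_gt:
  fixes z u :: real
  assumes "-2 < z" "u \<in> {0..1}"
  shows "-2 < z * u\<^sup>2"
proof -
  have u: "0 \<le> u\<^sup>2" "u\<^sup>2 \<le> 1" using power_le_one[of u 2] assms(2) by auto
  have "- 2 * u\<^sup>2 \<le> z * u\<^sup>2" using assms(1) u(1) by (intro mult_right_mono) auto
  moreover have "- 2 < z * u\<^sup>2" if "u\<^sup>2 = 1" using assms(1) that by simp
  ultimately show ?thesis using u(2) by (cases "u\<^sup>2 = 1") auto
qed

text \<open>Differentiation under the integral sign. The weight \<open>u ^ n\<close> is there for
  iteration: each derivative in \<open>z\<close> brings out a factor
  \<open>u\<^sup>2\<close>.\<close>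

lemma scaled_integral_deriv:
  fixes f f' :: "real \<Rightarrow> real"
  assumes f: "\<And>y. -2 < y \<Longrightarrow> (f has_real_derivative f' y) (at y)" and c: "continuous_on {-2<..} f'" and z: "-2 < z"
  shows "((\<lambda>z. integral {0..1} (\<lambda>u. u ^ n * f (z * u\<^sup>2))) has_real_derivative
     integral {0..1} (\<lambda>u. u ^ (n + 2) * f' (z * u\<^sup>2))) (at z)"
proof -
  have fc: "continuous_on {-2<..} f"
    using f by (auto intro!: DERIV_continuous_on simp: at_within_open[OF _ open_greaterThan])
  have "((\<lambda>z. integral (cbox 0 1) (\<lambda>u. u ^ n * f (z * u\<^sup>2))) has_real_derivative
     integral (cbox 0 1) (\<lambda>u. u ^ (n + 2) * f' (z * u\<^sup>2))) (at z within {-2<..})"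
  proof (rule leibniz_rule_field_derivative)
    fix x t :: real assume x: "x \<in> {-2<..}" "t \<in> cbox 0 1"
    have "((\<lambda>x. f (x * t\<^sup>2)) has_real_derivative f' (x * t\<^sup>2) * t\<^sup>2) (at x within {-2<..})"
      by (rule DERIV_chain2[OF f]) (use x scaled_gt[of x t] in \<open>auto intro!: derivative_eq_intros\<close>)
    then show "((\<lambda>x. t ^ n * f (x * t\<^sup>2)) has_real_derivative t ^ (n + 2) * f' (x * t\<^sup>2)) (at x within {-2<..})"
      by (auto intro!: derivative_eq_intros simp: power2_eq_square)
  next
    fix x :: real assume x: "x \<in> {-2<..}"
    have "continuous_on (cbox 0 1) (\<lambda>u. f (x * u\<^sup>2))"
      by (rule continuous_on_compose2[OF fc]) (use x scaled_gt[of x] in \<open>auto intro!: continuous_intros\<close>)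
    then show "(\<lambda>u. u ^ n * f (x * u\<^sup>2)) integrable_on cbox 0 1"
      by (intro integrable_continuous continuous_intros)
  next
    have "continuous_on ({-2<..} \<times> cbox 0 1) (\<lambda>p. f' (fst p * (snd p)\<^sup>2))"
      by (rule continuous_on_compose2[OF c]) (use scaled_gt in \<open>auto intro!: continuous_intros\<close>)
    then show "continuous_on ({-2<..} \<times> cbox 0 1) (\<lambda>(x, t). t ^ (n + 2) * f' (x * t\<^sup>2))"
      unfolding case_prod_beta by (intro continuous_intros)
  qed (use z in auto)
  then show ?thesis using z by (simp add: at_within_open[OF _ open_greaterThan])
qed

lemma Ck_on_scaled_integral:
  fixes f :: "real \<Rightarrow> real"
  assumes "\<And>k. Ck_on k {-2<..} f"
  shows "Ck_on k {-2<..} (\<lambda>z. integral {0..1} (\<lambda>u. u ^ n * f (z * u\<^sup>2)))"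
  using assms
proof (induction k arbitrary: f n)
  case (0 f n)
  have "((\<lambda>z. integral {0..1} (\<lambda>u. u ^ n * f (z * u\<^sup>2))) has_real_derivative
     integral {0..1} (\<lambda>u. u ^ (n + 2) * frechet_derivative f (at (z * u\<^sup>2)) 1)) (at z)" if "-2 < z" for z
    using Ck_on_SucD(2)[OF 0[of "Suc 0"], of 1] that
    by (intro scaled_integral_deriv Ck_on_Suc_realD[OF 0[of "Suc 0"]]) auto
  then show ?case
    by (auto intro!: DERIV_continuous_on simp: at_within_open[OF _ open_greaterThan])
next
  case (Suc k f n)
  show ?case
  proof (rule Ck_on_Suc_realI)
    show "((\<lambda>z. integral {0..1} (\<lambda>u. u ^ n * f (z * u\<^sup>2))) has_real_derivative
     integral {0..1} (\<lambda>u. u ^ (n + 2) * frechet_derivative f (at (z * u\<^sup>2)) 1)) (at z)" if "z \<in> {-2<..}" for z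
      using Ck_on_SucD(2)[OF Suc.prems[of "Suc 0"], of 1] that
      by (intro scaled_integral_deriv Ck_on_Suc_realD[OF Suc.prems[of "Suc 0"]]) auto
    show "Ck_on k {-2<..} (\<lambda>z. integral {0..1} (\<lambda>u. u ^ (n + 2) * frechet_derivative f (at (z * u\<^sup>2)) 1))"
      by (rule Suc.IH[OF Ck_on_SucD(2)[OF Suc.prems]])
  qed simp
qed

lemma Ck_on_t_ratio: "Ck_on k {-2<..} t_ratio"
  using Ck_on_mult[OF _ Ck_on_const[of k "{-2<..}" "3/2::real"] Ck_on_scaled_integral[OF Ck_on_dt_factor, of k 0]]
  unfolding t_ratio_def[abs_def] by simp

lemma t_ratio_pos:
  assumes "-2 < z" shows "0 < t_ratio z"
proof -
  have c: "continuous_on {0..1} (\<lambda>u. dt_factor (z * u\<^sup>2))"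
    by (rule continuous_on_compose2[OF Ck_on_dt_factor[of 0, simplified]])
      (use assms scaled_gt[of z] in \<open>auto intro!: continuous_intros\<close>)
  have p: "0 < dt_factor (z * u\<^sup>2)" if "u \<in> {0..1}" for u
    by (rule dt_factor_pos[OF scaled_gt[OF assms that]])
  have n: "0 \<le> dt_factor (z * u\<^sup>2)" if "u \<in> {0..1}" for u using p[OF that] by simp
  have "integral {0..1} (\<lambda>u. dt_factor (z * u\<^sup>2)) \<noteq> 0"
    using integral_eq_0_iff[OF c zero_less_one n] p[of 0] by (metis atLeastAtMost_iff less_irrefl order_refl zero_le_one)
  moreover have "0 \<le> integral {0..1} (\<lambda>u. dt_factor (z * u\<^sup>2))"
    by (intro integral_nonneg integrable_continuous_real c n)
  ultimately show ?thesis by (simp add: t_ratio_def)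
qed

definition t_ratio' :: "real \<Rightarrow> real" where
  "t_ratio' z = frechet_derivative t_ratio (at z) 1"

lemma DERIV_t_ratio: "-2 < z \<Longrightarrow> (t_ratio has_real_derivative t_ratio' z) (at z)"
  unfolding t_ratio'_def by (rule Ck_on_Suc_realD[OF Ck_on_t_ratio]) simp

text \<open>The two integrands add up to the derivative of \<open>u \<mapsto> u * dt_factor (z * u\<^sup>2)\<close>.\<close>

lemma t_ratio_ode:
  assumes "-2 < z"
  shows "t_ratio z + 2 * z * t_ratio' z = 3/2 * dt_factor z"
proof -
  define q' where "q' z = frechet_derivative dt_factor (at z) 1" for z
  have q': "(dt_factor has_real_derivative q' z) (at z)" if "-2 < z" for z
    unfolding q'_def using that by (intro Ck_on_Suc_realD[OF Ck_on_dt_factor]) simp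
  have q'c: "continuous_on {-2<..} q'"
    unfolding q'_def[abs_def] using Ck_on_SucD(2)[OF Ck_on_dt_factor[of "Suc 0"], of 1] by simp
  have c: "continuous_on {0..1} (\<lambda>u. dt_factor (z * u\<^sup>2))"
    by (rule continuous_on_compose2[OF Ck_on_dt_factor[of 0, simplified]])
      (use assms scaled_gt[of z] in \<open>auto intro!: continuous_intros\<close>)
  have c': "continuous_on {0..1} (\<lambda>u. q' (z * u\<^sup>2))"
    by (rule continuous_on_compose2[OF q'c]) (use assms scaled_gt[of z] in \<open>auto intro!: continuous_intros\<close>)
  have "(t_ratio has_real_derivative 3/2 * integral {0..1} (\<lambda>u. u\<^sup>2 * q' (z * u\<^sup>2))) (at z)"
    using scaled_integral_deriv[OF q' q'c assms, of 0] unfolding t_ratio_def[abs_def]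
    by (auto intro!: derivative_eq_intros simp: power2_eq_square)
  then have m': "t_ratio' z = 3/2 * integral {0..1} (\<lambda>u. u\<^sup>2 * q' (z * u\<^sup>2))"
    using DERIV_t_ratio[OF assms] DERIV_unique by blast
  have "((\<lambda>u. dt_factor (z * u\<^sup>2) + 2 * z * (u\<^sup>2 * q' (z * u\<^sup>2))) has_integral 1 * dt_factor (z * 1\<^sup>2) - 0 * dt_factor (z * 0\<^sup>2)) {0..1}"
  proof (rule fundamental_theorem_of_calculus)
    fix u :: real assume u: "u \<in> {0..1}"
    have "((\<lambda>u. dt_factor (z * u\<^sup>2)) has_real_derivative q' (z * u\<^sup>2) * (2 * z * u)) (at u within {0..1})"
      by (rule DERIV_chain2[where f = dt_factor and g = "\<lambda>u. z * u\<^sup>2", OF q'[OF scaled_gt[OF assms u]]]) (auto intro!: derivative_eq_intros)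
    then have "((\<lambda>u. u * dt_factor (z * u\<^sup>2)) has_real_derivative dt_factor (z * u\<^sup>2) + 2 * z * (u\<^sup>2 * q' (z * u\<^sup>2))) (at u within {0..1})"
      by (auto intro!: derivative_eq_intros simp: power2_eq_square)
    then show "((\<lambda>u. u * dt_factor (z * u\<^sup>2)) has_vector_derivative dt_factor (z * u\<^sup>2) + 2 * z * (u\<^sup>2 * q' (z * u\<^sup>2))) (at u within {0..1})"
      by (simp add: has_real_derivative_iff_has_vector_derivative)
  qed simp
  note h1 = this
  have h2: "((\<lambda>u. dt_factor (z * u\<^sup>2) + 2 * z * (u\<^sup>2 * q' (z * u\<^sup>2))) has_integral
      integral {0..1} (\<lambda>u. dt_factor (z * u\<^sup>2)) + 2 * z * integral {0..1} (\<lambda>u. u\<^sup>2 * q' (z * u\<^sup>2))) {0..1}"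
    by (intro has_integral_add has_integral_mult_right integrable_integral integrable_continuous_real
        continuous_intros c c')
  have "integral {0..1} (\<lambda>u. dt_factor (z * u\<^sup>2)) + 2 * z * integral {0..1} (\<lambda>u. u\<^sup>2 * q' (z * u\<^sup>2)) = dt_factor z"
    using has_integral_unique[OF h2 h1] by simp
  then show ?thesis by (simp add: t_ratio_def m' algebra_simps)
qed

text \<open>At \<open>z = 0\<close> the derivative drops out of \<open>t_ratio_ode\<close>, leaving
  \<open>3/2 * dt_factor 0\<close>.\<close>

lemma t_ratio_0: "t_ratio 0 = sqrt 3"
proof -
  have "dt_factor 0 = sqrt (4/3)" by (simp add: dt_factor_def)
  also have "\<dots> = 2 / sqrt 3" by (simp add: real_sqrt_divide)
  finally have "t_ratio 0 = 3 / sqrt 3" using t_ratio_ode[of 0] by simp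
  then show ?thesis by (simp add: real_div_sqrt)
qed

text \<open>For \<open>z \<ge> 0\<close> this is \<open>t\<^sup>2\<close>. It continues
  \<open>t\<^sup>2\<close> smoothly and increasingly to negative \<open>z\<close>, where
  \<open>t\<close> itself has no meaning.\<close>

definition t_sq :: "real \<Rightarrow> real" where
  "t_sq z = z * (t_ratio z)\<^sup>2"

lemma DERIV_t_sq:
  assumes "-2 < z" shows "(t_sq has_real_derivative 3/2 * (t_ratio z * dt_factor z)) (at z)"
proof -
  have "(t_sq has_real_derivative t_ratio z * (t_ratio z + 2 * z * t_ratio' z)) (at z)"
    unfolding t_sq_def[abs_def] using DERIV_t_ratio[OF assms]
    by (auto intro!: derivative_eq_intros simp: algebra_simps power2_eq_square)
  then show ?thesis unfolding t_ratio_ode[OF assms] by (simp add: mult_ac)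
qed

lemma t_sq_strict_mono: "-2 < x \<Longrightarrow> x < y \<Longrightarrow> t_sq x < t_sq y"
proof (rule DERIV_pos_imp_increasing[of x y t_sq])
  fix z assume "-2 < x" "x \<le> z"
  then have "-2 < z" by simp
  then have "(t_sq has_real_derivative 3/2 * (t_ratio z * dt_factor z)) (at z)" "3/2 * (t_ratio z * dt_factor z) > 0"
    using DERIV_t_sq t_ratio_pos dt_factor_pos by simp_all
  then show "\<exists>d. (t_sq has_real_derivative d) (at z) \<and> d > 0" by blast
qed

definition t_of :: "real \<Rightarrow> real" where
  "t_of z = sqrt z * t_ratio z"

lemma t_of_sq: "0 \<le> z \<Longrightarrow> (t_of z)\<^sup>2 = t_sq z"
  by (simp add: t_of_def t_sq_def power_mult_distrib)

lemma t_of_nonneg: "0 \<le> z \<Longrightarrow> 0 \<le> t_of z"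
  using t_ratio_pos[of z] by (simp add: t_of_def)

lemma t_of_pos: "0 < z \<Longrightarrow> 0 < t_of z"
  using t_ratio_pos[of z] by (simp add: t_of_def)

lemma t_of_strict_mono:
  assumes "0 \<le> x" "x < y" shows "t_of x < t_of y"
proof (rule power_less_imp_less_base[of _ 2])
  show "(t_of x)\<^sup>2 < (t_of y)\<^sup>2" using t_sq_strict_mono[of x y] assms by (simp add: t_of_sq)
  show "0 \<le> t_of y" using assms by (intro t_of_nonneg) auto
qed

lemma DERIV_t_of:
  assumes "0 < z"
  shows "(t_of has_real_derivative 3/4 * sqrt ((z + 2) * (z + 4) / (z * (z + 6)))) (at z)"
proof -
  have s: "sqrt z > 0" "sqrt z * sqrt z = z" using assms by auto
  have "(t_of has_real_derivative (t_ratio z + 2 * z * t_ratio' z) / (2 * sqrt z)) (at z)"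
    unfolding t_of_def[abs_def] using DERIV_t_ratio[of z] assms s
    by (auto intro!: derivative_eq_intros simp: field_simps power2_eq_square)
  moreover have "(t_ratio z + 2 * z * t_ratio' z) / (2 * sqrt z) = 3/4 * (dt_factor z / sqrt z)"
    using t_ratio_ode[of z] assms by (simp only: t_ratio_ode)
  moreover have "dt_factor z / sqrt z = sqrt ((z + 2) * (z + 4) / (z * (z + 6)))"
    by (simp add: dt_factor_def real_sqrt_divide[symmetric] mult_ac)
  ultimately show ?thesis by simp
qed

text \<open>The integrand defining \<open>t\<close> is singular at the lower end point, so the
  fundamental theorem is applied in the interior, with \<open>t_of\<close> continuous up to the
  end.\<close>

lemma bggg_t_eq:
  assumes "0 \<le> z"
  shows "bggg_t (3/4 * (z + 3)) = t_of z"
proof -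
  define f where "f s = sqrt ((s - 3/4) * (s + 3/4)) / sqrt ((s - 9/4) * (s + 9/4))" for s :: real
  define a where "a z = 3/4 * (z + 3)" for z :: real
  have "(f has_integral t_of (4/3 * a z - 3) - t_of (4/3 * (9/4) - 3)) {9/4..a z}"
  proof (rule fundamental_theorem_of_calculus_interior)
    show "continuous_on {9/4..a z} (\<lambda>s. t_of (4/3 * s - 3))"
    proof -
      have "continuous_on {-2<..} t_ratio" using Ck_on_t_ratio[of 0] by simp
      then have "continuous_on {0..} t_of" unfolding t_of_def[abs_def]
        by (intro continuous_intros) (auto elim: continuous_on_subset)
      then show ?thesis by (rule continuous_on_compose2) (auto intro!: continuous_intros)
    qed
    fix s assume s: "s \<in> {9/4<..<a z}"
    let ?z = "4/3 * s - 3"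
    have z: "0 < ?z" using s by simp
    have "((\<lambda>s. t_of (4/3 * s - 3)) has_real_derivative 3/4 * sqrt ((?z + 2) * (?z + 4) / (?z * (?z + 6))) * (4/3)) (at s)"
      by (rule DERIV_chain2[where f = t_of and g = "\<lambda>s. 4/3 * s - 3", OF DERIV_t_of[OF z]]) (auto intro!: derivative_eq_intros)
    moreover have "f s = 3/4 * sqrt ((?z + 2) * (?z + 4) / (?z * (?z + 6))) * (4/3)"
    proof -
      have "(?z + 2) * (?z + 4) / (?z * (?z + 6)) = ((s - 3/4) * (s + 3/4)) / ((s - 9/4) * (s + 9/4))"
        using s by (simp add: divide_simps) (simp add: algebra_simps)
      then show ?thesis by (simp add: f_def real_sqrt_divide)
    qed
    ultimately show "((\<lambda>s. t_of (4/3 * s - 3)) has_vector_derivative f s) (at s)"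
      by (simp add: has_real_derivative_iff_has_vector_derivative)
  qed (use assms in \<open>auto simp: a_def\<close>)
  then have "integral {9/4..a z} f = t_of (4/3 * a z - 3) - t_of (4/3 * (9/4) - 3)" by (rule integral_unique)
  moreover have "4/3 * a z - 3 = z"
    unfolding a_def mult.assoc[symmetric] by simp
  moreover have "t_of (4/3 * (9/4) - 3) = 0" by (simp add: t_of_def)
  ultimately show ?thesis unfolding bggg_t_def f_def[abs_def] a_def by simp
qed

lemma bggg_r_t_of:
  assumes "0 \<le> z"
  shows "bggg_r (t_of z) = 3/4 * (z + 3)"
  unfolding bggg_r_def
proof (rule the_equality)
  show "9/4 \<le> 3/4 * (z + 3) \<and> bggg_t (3/4 * (z + 3)) = t_of z" using assms bggg_t_eq by auto
next
  fix r assume r: "9/4 \<le> r \<and> bggg_t r = t_of z"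
  then have "t_of (4/3 * r - 3) = t_of z" using bggg_t_eq[of "4/3 * r - 3"] by simp
  then have "4/3 * r - 3 = z" using r assms t_of_strict_mono[of "4/3 * r - 3" z] t_of_strict_mono[of z "4/3 * r - 3"]
    by (cases "4/3 * r - 3" z rule: linorder_cases) auto
  then show "r = 3/4 * (z + 3)" by simp
qed

text \<open>The choice of \<open>z\<close> turns \<open>r - 9/4\<close>, \<open>r - 3/4\<close>,
  \<open>r + 3/4\<close>, \<open>r + 9/4\<close> into \<open>3/4\<close> times \<open>z\<close>,
  \<open>z + 2\<close>, \<open>z + 4\<close>, \<open>z + 6\<close>.\<close>

lemma bggg_AB:
  assumes "0 \<le> z" "t = t_of z"
  shows "bggg_A 1 t = sqrt (z * (z + 6) / ((z + 2) * (z + 4)))"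
    "i \<noteq> 1 \<Longrightarrow> bggg_A i t = sqrt (3/16 * (z * (z + 4)))"
    "bggg_B 1 t = (z + 3) / 2"
    "i \<noteq> 1 \<Longrightarrow> bggg_B i t = sqrt (3/16 * ((z + 2) * (z + 6)))"
proof -
  have r: "bggg_r t = 3/4 * (z + 3)" using bggg_r_t_of assms by simp
  have a: "3/4 * (z + 3) - 9/4 = 3/4 * z" "3/4 * (z + 3) + 9/4 = 3/4 * (z + 6)"
    "3/4 * (z + 3) - 3/4 = 3/4 * (z + 2)" "3/4 * (z + 3) + 3/4 = 3/4 * (z + 4)" by (simp_all add: algebra_simps)
  have "sqrt (3/4 * z * (3/4 * (z + 6))) = 3/4 * sqrt (z * (z + 6))"
    "sqrt (3/4 * (z + 2) * (3/4 * (z + 4))) = 3/4 * sqrt ((z + 2) * (z + 4))"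
    by (rule real_sqrt_unique; use assms in \<open>simp add: power_mult_distrib power2_eq_square algebra_simps\<close>)+
  then show "bggg_A 1 t = sqrt (z * (z + 6) / ((z + 2) * (z + 4)))"
    by (simp only: bggg_A_def r a Let_def) (simp add: real_sqrt_divide)
  show "bggg_A i t = sqrt (3/16 * (z * (z + 4)))" if "i \<noteq> 1"
    using that by (simp only: bggg_A_def r a Let_def) (simp add: field_simps)
  show "bggg_B 1 t = (z + 3) / 2" by (simp add: bggg_B_def r)
  show "bggg_B i t = sqrt (3/16 * ((z + 2) * (z + 6)))" if "i \<noteq> 1"
    using that by (simp only: bggg_B_def r a Let_def) (simp add: field_simps)
qed

lemma continuous_on_t_of: "continuous_on {0..} t_of"
proof -
  have "continuous_on {0..} t_ratio" by (rule continuous_on_subset[OF Ck_on_t_ratio[of 0, simplified]]) auto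
  then show ?thesis unfolding t_of_def[abs_def] by (intro continuous_intros)
qed

text \<open>The speed \<open>dt / dz\<close> stays above its limit 3/4. This makes
  \<open>t_of\<close> surjective onto the half-line.\<close>

lemma t_of_ge:
  assumes "0 \<le> z" shows "3/4 * z \<le> t_of z"
proof -
  have "t_of 0 - 3/4 * 0 \<le> t_of z - 3/4 * z"
  proof (rule DERIV_nonneg_imp_increasing_open[OF assms])
    fix x :: real assume x: "0 < x"
    have "x * (x + 6) > 0" using x by simp
    then have "1 \<le> (x + 2) * (x + 4) / (x * (x + 6))" using x by (simp add: pos_le_divide_eq algebra_simps)
    then have "0 \<le> 3/4 * sqrt ((x + 2) * (x + 4) / (x * (x + 6))) - 3/4" by simp
    moreover have "((\<lambda>z. t_of z - 3/4 * z) has_real_derivative 3/4 * sqrt ((x + 2) * (x + 4) / (x * (x + 6))) - 3/4) (at x)"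
      by (rule derivative_eq_intros DERIV_t_of[OF x] refl | simp)+
    ultimately show "\<exists>y. ((\<lambda>z. t_of z - 3/4 * z) has_real_derivative y) (at x) \<and> 0 \<le> y" by blast
  next
    show "continuous_on {0..z} (\<lambda>z. t_of z - 3/4 * z)"
      by (intro continuous_intros continuous_on_subset[OF continuous_on_t_of]) auto
  qed
  then show ?thesis by (simp add: t_of_def)
qed

text \<open>Needed to turn decay in \<open>z\<close> into decay in \<open>t\<close>: for
  \<open>z \<ge> 1\<close> the quotient under the root in \<open>dt / dz\<close> is at most
  4.\<close>

lemma t_of_le:
  assumes "1 \<le> z" shows "t_of z \<le> t_of 1 + 3/2 * z"
proof -
  have "t_of z - 3/2 * z \<le> t_of 1 - 3/2 * 1"
  proof (rule DERIV_nonpos_imp_nonincreasing[OF assms])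
    fix x :: real assume x: "1 \<le> x"
    then have "(x + 2) * (x + 4) \<le> 4 * (x * (x + 6))" using mult_mono[of 1 x 1 x] by (simp add: algebra_simps)
    then have "(x + 2) * (x + 4) / (x * (x + 6)) \<le> 2\<^sup>2" using x by (simp add: divide_le_eq)
    then have "sqrt ((x + 2) * (x + 4) / (x * (x + 6))) \<le> 2" by (rule real_le_lsqrt[rotated 1]) (use x in auto)
    then have "3/4 * sqrt ((x + 2) * (x + 4) / (x * (x + 6))) - 3/2 \<le> 0" by simp
    moreover have "((\<lambda>z. t_of z - 3/2 * z) has_real_derivative 3/4 * sqrt ((x + 2) * (x + 4) / (x * (x + 6))) - 3/2) (at x)"
    proof -
      have d: "(t_of has_real_derivative 3/4 * sqrt ((x + 2) * (x + 4) / (x * (x + 6)))) (at x)"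
        using x by (intro DERIV_t_of) auto
      show ?thesis by (rule derivative_eq_intros d refl | simp)+
    qed
    ultimately show "\<exists>y. ((\<lambda>z. t_of z - 3/2 * z) has_real_derivative y) (at x) \<and> y \<le> 0" by blast
  qed
  then show ?thesis by simp
qed

lemma t_of_surj:
  assumes "0 \<le> t" obtains z where "0 \<le> z" "t_of z = t"
proof -
  have "\<exists>z\<ge>0. z \<le> 4/3 * t \<and> t_of z = t"
    by (rule IVT') (use assms t_of_ge[of "4/3 * t"] in \<open>auto simp: t_of_def intro: continuous_on_subset[OF continuous_on_t_of[unfolded t_of_def[abs_def]]]\<close>)
  then show ?thesis using that by blast
qed

section \<open>Curvature of connections in normal form\<close>

lemma bilinear_qmult: "bilinear (\<odot>)"
  unfolding bilinear_def by (intro conjI allI linearI) (simp_all only: qmult_add qmult_scaleR)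

lemma bounded_bilinear_qmult: "bounded_bilinear (\<odot>)"
  using bilinear_qmult bilinear_conv_bounded_bilinear by blast

lemma qcnj_add [simp]: "qcnj (a + b) = qcnj a + qcnj b"
  by (simp add: qcnj_def)

lemma qcnj_minus [simp]: "qcnj (- a) = - qcnj a"
  by (simp add: qcnj_def)

lemma bounded_linear_qcnj: "bounded_linear qcnj"
  by (intro linear_conv_bounded_linear[THEN iffD1] linearI) (simp_all only: qcnj_add qcnj_scaleR)

lemma qcnj_zero [simp]: "qcnj 0 = 0"
  by (simp add: qcnj_def zero_prod_def)

lemma qcnj_qone [simp]: "qcnj qone = qone"
  by (simp add: qcnj_def qone_def)

lemma qmult_zero [simp]: "0 \<odot> a = 0" "a \<odot> 0 = 0"
  by (simp_all add: qmult_def zero_prod_def)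

lemma qmult_diff: "(a - b) \<odot> c = a \<odot> c - b \<odot> c" "a \<odot> (b - c) = a \<odot> b - a \<odot> c"
  by (simp_all add: qmult_def algebra_simps)

lemma qcnj_mult_self: "qcnj a \<odot> a = (norm a)\<^sup>2 *\<^sub>R qone" "a \<odot> qcnj a = (norm a)\<^sup>2 *\<^sub>R qone"
  unfolding norm_quat_sq
  by (simp_all add: qmult_def qcnj_def qone_def complex_eq_iff power2_eq_square algebra_simps)

lemma qcnj_cancel: "qcnj a \<odot> (a \<odot> b) = (norm a)\<^sup>2 *\<^sub>R b" "a \<odot> (qcnj a \<odot> b) = (norm a)\<^sup>2 *\<^sub>R b"
  by (simp_all add: qmult_assoc[symmetric] qcnj_mult_self)

lemma inner_qmult_left: "inner (a \<odot> b) (a \<odot> c) = (norm a)\<^sup>2 * inner b c"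
  unfolding norm_quat_sq
  by (simp add: qmult_def inner_prod_def inner_complex_def power2_eq_square algebra_simps)

lemma inner_qmult_right: "inner (b \<odot> a) (c \<odot> a) = (norm a)\<^sup>2 * inner b c"
  unfolding norm_quat_sq
  by (simp add: qmult_def inner_prod_def inner_complex_def power2_eq_square algebra_simps)

lemma su2_qcnj: "\<xi> \<in> su2 \<longleftrightarrow> qcnj \<xi> = - \<xi>"
  by (cases \<xi>) (auto simp: su2_def qcnj_def complex_eq_iff)

lemma norm_SU2: "q \<in> SU2 \<Longrightarrow> norm q = 1"
  by (simp add: SU2_def)

lemma M_snd: "x \<in> M \<Longrightarrow> norm (snd x) = 1"
  by (auto simp: M_def SU2_def)

text \<open>
  Left-trivialised tangent vectors: \<open>\<zeta>\<close> has the components \<open>\<eta>\<^sub>i\<^sup>-\<close>, and \<open>\<xi> - \<zeta>\<close> has the real part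
  \<open>dt / t\<close> and the components \<open>\<eta>\<^sub>i\<^sup>+\<close>.
\<close>

definition frame_vec :: "point \<Rightarrow> quat \<Rightarrow> quat \<Rightarrow> point" where
  "frame_vec x \<xi> \<zeta> = (fst x \<odot> \<xi>, (2 / (rad x)\<^sup>2) *\<^sub>R (fst x \<odot> \<zeta> \<odot> qcnj (fst x) \<odot> snd x))"

text \<open>Both components of \<open>X\<close> are translated back by \<open>fst x\<close>.
  Tangency to the sphere says that \<open>snd X \<odot> qcnj (snd x)\<close> is imaginary, and
  conjugation by \<open>fst x\<close> keeps it so, whence \<open>\<zeta> \<in> su2\<close>.\<close>

lemma tangent_frame_vec:
  assumes "x \<in> M" "fst x \<noteq> 0" "X \<in> tangent x"
  obtains \<xi> \<zeta> where "\<zeta> \<in> su2" "X = frame_vec x \<xi> \<zeta>"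
proof -
  let ?p = "fst x" and ?q = "snd x"
  have p: "rad x \<noteq> 0" "norm ?p = rad x" using assms by (auto simp: rad_def)
  have q: "norm ?q = 1" using assms M_snd by auto
  define \<xi> where "\<xi> = (1 / (rad x)\<^sup>2) *\<^sub>R (qcnj ?p \<odot> fst X)"
  define \<zeta> where "\<zeta> = (1 / (2 * (rad x)\<^sup>2)) *\<^sub>R (qcnj ?p \<odot> (snd X \<odot> (qcnj ?q \<odot> ?p)))"
  have "Re (fst (snd X \<odot> qcnj ?q)) = 0"
    using assms(3) by (simp add: tangent_def qmult_def qcnj_def inner_prod_def inner_complex_def algebra_simps)
  then have "qcnj (snd X \<odot> qcnj ?q) = - (snd X \<odot> qcnj ?q)" unfolding su2_qcnj[symmetric] su2_def by simp
  then have a: "?q \<odot> qcnj (snd X) = - (snd X \<odot> qcnj ?q)" by simp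
  have "qcnj ?p \<odot> ((?q \<odot> qcnj (snd X)) \<odot> ?p) = - (qcnj ?p \<odot> (snd X \<odot> (qcnj ?q \<odot> ?p)))"
    unfolding a by (simp add: qmult_assoc)
  then have "\<zeta> \<in> su2" by (simp add: su2_qcnj \<zeta>_def qmult_assoc)
  moreover have "X = frame_vec x \<xi> \<zeta>"
    using p q by (simp add: frame_vec_def \<xi>_def \<zeta>_def prod_eq_iff qmult_assoc qcnj_cancel qcnj_mult_self power2_eq_square)
  ultimately show ?thesis using that by blast
qed

lemma frame_vec_tangent:
  assumes "x \<in> M" "\<zeta> \<in> su2"
  shows "frame_vec x \<xi> \<zeta> \<in> tangent x"
proof -
  let ?p = "fst x" and ?q = "snd x"
  have "Re (fst (?p \<odot> \<zeta> \<odot> qcnj ?p)) = 0"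
    using assms(2) by (simp add: qmult_def qcnj_def su2_def algebra_simps)
  then have "inner (qone \<odot> ?q) ((?p \<odot> \<zeta> \<odot> qcnj ?p) \<odot> ?q) = 0"
    unfolding inner_qmult_right by (simp add: qone_def inner_prod_def inner_complex_def)
  then show ?thesis by (simp add: tangent_def frame_vec_def)
qed

lemma inner_qone: "inner qone \<xi> = Re (fst \<xi>)"
  by (simp add: qone_def inner_prod_def inner_complex_def)

text \<open>On tangent vectors its imaginary part has the components
  \<open>(rad x)\<^sup>2 * eta_plus i x\<close>. Being polynomial in the point, it is smooth across
  \<open>fst x = 0\<close>, where the forms \<open>eta_plus\<close> are singular.\<close>

definition cform :: "point \<Rightarrow> point \<Rightarrow> quat" where
  "cform x X = qcnj (fst x) \<odot> fst X + (1/2) *\<^sub>R (qcnj (fst x) \<odot> (snd x \<odot> qcnj (snd X)) \<odot> fst x)"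

lemma frame_vec_forms:
  assumes x: "x \<in> M" "fst x \<noteq> 0" and z: "\<zeta> \<in> su2" and i: "i \<in> {1..3}"
  shows "d_rad x (frame_vec x \<xi> \<zeta>) = rad x * Re (fst \<xi>)"
    "eta_plus i x (frame_vec x \<xi> \<zeta>) = inner (\<xi> - \<zeta>) (T i)"
    "eta_minus i x (frame_vec x \<xi> \<zeta>) = inner \<zeta> (T i)"
    "cform x (frame_vec x \<xi> \<zeta>) = (rad x)\<^sup>2 *\<^sub>R (\<xi> - \<zeta>)"
proof -
  let ?p = "fst x" and ?q = "snd x" and ?t = "rad x"
  have p: "?t \<noteq> 0" "norm ?p = ?t" using assms by (auto simp: rad_def)
  have q: "norm ?q = 1" using assms M_snd by auto
  have z': "qcnj \<zeta> = - \<zeta>" using z su2_qcnj by auto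
  have "inner (?p \<odot> qone) (?p \<odot> \<xi>) = ?t\<^sup>2 * Re (fst \<xi>)"
    unfolding inner_qmult_left p by (simp add: qone_def inner_prod_def inner_complex_def)
  then show d: "d_rad x (frame_vec x \<xi> \<zeta>) = ?t * Re (fst \<xi>)"
    using p by (simp add: d_rad_def frame_vec_def power2_eq_square)
  have "d_fib1 x (frame_vec x \<xi> \<zeta>) = (1 / ?t) *\<^sub>R (?p \<odot> \<xi> - Re (fst \<xi>) *\<^sub>R ?p)"
    unfolding d_fib1_def d using p by (simp add: frame_vec_def fib1_def)
  also have "?p \<odot> \<xi> - Re (fst \<xi>) *\<^sub>R ?p = ?p \<odot> (\<xi> - Re (fst \<xi>) *\<^sub>R qone)"
    by (simp add: qmult_diff)
  finally have f1: "d_fib1 x (frame_vec x \<xi> \<zeta>) = (1 / ?t) *\<^sub>R (?p \<odot> (\<xi> - Re (fst \<xi>) *\<^sub>R qone))" .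
  have mc1: "maurer_cartan1 x (frame_vec x \<xi> \<zeta>) = \<xi> - Re (fst \<xi>) *\<^sub>R qone"
    unfolding maurer_cartan1_def f1 using p by (simp add: fib1_def qcnj_cancel power2_eq_square)
  have mc2: "maurer_cartan2 x (frame_vec x \<xi> \<zeta>) = \<xi> - Re (fst \<xi>) *\<^sub>R qone - 2 *\<^sub>R \<zeta>"
    unfolding maurer_cartan2_def d_fib2_def f1 using p q z'
    by (simp add: fib1_def fib2_def frame_vec_def qmult_assoc qcnj_cancel qcnj_mult_self power2_eq_square qmult_add qmult_diff)
       (simp add: scaleR_diff_right)
  have T1: "inner qone (T i) = 0" by (simp add: qone_def T_def inner_prod_def inner_complex_def)
  show "eta_plus i x (frame_vec x \<xi> \<zeta>) = inner (\<xi> - \<zeta>) (T i)"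
    "eta_minus i x (frame_vec x \<xi> \<zeta>) = inner \<zeta> (T i)"
    by (simp_all add: eta_plus_def eta_minus_def mc1 mc2 inner_add_left inner_diff_left T1)
  show "cform x (frame_vec x \<xi> \<zeta>) = (rad x)\<^sup>2 *\<^sub>R (\<xi> - \<zeta>)"
    using p q z' by (simp add: cform_def frame_vec_def qmult_assoc qcnj_cancel qcnj_mult_self scaleR_diff_right power2_eq_square)
qed

lemma cform_eta:
  assumes "x \<in> M" "fst x \<noteq> 0" "X \<in> tangent x" "i \<in> {1..3}"
  shows "inner (cform x X) (T i) = (rad x)\<^sup>2 * eta_plus i x X"
proof -
  obtain \<xi> \<zeta> where X: "\<zeta> \<in> su2" "X = frame_vec x \<xi> \<zeta>" using tangent_frame_vec[OF assms(1-3)] .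
  show ?thesis unfolding X(2) frame_vec_forms[OF assms(1,2) X(1) assms(4)] by simp
qed

text \<open>The normal form with \<open>A_1 f^+ = s * P s\<close> and
  \<open>A_2 g^+ = s * Q s\<close>, where \<open>s = t\<^sup>2\<close>, written so that
  \<open>P\<close>, \<open>Q\<close> smooth near \<open>s \<ge> 0\<close> give a smooth form on the
  ambient space.\<close>

definition model :: "(real \<Rightarrow> real) \<Rightarrow> (real \<Rightarrow> real) \<Rightarrow> conn" where
  "model P Q x X =
     (P ((norm (fst x))\<^sup>2) * inner (cform x X) (T 1)) *\<^sub>R T 1 +
     (Q ((norm (fst x))\<^sup>2) * inner (cform x X) (T 2)) *\<^sub>R T 2 +
     (Q ((norm (fst x))\<^sup>2) * inner (cform x X) (T 3)) *\<^sub>R T 3"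

lemma model_eta:
  assumes "x \<in> M" "fst x \<noteq> 0" "X \<in> tangent x"
  shows "model P Q x X = ((rad x)\<^sup>2 * P ((rad x)\<^sup>2) * eta_plus 1 x X) *\<^sub>R T 1 +
     ((rad x)\<^sup>2 * Q ((rad x)\<^sup>2)) *\<^sub>R (eta_plus 2 x X *\<^sub>R T 2 + eta_plus 3 x X *\<^sub>R T 3)"
  using cform_eta[OF assms, of 1] cform_eta[OF assms, of 2] cform_eta[OF assms, of 3]
  by (simp add: model_def rad_def scaleR_add_right mult_ac)

definition cform_deriv :: "point \<Rightarrow> point \<Rightarrow> point \<Rightarrow> quat" where
  "cform_deriv x X Y = qcnj (fst X) \<odot> fst Y + (1/2) *\<^sub>R
    (qcnj (fst X) \<odot> (snd x \<odot> qcnj (snd Y)) \<odot> fst x + qcnj (fst x) \<odot> (snd X \<odot> qcnj (snd Y)) \<odot> fst x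
     + qcnj (fst x) \<odot> (snd x \<odot> qcnj (snd Y)) \<odot> fst X)"

lemma has_derivative_qmult [derivative_intros]:
  assumes "(f has_derivative f') (at x within S)" "(g has_derivative g') (at x within S)"
  shows "((\<lambda>x. f x \<odot> g x) has_derivative (\<lambda>h. f x \<odot> g' h + f' h \<odot> g x)) (at x within S)"
  by (rule bounded_bilinear.FDERIV[OF bounded_bilinear_qmult assms])

lemma has_derivative_qcnj [derivative_intros]:
  assumes "(f has_derivative f') (at x within S)"
  shows "((\<lambda>x. qcnj (f x)) has_derivative (\<lambda>h. qcnj (f' h))) (at x within S)"
  by (rule bounded_linear.has_derivative[OF bounded_linear_qcnj assms])

lemma has_derivative_cform:
  "((\<lambda>y. cform y Y) has_derivative (\<lambda>X. cform_deriv x X Y)) (at x)"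
  unfolding cform_def
  by (rule derivative_eq_intros | rule ext | simp)+
     (simp add: cform_deriv_def algebra_simps qmult_add qmult_assoc)

lemma has_derivative_norm_sq_fst:
  "((\<lambda>y::point. (norm (fst y))\<^sup>2) has_derivative (\<lambda>X. 2 * inner (fst x) (fst X))) (at x)"
  unfolding power2_norm_eq_inner by (auto intro!: derivative_eq_intros simp: inner_commute)

lemma has_derivative_model:
  assumes "(P has_real_derivative P') (at ((norm (fst x))\<^sup>2))" "(Q has_real_derivative Q') (at ((norm (fst x))\<^sup>2))"
  shows "((\<lambda>y. model P Q y Y) has_derivative (\<lambda>X.
     (P' * (2 * inner (fst x) (fst X)) * inner (cform x Y) (T 1) + P ((norm (fst x))\<^sup>2) * inner (cform_deriv x X Y) (T 1)) *\<^sub>R T 1 +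
     (Q' * (2 * inner (fst x) (fst X)) * inner (cform x Y) (T 2) + Q ((norm (fst x))\<^sup>2) * inner (cform_deriv x X Y) (T 2)) *\<^sub>R T 2 +
     (Q' * (2 * inner (fst x) (fst X)) * inner (cform x Y) (T 3) + Q ((norm (fst x))\<^sup>2) * inner (cform_deriv x X Y) (T 3)) *\<^sub>R T 3)) (at x)"
proof -
  have *: "((\<lambda>y. (H ((norm (fst y))\<^sup>2) * inner (cform y Y) v) *\<^sub>R v) has_derivative
     (\<lambda>X. (H' * (2 * inner (fst x) (fst X)) * inner (cform x Y) v + H ((norm (fst x))\<^sup>2) * inner (cform_deriv x X Y) v) *\<^sub>R v)) (at x)"
    if "(H has_real_derivative H') (at ((norm (fst x))\<^sup>2))" for H H' v
  proof -
    have "((\<lambda>y. H ((norm (fst y))\<^sup>2)) has_derivative (\<lambda>X. H' * (2 * inner (fst x) (fst X)))) (at x)"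
      using has_derivative_compose[OF has_derivative_norm_sq_fst that[unfolded has_field_derivative_def]] by simp
    note has_derivative_scaleR_left[OF has_derivative_mult[OF this has_derivative_inner_left[OF has_derivative_cform[of Y x], of v]], of v]
    then show ?thesis by (simp add: algebra_simps)
  qed
  show ?thesis unfolding model_def by (intro has_derivative_add * assms)
qed

lemma cform_deriv_frame_vec:
  assumes x: "x \<in> M" "fst x \<noteq> 0" and z: "\<zeta> \<in> su2" "\<zeta>' \<in> su2"
  shows "cform_deriv x (frame_vec x \<xi> \<zeta>) (frame_vec x \<xi>' \<zeta>') =
    (rad x)\<^sup>2 *\<^sub>R (qcnj \<xi> \<odot> \<xi>' - qcnj \<xi> \<odot> \<zeta>' - 2 *\<^sub>R (\<zeta> \<odot> \<zeta>') - \<zeta>' \<odot> \<xi>)"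
proof -
  have p: "rad x \<noteq> 0" "norm (fst x) = rad x" "norm (snd x) = 1" using assms M_snd by (auto simp: rad_def)
  have z': "qcnj \<zeta> = - \<zeta>" "qcnj \<zeta>' = - \<zeta>'" using z su2_qcnj by auto
  show ?thesis using p z'
    by (simp add: cform_deriv_def frame_vec_def qmult_assoc qcnj_cancel qcnj_mult_self algebra_simps power2_eq_square)
qed

lemma su2_bracket_T:
  "su2_bracket (a *\<^sub>R T 1 + b *\<^sub>R T 2 + c *\<^sub>R T 3) (a' *\<^sub>R T 1 + b' *\<^sub>R T 2 + c' *\<^sub>R T 3) =
    (2 * (b * c' - b' * c)) *\<^sub>R T 1 + (2 * (c * a' - c' * a)) *\<^sub>R T 2 + (2 * (a * b' - a' * b)) *\<^sub>R T 3"
  by (simp add: su2_bracket_def T_def qmult_def complex_eq_iff prod_eq_iff algebra_simps)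

text \<open>The linear terms come from the structure equation \<open>d\<eta>_1^+ = - 2 (\<eta>_2^+
  \<and> \<eta>_3^+ + \<eta>_2^- \<and> \<eta>_3^-)\<close> and its cyclic versions, the terms
  \<open>2 * G\<^sup>2\<close> and \<open>2 * F * G\<close> from the bracket. \<open>dF\<close> and
  \<open>dG\<close> stand for the derivatives of \<open>F\<close> and \<open>G\<close> in
  \<open>t\<close>.\<close>

definition curv_form :: "real \<Rightarrow> real \<Rightarrow> real \<Rightarrow> real \<Rightarrow> point \<Rightarrow> point \<Rightarrow> point \<Rightarrow> quat" where
  "curv_form F dF G dG x X Y =
     (dF * (d_rad x X * eta_plus 1 x Y - d_rad x Y * eta_plus 1 x X)
       + (2 * G\<^sup>2 - 2 * F) * (eta_plus 2 x X * eta_plus 3 x Y - eta_plus 2 x Y * eta_plus 3 x X)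
       - 2 * F * (eta_minus 2 x X * eta_minus 3 x Y - eta_minus 2 x Y * eta_minus 3 x X)) *\<^sub>R T 1 +
     (dG * (d_rad x X * eta_plus 2 x Y - d_rad x Y * eta_plus 2 x X)
       + (2 * F * G - 2 * G) * (eta_plus 3 x X * eta_plus 1 x Y - eta_plus 3 x Y * eta_plus 1 x X)
       - 2 * G * (eta_minus 3 x X * eta_minus 1 x Y - eta_minus 3 x Y * eta_minus 1 x X)) *\<^sub>R T 2 +
     (dG * (d_rad x X * eta_plus 3 x Y - d_rad x Y * eta_plus 3 x X)
       + (2 * F * G - 2 * G) * (eta_plus 1 x X * eta_plus 2 x Y - eta_plus 1 x Y * eta_plus 2 x X)
       - 2 * G * (eta_minus 1 x X * eta_minus 2 x Y - eta_minus 1 x Y * eta_minus 2 x X)) *\<^sub>R T 3"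

lemma curvature_model:
  assumes x: "x \<in> M" "fst x \<noteq> 0" and t: "t = rad x" "s = t\<^sup>2"
    and d: "(P has_real_derivative P') (at s)" "(Q has_real_derivative Q') (at s)"
    and F: "F = s * P s" "dF = 2 * t * (P s + s * P')" and G: "G = s * Q s" "dG = 2 * t * (Q s + s * Q')"
    and XY: "X \<in> tangent x" "Y \<in> tangent x"
  shows "curvature (model P Q) x X Y = curv_form F dF G dG x X Y"
proof -
  obtain \<xi> \<zeta> where X: "\<zeta> \<in> su2" "X = frame_vec x \<xi> \<zeta>" using tangent_frame_vec[OF x XY(1)] .
  obtain \<xi>' \<zeta>' where Y: "\<zeta>' \<in> su2" "Y = frame_vec x \<xi>' \<zeta>'" using tangent_frame_vec[OF x XY(2)] .
  have tp: "t \<noteq> 0" using x t by (simp add: rad_def)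
  have ns: "(norm (fst x))\<^sup>2 = s" using t by (simp add: rad_def)
  have ip: "inner (fst x) (fst (frame_vec x \<xi> \<zeta>)) = s * Re (fst \<xi>)" for \<xi> \<zeta>
    using inner_qmult_left[of "fst x" qone \<xi>] by (simp add: frame_vec_def ns inner_qone)
  have fr: "frechet_derivative (\<lambda>y. model P Q y Y) (at x) X =
     (P' * (2 * inner (fst x) (fst X)) * inner (cform x Y) (T 1) + P s * inner (cform_deriv x X Y) (T 1)) *\<^sub>R T 1 +
     (Q' * (2 * inner (fst x) (fst X)) * inner (cform x Y) (T 2) + Q s * inner (cform_deriv x X Y) (T 2)) *\<^sub>R T 2 +
     (Q' * (2 * inner (fst x) (fst X)) * inner (cform x Y) (T 3) + Q s * inner (cform_deriv x X Y) (T 3)) *\<^sub>R T 3" for X Y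
    using fun_cong[OF frechet_derivative_at[OF has_derivative_model[of P P' x Q Q' Y]], of X] d by (simp add: ns)
  note cX = frame_vec_forms(4)[OF x X(1), of 1 \<xi>, simplified] frame_vec_forms(4)[OF x Y(1), of 1 \<xi>', simplified]
  have mX: "model P Q x X = (F * inner (\<xi> - \<zeta>) (T 1)) *\<^sub>R T 1 + (G * inner (\<xi> - \<zeta>) (T 2)) *\<^sub>R T 2 + (G * inner (\<xi> - \<zeta>) (T 3)) *\<^sub>R T 3"
    and mY: "model P Q x Y = (F * inner (\<xi>' - \<zeta>') (T 1)) *\<^sub>R T 1 + (G * inner (\<xi>' - \<zeta>') (T 2)) *\<^sub>R T 2 + (G * inner (\<xi>' - \<zeta>') (T 3)) *\<^sub>R T 3"
    unfolding model_def X(2) Y(2) cX ns F G t(1)[symmetric] t(2)[symmetric] by (simp_all add: mult_ac)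
  have rX: "d_rad x X = t * Re (fst \<xi>)" "d_rad x Y = t * Re (fst \<xi>')"
    using frame_vec_forms(1)[OF x X(1), of 1] frame_vec_forms(1)[OF x Y(1), of 1] X Y t by auto
  have eX: "eta_plus i x X = inner (\<xi> - \<zeta>) (T i)" "eta_minus i x X = inner \<zeta> (T i)"
    "eta_plus i x Y = inner (\<xi>' - \<zeta>') (T i)" "eta_minus i x Y = inner \<zeta>' (T i)" if "i \<in> {1..3}" for i
    using frame_vec_forms(2,3)[OF x X(1) that] frame_vec_forms(2,3)[OF x Y(1) that] X Y by auto
  define u where "u = \<xi> - \<zeta>"
  define u' where "u' = \<xi>' - \<zeta>'"
  \<comment> \<open>\<open>s\<close> times the imaginary part of \<open>w\<close> is that of the
    exterior derivative of \<open>cform\<close> on \<open>X\<close> and \<open>Y\<close>: the real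
    parts carry \<open>dt / t\<close>, and the brackets are the Maurer-Cartan equation.\<close>
  define w where "w = 2 *\<^sub>R (Re (fst \<xi>) *\<^sub>R u' - Re (fst \<xi>') *\<^sub>R u) - su2_bracket u u' - su2_bracket \<zeta> \<zeta>'"
  have w: "inner (cform_deriv x X Y) (T i) - inner (cform_deriv x Y X) (T i) = s * inner w (T i)" if "i \<in> {1,2,3}" for i
    unfolding X(2) Y(2) cform_deriv_frame_vec[OF x X(1) Y(1)] cform_deriv_frame_vec[OF x Y(1) X(1)]
    using X(1) Y(1) that unfolding w_def u_def u'_def su2_bracket_def t(1)[symmetric] t(2)[symmetric] inner_scaleR_left right_diff_distrib[symmetric]
    by (elim insertE) (simp_all add: su2_def T_def inner_prod_def inner_complex_def qmult_def qcnj_def algebra_simps)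
  have w': "inner w (T 1) = 2 * (Re (fst \<xi>) * inner u' (T 1) - Re (fst \<xi>') * inner u (T 1))
      - 2 * (inner u (T 2) * inner u' (T 3) - inner u' (T 2) * inner u (T 3))
      - 2 * (inner \<zeta> (T 2) * inner \<zeta>' (T 3) - inner \<zeta>' (T 2) * inner \<zeta> (T 3))"
    "inner w (T 2) = 2 * (Re (fst \<xi>) * inner u' (T 2) - Re (fst \<xi>') * inner u (T 2))
      - 2 * (inner u (T 3) * inner u' (T 1) - inner u' (T 3) * inner u (T 1))
      - 2 * (inner \<zeta> (T 3) * inner \<zeta>' (T 1) - inner \<zeta>' (T 3) * inner \<zeta> (T 1))"
    "inner w (T 3) = 2 * (Re (fst \<xi>) * inner u' (T 3) - Re (fst \<xi>') * inner u (T 3))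
      - 2 * (inner u (T 1) * inner u' (T 2) - inner u' (T 1) * inner u (T 2))
      - 2 * (inner \<zeta> (T 1) * inner \<zeta>' (T 2) - inner \<zeta>' (T 1) * inner \<zeta> (T 2))"
    unfolding w_def su2_bracket_def
    by (simp_all add: T_def inner_prod_def inner_complex_def qmult_def algebra_simps)
  have W: "inner (cform_deriv x X Y) (T 1) = inner (cform_deriv x Y X) (T 1) + s * inner w (T 1)"
    "inner (cform_deriv x X Y) (T 2) = inner (cform_deriv x Y X) (T 2) + s * inner w (T 2)"
    "inner (cform_deriv x X Y) (T 3) = inner (cform_deriv x Y X) (T 3) + s * inner w (T 3)"
    using w[of 1] w[of 2] w[of 3] by (simp_all add: algebra_simps)
  have "curvature (model P Q) x X Y =
    (2 * P' * s\<^sup>2 * (Re (fst \<xi>) * inner u' (T 1) - Re (fst \<xi>') * inner u (T 1)) + P s * (s * inner w (T 1))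
      + 2 * G\<^sup>2 * (inner u (T 2) * inner u' (T 3) - inner u' (T 2) * inner u (T 3))) *\<^sub>R T 1 +
    (2 * Q' * s\<^sup>2 * (Re (fst \<xi>) * inner u' (T 2) - Re (fst \<xi>') * inner u (T 2)) + Q s * (s * inner w (T 2))
      + 2 * F * G * (inner u (T 3) * inner u' (T 1) - inner u' (T 3) * inner u (T 1))) *\<^sub>R T 2 +
    (2 * Q' * s\<^sup>2 * (Re (fst \<xi>) * inner u' (T 3) - Re (fst \<xi>') * inner u (T 3)) + Q s * (s * inner w (T 3))
      + 2 * F * G * (inner u (T 1) * inner u' (T 2) - inner u' (T 1) * inner u (T 2))) *\<^sub>R T 3"
    unfolding curvature_def mX mY su2_bracket_T fr W
    unfolding X(2) Y(2) ip cX u_def u'_def t(1)[symmetric] t(2)[symmetric]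
    by (simp add: algebra_simps power2_eq_square)
  then show ?thesis
    unfolding w' curv_form_def rX F G
    using eX[of 1] eX[of 2] eX[of 3] tp
    by (simp add: u_def[symmetric] u'_def[symmetric] t(2) algebra_simps power2_eq_square)
qed

section \<open>Independence of the extension off the manifold\<close>

lemma has_vector_derivativeI_quotient:
  fixes f :: "real \<Rightarrow> 'a::real_normed_vector"
  assumes "((\<lambda>s. (f s - f a) /\<^sub>R (s - a)) \<longlongrightarrow> d) (at a)"
  shows "(f has_vector_derivative d) (at a)"
  unfolding has_vector_derivative_def has_derivative_iff_norm
proof (intro conjI bounded_linear_scaleR_left)
  have "((\<lambda>s. norm ((f s - f a) /\<^sub>R (s - a) - d)) \<longlongrightarrow> 0) (at a)"
    using tendsto_norm_zero[OF Lim_null[THEN iffD1, OF assms]] .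
  moreover have "\<forall>\<^sub>F s in at a. norm ((f s - f a) /\<^sub>R (s - a) - d) = norm (f s - f a - (s - a) *\<^sub>R d) / norm (s - a)"
    using eventually_neq_at_within[of a a]
  proof eventually_elim
    case (elim s)
    then have "f s - f a - (s - a) *\<^sub>R d = (s - a) *\<^sub>R ((f s - f a) /\<^sub>R (s - a) - d)"
      by (simp add: scaleR_diff_right)
    then have "norm (f s - f a - (s - a) *\<^sub>R d) = \<bar>s - a\<bar> * norm ((f s - f a) /\<^sub>R (s - a) - d)"
      by (metis norm_scaleR)
    then show ?case using elim by simp
  qed
  ultimately show "((\<lambda>s. norm (f s - f a - (s - a) *\<^sub>R d) / norm (s - a)) \<longlongrightarrow> 0) (at a)"
    by (rule Lim_transform_eventually)
qed

text \<open>
  The value is symmetric in \<open>X\<close> and \<open>Y\<close>, which is why the curvature at a point of \<open>M\<close> depends only on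
  the restriction of a connection to vectors tangent to \<open>M\<close>.
\<close>

lemma tangential_derivative:
  fixes C :: conn
  assumes x: "x \<in> M" and XY: "X \<in> tangent x" "Y \<in> tangent x"
    and diff: "\<And>Z. (\<lambda>y. C y Z) differentiable (at x)"
    and N: "open N" "x \<in> N"
    and lin: "\<And>y. y \<in> N \<inter> M \<Longrightarrow> linear (C y)"
    and van: "\<And>y Z. y \<in> N \<inter> M \<Longrightarrow> Z \<in> tangent y \<Longrightarrow> C y Z = 0"
  shows "frechet_derivative (\<lambda>y. C y Y) (at x) X = inner (snd X) (snd Y) *\<^sub>R C x (0, snd x)"
proof -
  let ?q = "snd x"
  define k where "k = inner (snd X) (snd Y)"
  have q: "norm ?q = 1" using x by (auto simp: M_def SU2_def)
  have qX: "inner ?q (snd X) = 0" "inner ?q (snd Y) = 0" using XY by (auto simp: tangent_def)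
  define \<nu> where "\<nu> s = norm (?q + s *\<^sub>R snd X)" for s
  have \<nu>2: "(\<nu> s)\<^sup>2 = 1 + s\<^sup>2 * (norm (snd X))\<^sup>2" for s
  proof -
    have "(\<nu> s)\<^sup>2 = inner (?q + s *\<^sub>R snd X) (?q + s *\<^sub>R snd X)" by (simp add: \<nu>_def power2_norm_eq_inner)
    also have "\<dots> = inner ?q ?q + s\<^sup>2 * inner (snd X) (snd X)"
      using qX by (simp add: inner_add_left inner_add_right inner_commute power2_eq_square)
    finally show ?thesis using q by (simp add: dot_square_norm)
  qed
  have \<nu>e: "\<nu> s = sqrt (1 + s\<^sup>2 * (norm (snd X))\<^sup>2)" for s
    using \<nu>2[of s] by (metis \<nu>_def norm_ge_zero real_sqrt_unique)
  have \<nu>p: "0 < \<nu> s" for s unfolding \<nu>e by (intro real_sqrt_gt_zero add_pos_nonneg) auto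
  have \<nu>0: "\<nu> 0 = 1" by (simp add: \<nu>e)
  \<comment> \<open>A curve inside \<open>M\<close> through \<open>x\<close> with velocity
    \<open>X\<close>: straight in the first factor, radially projected to the sphere in the
    second.\<close>
  define \<gamma> where "\<gamma> s = (fst x + s *\<^sub>R fst X, (1 / \<nu> s) *\<^sub>R (?q + s *\<^sub>R snd X))" for s
  have \<gamma>0: "\<gamma> 0 = x" by (simp add: \<gamma>_def \<nu>0)
  have \<gamma>M: "\<gamma> s \<in> M" for s using \<nu>p[of s] by (simp add: M_def \<gamma>_def SU2_def \<nu>_def[symmetric])
  have \<nu>d: "(\<nu> has_real_derivative 0) (at 0)"
    unfolding \<nu>e[abs_def] by (auto intro!: derivative_eq_intros)
  have \<gamma>d: "(\<gamma> has_vector_derivative X) (at 0)"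
  proof -
    have 1: "((\<lambda>s. 1 / \<nu> s) has_real_derivative 0) (at 0)"
      using \<nu>d \<nu>0 by (auto intro!: derivative_eq_intros)
    have "((\<lambda>s. fst x + s *\<^sub>R fst X) has_vector_derivative fst X) (at 0)"
      by (auto intro!: derivative_eq_intros)
    moreover have "((\<lambda>s. (1 / \<nu> s) *\<^sub>R (?q + s *\<^sub>R snd X)) has_vector_derivative (1 / \<nu> 0) *\<^sub>R snd X + 0 *\<^sub>R (?q + 0 *\<^sub>R snd X)) (at 0)"
      by (rule has_vector_derivative_scaleR[OF 1]) (auto intro!: derivative_eq_intros)
    ultimately have "(\<gamma> has_vector_derivative (fst X, snd X)) (at 0)"
      unfolding \<gamma>_def using has_vector_derivative_Pair \<nu>0 by fastforce
    then show ?thesis by simp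
  qed
  have Cd: "((\<lambda>s. C (\<gamma> s) Z) has_vector_derivative frechet_derivative (\<lambda>y. C y Z) (at x) X) (at 0)" for Z
  proof -
    have "((\<lambda>y. C y Z) has_derivative frechet_derivative (\<lambda>y. C y Z) (at x)) (at (\<gamma> 0))"
      using diff[of Z] frechet_derivative_works \<gamma>0 by auto
    then have "(((\<lambda>y. C y Z) \<circ> \<gamma>) has_derivative (frechet_derivative (\<lambda>y. C y Z) (at x) \<circ> (\<lambda>h. h *\<^sub>R X))) (at 0)"
      by (intro diff_chain_at \<gamma>d[unfolded has_vector_derivative_def])
    moreover have "linear (frechet_derivative (\<lambda>y. C y Z) (at x))"
      using diff by (rule linear_frechet_derivative)
    ultimately show ?thesis
      by (simp add: has_vector_derivative_def o_def linear_cmul)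
  qed
  have Cc: "continuous (at 0) (\<lambda>s. C (\<gamma> s) Z)" for Z
    using Cd[of Z] has_vector_derivative_continuous by blast
  have \<gamma>c: "continuous (at 0) \<gamma>" using \<gamma>d has_vector_derivative_continuous by blast
  then have ev: "\<forall>\<^sub>F s in at 0. \<gamma> s \<in> N"
    using N \<gamma>0 unfolding continuous_at by (auto elim!: topological_tendstoD)
  \<comment> \<open>Only the part of \<open>Y\<close> normal to \<open>M\<close> at
    \<open>\<gamma> s\<close> contributes to \<open>C (\<gamma> s) Y\<close>, and it has size
    \<open>s * k / \<nu> s\<close>. Once this factor \<open>s\<close> is split off, continuity of
    \<open>b\<close> at 0 gives the derivative.\<close>
  define b where "b s = (k / (\<nu> s)\<^sup>2) *\<^sub>R (C (\<gamma> s) (0, ?q) + s *\<^sub>R C (\<gamma> s) (0, snd X))" for s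
  have Ceq: "C (\<gamma> s) Y = s *\<^sub>R b s" if s: "\<gamma> s \<in> N" for s
  proof -
    let ?g = "snd (\<gamma> s)"
    have l: "linear (C (\<gamma> s))" using s \<gamma>M by (intro lin) auto
    have gY: "inner ?g (snd Y) = s * k / \<nu> s" using qX by (simp add: \<gamma>_def k_def inner_add_left)
    have gg: "inner ?g ?g = 1" using \<gamma>M[of s] by (auto simp: M_def SU2_def power2_norm_eq_inner[symmetric] dot_square_norm)
    have "Y - inner ?g (snd Y) *\<^sub>R (0, ?g) \<in> tangent (\<gamma> s)"
      using gg by (simp add: tangent_def inner_diff_right)
    then have "C (\<gamma> s) (Y - inner ?g (snd Y) *\<^sub>R (0, ?g)) = 0" using s \<gamma>M by (intro van) auto
    then have "C (\<gamma> s) Y = (s * k / \<nu> s) *\<^sub>R C (\<gamma> s) (0, ?g)"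
      by (simp only: linear_diff[OF l] linear_cmul[OF l] gY) simp
    also have "(0, ?g) = (1 / \<nu> s) *\<^sub>R ((0, ?q) + s *\<^sub>R (0 :: quat, snd X))" by (simp add: \<gamma>_def)
    also have "C (\<gamma> s) \<dots> = (1 / \<nu> s) *\<^sub>R (C (\<gamma> s) (0, ?q) + s *\<^sub>R C (\<gamma> s) (0, snd X))"
      by (simp only: linear_cmul[OF l] linear_add[OF l])
    finally show ?thesis by (simp add: b_def power2_eq_square)
  qed
  have "(b \<longlongrightarrow> b 0) (at 0)"
  proof -
    have nc: "continuous (at 0) \<nu>" using \<nu>d DERIV_isCont by blast
    have "continuous (at 0) b" unfolding b_def[abs_def]
      by (intro continuous_intros Cc nc) (use \<nu>0 in auto)
    then show ?thesis by (simp add: continuous_at)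
  qed
  moreover have "\<forall>\<^sub>F s in at 0. b s = (C (\<gamma> s) Y - C (\<gamma> 0) Y) /\<^sub>R (s - 0)"
  proof -
    have C0: "C (\<gamma> 0) Y = 0" using Ceq[of 0] \<gamma>0 N by simp
    show ?thesis using ev eventually_neq_at_within[of 0 0]
      by eventually_elim (simp add: Ceq C0)
  qed
  ultimately have "((\<lambda>s. (C (\<gamma> s) Y - C (\<gamma> 0) Y) /\<^sub>R (s - 0)) \<longlongrightarrow> b 0) (at 0)"
    by (rule Lim_transform_eventually)
  then have "((\<lambda>s. C (\<gamma> s) Y) has_vector_derivative b 0) (at 0)"
    by (rule has_vector_derivativeI_quotient)
  then have "frechet_derivative (\<lambda>y. C y Y) (at x) X = b 0"
    using Cd[of Y] vector_derivative_unique_at by blast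
  then show ?thesis by (simp add: b_def k_def \<gamma>0 \<nu>0)
qed

text \<open>The difference of the connections vanishes on tangent vectors, so its two derivative
  terms in the curvature cancel by the symmetry of \<open>tangential_derivative\<close>, and the
  brackets see only the common values.\<close>

lemma curvature_cong:
  assumes x: "x \<in> M" and XY: "X \<in> tangent x" "Y \<in> tangent x"
    and diff: "\<And>Z. (\<lambda>y. A y Z) differentiable (at x)" "\<And>Z. (\<lambda>y. B y Z) differentiable (at x)"
    and N: "open N" "x \<in> N"
    and lin: "\<And>y. y \<in> N \<inter> M \<Longrightarrow> linear (A y)" "\<And>y. y \<in> N \<inter> M \<Longrightarrow> linear (B y)"
    and eq: "\<And>y Z. y \<in> N \<inter> M \<Longrightarrow> Z \<in> tangent y \<Longrightarrow> A y Z = B y Z"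
  shows "curvature A x X Y = curvature B x X Y"
proof -
  define C where "C y Z = A y Z - B y Z" for y Z
  have Cd: "(\<lambda>y. C y Z) differentiable (at x)" for Z
    unfolding C_def using diff by (intro differentiable_diff) auto
  have Cl: "linear (C y)" if "y \<in> N \<inter> M" for y
    unfolding C_def[abs_def] by (intro linear_compose_sub lin that)
  have Cv: "C y Z = 0" if "y \<in> N \<inter> M" "Z \<in> tangent y" for y Z using eq that by (simp add: C_def)
  have fr: "frechet_derivative (\<lambda>y. C y Z) (at x) W = frechet_derivative (\<lambda>y. A y Z) (at x) W - frechet_derivative (\<lambda>y. B y Z) (at x) W" for Z W
  proof -
    have "((\<lambda>y. C y Z) has_derivative (\<lambda>W. frechet_derivative (\<lambda>y. A y Z) (at x) W - frechet_derivative (\<lambda>y. B y Z) (at x) W)) (at x)"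
      unfolding C_def
      by (intro has_derivative_diff frechet_derivative_works[THEN iffD1, OF diff(1)] frechet_derivative_works[THEN iffD1, OF diff(2)])
    from fun_cong[OF frechet_derivative_at[OF this], of W] show ?thesis by simp
  qed
  have "frechet_derivative (\<lambda>y. C y Y) (at x) X = frechet_derivative (\<lambda>y. C y X) (at x) Y"
    using tangential_derivative[OF x XY Cd N Cl Cv] tangential_derivative[OF x XY(2,1) Cd N Cl Cv]
    by (simp add: inner_commute)
  moreover have "A x X = B x X" "A x Y = B x Y" using eq XY x N by auto
  ultimately show ?thesis unfolding curvature_def using fr[of X Y] fr[of Y X] by (simp add: algebra_simps)
qed

section \<open>The instanton equations\<close>

lemma wedge_scale_left_real: "wedge k l (\<lambda>V. c * \<alpha> V) \<gamma> W = c * (wedge k l \<alpha> \<gamma> W :: real)"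
  using wedge_scale_left[of k l c \<alpha> \<gamma> W] by simp

lemma wedge_scale_right_real: "wedge k l \<gamma> (\<lambda>V. c * \<alpha> V) W = c * (wedge k l \<gamma> \<alpha> W :: real)"
  using wedge_scale_right[of k l \<gamma> c \<alpha> W] by simp

section \<open>Exterior algebra of the invariant coframe\<close>

definition coframe :: "point \<Rightarrow> nat \<Rightarrow> point \<Rightarrow> real" where
  "coframe x i = (if i = 0 then d_rad x else if i \<le> 3 then eta_plus i x else eta_minus (i - 3) x)"

definition coform :: "point \<Rightarrow> nat list \<Rightarrow> (nat \<Rightarrow> point) \<Rightarrow> real" where
  "coform x is = det_form (map (coframe x) is)"

lemma coform_one:
  "one_form (d_rad x) = coform x [0]"
  "i \<in> {1..3} \<Longrightarrow> one_form (eta_plus i x) = coform x [i]"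
  "i \<in> {1..3} \<Longrightarrow> one_form (eta_minus i x) = coform x [i + 3]"
  by (auto simp: det_form_single coform_def coframe_def)

lemma wedge_coform:
  "length is = k \<Longrightarrow> length js = l \<Longrightarrow> wedge k l (coform x is) (coform x js) = coform x (is @ js)"
  using wedge_det_form[of "map (coframe x) is" "map (coframe x) js"] by (auto simp: coform_def)

lemma coform_swap:
  "coform x (is @ a # b # js) V = - coform x (is @ b # a # js) V"
  unfolding coform_def map_append list.map by (rule det_form_swap)

text \<open>As conditional rewrite rules these bubble-sort index lists of length up to six, so that
  every basis form reaches increasing order or is killed by \<open>coform_repeat\<close>.\<close>

lemma coform_sort:
  assumes "b < a"
  shows "coform x (a # b # js) V = - coform x (b # a # js) V"
    "coform x (i # a # b # js) V = - coform x (i # b # a # js) V"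
    "coform x (i # j # a # b # js) V = - coform x (i # j # b # a # js) V"
    "coform x (i # j # k # a # b # js) V = - coform x (i # j # k # b # a # js) V"
    "coform x (i # j # k # l # a # b # js) V = - coform x (i # j # k # l # b # a # js) V"
  using coform_swap[of x "[]" a b js V] coform_swap[of x "[i]" a b js V] coform_swap[of x "[i, j]" a b js V]
    coform_swap[of x "[i, j, k]" a b js V] coform_swap[of x "[i, j, k, l]" a b js V] by simp_all

lemma coform_repeat:
  "coform x (a # a # js) V = 0"
  "coform x (i # a # a # js) V = 0"
  "coform x (i # j # a # a # js) V = 0"
  "coform x (i # j # k # a # a # js) V = 0"
  "coform x (i # j # k # l # a # a # js) V = 0"
  using coform_swap[of x "[]" a a js V] coform_swap[of x "[i]" a a js V] coform_swap[of x "[i, j]" a a js V]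
    coform_swap[of x "[i, j, k]" a a js V] coform_swap[of x "[i, j, k, l]" a a js V] by simp_all

lemma sum_123: "(\<Sum>i = 1..3. h i) = h 1 + h 2 + h (3::nat)" for h :: "nat \<Rightarrow> real"
  by (simp add: numeral_3_eq_3 numeral_2_eq_2)

lemma wedge_coform_lists:
  "wedge 1 1 (coform x [a]) (coform x [b]) = coform x [a, b]"
  "wedge 2 2 (coform x [a, b]) (coform x [c, d]) = coform x [a, b, c, d]"
  "wedge 1 3 (coform x [a]) (coform x [b, c, d]) = coform x [a, b, c, d]"
  "wedge 2 4 (coform x [a, b]) (coform x [c, d, e, f]) = coform x [a, b, c, d, e, f]"
  by (simp_all add: wedge_coform)

lemmas wedge_linear = wedge_add_left wedge_add_right wedge_scale_left_real wedge_scale_right_real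

lemma omega_coform:
  "bggg_omega x = (\<lambda>V. 4 * bggg_A 1 (rad x) * bggg_B 1 (rad x) * coform x [4, 1] V +
    (4 * bggg_A 2 (rad x) * bggg_B 2 (rad x) * coform x [5, 2] V +
    4 * bggg_A 3 (rad x) * bggg_B 3 (rad x) * coform x [6, 3] V))"
proof (rule ext)
  fix V
  have e: "one_form (eta_plus 1 x) = coform x [1]" "one_form (eta_plus 2 x) = coform x [2]"
    "one_form (eta_plus 3 x) = coform x [3]" "one_form (eta_minus 1 x) = coform x [1 + 3]"
    "one_form (eta_minus 2 x) = coform x [2 + 3]" "one_form (eta_minus 3 x) = coform x [3 + 3]"
    by (rule coform_one; simp)+
  have "bggg_omega x V = 4 * (bggg_A 1 (rad x) * bggg_B 1 (rad x) * coform x [1 + 3, 1] V +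
    bggg_A 2 (rad x) * bggg_B 2 (rad x) * coform x [2 + 3, 2] V +
    bggg_A 3 (rad x) * bggg_B 3 (rad x) * coform x [3 + 3, 3] V)"
    unfolding bggg_omega_def sum_123 e wedge_coform_lists by simp
  then show "bggg_omega x V = 4 * bggg_A 1 (rad x) * bggg_B 1 (rad x) * coform x [4, 1] V +
    (4 * bggg_A 2 (rad x) * bggg_B 2 (rad x) * coform x [5, 2] V +
    4 * bggg_A 3 (rad x) * bggg_B 3 (rad x) * coform x [6, 3] V)" by (simp add: algebra_simps)
qed

lemma wedge3_coform:
  assumes "i \<in> {1..3}" "j \<in> {1..3}" "k \<in> {1..3}"
  shows "wedge3 (eta_plus i x) (eta_plus j x) (eta_plus k x) = coform x [i, j, k]"
    "wedge3 (eta_minus i x) (eta_minus j x) (eta_plus k x) = coform x [i + 3, j + 3, k]"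
  using assms by (simp_all add: wedge3_def coform_one wedge_coform)

text \<open>The coefficient 4 becomes 8 because \<open>(i, j)\<close> and \<open>(j, i)\<close>
  contribute equally: both \<open>levi_civita\<close> and the form change sign.\<close>

lemma Omega2_coform:
  "bggg_Omega2 x = (\<lambda>V. - 8 * bggg_A 1 (rad x) * bggg_A 2 (rad x) * bggg_A 3 (rad x) * coform x [1, 2, 3] V
     + (8 * bggg_B 1 (rad x) * bggg_B 2 (rad x) * bggg_A 3 (rad x) * coform x [4, 5, 3] V +
       (8 * bggg_B 2 (rad x) * bggg_B 3 (rad x) * bggg_A 1 (rad x) * coform x [5, 6, 1] V +
        8 * bggg_B 3 (rad x) * bggg_B 1 (rad x) * bggg_A 2 (rad x) * coform x [6, 4, 2] V)))"
  by (rule ext) (simp add: bggg_Omega2_def sum_123[unfolded One_nat_def] wedge3_coform levi_civita_def coform_sort[of 4 5] coform_sort[of 5 6] coform_sort[of 4 6])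

text \<open>In half the square of \<open>bggg_omega\<close> the squares of the summands vanish and
  each mixed product occurs twice, hence the coefficients 16. The equalities
  \<open>A_3 = A_2\<close>, \<open>B_3 = B_2\<close> are built in.\<close>

lemma psi_coform:
  assumes "a1 = bggg_A 1 (rad x)" "a2 = bggg_A 2 (rad x)" "b1 = bggg_B 1 (rad x)" "b2 = bggg_B 2 (rad x)"
  shows "bggg_psi x = (\<lambda>V. 16 * a1 * b1 * a2 * b2 * coform x [4, 1, 5, 2] V
    + (16 * a1 * b1 * a2 * b2 * coform x [4, 1, 6, 3] V
    + (16 * a2 * b2 * a2 * b2 * coform x [5, 2, 6, 3] V
    + (8 * a1 * a2 * a2 * coform x [0, 1, 2, 3] V
    + (- 8 * b1 * b2 * a2 * coform x [0, 4, 5, 3] V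
    + (- 8 * b2 * b2 * a1 * coform x [0, 5, 6, 1] V
    + - 8 * b2 * b1 * a2 * coform x [0, 6, 4, 2] V))))))"
proof -
  have 3: "bggg_A 3 (rad x) = a2" "bggg_B 3 (rad x) = b2" using assms by (simp_all add: bggg_A_def bggg_B_def)
  have s: "coform x [5, 2, 4, 1] V = coform x [4, 1, 5, 2] V" "coform x [6, 3, 4, 1] V = coform x [4, 1, 6, 3] V"
    "coform x [6, 3, 5, 2] V = coform x [5, 2, 6, 3] V"
    "coform x [4, 1, 4, 1] V = 0" "coform x [5, 2, 5, 2] V = 0" "coform x [6, 3, 6, 3] V = 0" for V
    by (simp_all add: coform_sort coform_repeat)
  show ?thesis
    unfolding bggg_psi_def[abs_def] omega_coform Omega2_coform coform_one 3 assms[symmetric]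
    by (rule ext) (simp only: wedge_linear wedge_coform_lists s, simp add: algebra_simps)
qed

text \<open>The three groups of two-forms are those that occur in the curvature along
  \<open>T 1\<close>, \<open>T 2\<close>, \<open>T 3\<close>. Wedged with \<open>bggg_psi\<close>,
  each gives a multiple of one six-form, namely the product of the coframe without
  \<open>\<eta>_i^-\<close>; so each component amounts to one scalar equation.\<close>

lemma wedge_psi:
  assumes "a1 = bggg_A 1 (rad x)" "a2 = bggg_A 2 (rad x)" "b1 = bggg_B 1 (rad x)" "b2 = bggg_B 2 (rad x)"
  shows
    "wedge 2 4 (\<lambda>W. a * coform x [0, 1] W + (b * coform x [2, 3] W + c * coform x [5, 6] W)) (bggg_psi x) V =
      (- 16 * a2 * b2 * a2 * b2 * a - 8 * b2 * b2 * a1 * b + 8 * a1 * a2 * a2 * c) * coform x [0, 1, 2, 3, 5, 6] V"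
    "wedge 2 4 (\<lambda>W. a * coform x [0, 2] W + (b * coform x [3, 1] W + c * coform x [6, 4] W)) (bggg_psi x) V =
      (16 * a1 * b1 * a2 * b2 * a + 8 * b1 * b2 * a2 * b - 8 * a1 * a2 * a2 * c) * coform x [0, 1, 2, 3, 4, 6] V"
    "wedge 2 4 (\<lambda>W. a * coform x [0, 3] W + (b * coform x [1, 2] W + c * coform x [4, 5] W)) (bggg_psi x) V =
      - (16 * a1 * b1 * a2 * b2 * a + 8 * b1 * b2 * a2 * b - 8 * a1 * a2 * a2 * c) * coform x [0, 1, 2, 3, 4, 5] V"
  unfolding psi_coform[OF assms]
  by (simp_all only: wedge_linear wedge_coform_lists) (simp_all add: coform_sort coform_repeat algebra_simps)

text \<open>
  The instanton equations in terms of \<open>F = A\<^sub>1 f\<^sup>+\<close> and \<open>G = A\<^sub>2 g\<^sup>+\<close>, cleared of denominators: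
  these are the coefficients of \<open>F\<^sub>A \<and> \<psi>\<close>.
\<close>

definition eq_f :: "real \<Rightarrow> real \<Rightarrow> real \<Rightarrow> real \<Rightarrow> real" where
  "eq_f t F dF G = 2 * (bggg_A 2 t)\<^sup>2 * (bggg_B 2 t)\<^sup>2 * dF + 2 * (bggg_B 2 t)\<^sup>2 * bggg_A 1 t * (G\<^sup>2 - F)
     + 2 * bggg_A 1 t * (bggg_A 2 t)\<^sup>2 * F"

definition eq_g :: "real \<Rightarrow> real \<Rightarrow> real \<Rightarrow> real \<Rightarrow> real" where
  "eq_g t F G dG = bggg_A 1 t * bggg_B 1 t * bggg_B 2 t * dG + bggg_B 1 t * bggg_B 2 t * (F * G - G)
     + bggg_A 1 t * bggg_A 2 t * G"

text \<open>The components along \<open>T 2\<close> and \<open>T 3\<close> repeat the same equation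
  up to sign: here the \<open>U(1)\<close>-symmetry reduces the system to two equations.\<close>

lemma instanton_form:
  assumes x: "x \<in> M" "fst x \<noteq> 0" and V: "\<And>i. i < 6 \<Longrightarrow> V i \<in> tangent x"
    and curv: "\<And>X Y. X \<in> tangent x \<Longrightarrow> Y \<in> tangent x \<Longrightarrow> curvature A x X Y = curv_form F dF G dG x X Y"
  shows "wedge 2 4 (\<lambda>W. curvature A x (W 0) (W 1)) (bggg_psi x) V =
    (- 8 * eq_f (rad x) F dF G * coform x [0, 1, 2, 3, 5, 6] V) *\<^sub>R T 1
    + (16 * bggg_A 2 (rad x) * eq_g (rad x) F G dG * coform x [0, 1, 2, 3, 4, 6] V) *\<^sub>R T 2
    + (- 16 * bggg_A 2 (rad x) * eq_g (rad x) F G dG * coform x [0, 1, 2, 3, 4, 5] V) *\<^sub>R T 3"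
proof -
  have pair: "coform x [i, j] W = coframe x i (W 0) * coframe x j (W 1) - coframe x i (W 1) * coframe x j (W 0)" for i j W
    by (simp add: coform_def det_form_pair)
  define w1 where "w1 = (\<lambda>W. dF * coform x [0, 1] W + ((2 * G\<^sup>2 - 2 * F) * coform x [2, 3] W + (- 2 * F) * coform x [5, 6] W))"
  define w2 where "w2 = (\<lambda>W. dG * coform x [0, 2] W + ((2 * F * G - 2 * G) * coform x [3, 1] W + (- 2 * G) * coform x [6, 4] W))"
  define w3 where "w3 = (\<lambda>W. dG * coform x [0, 3] W + ((2 * F * G - 2 * G) * coform x [1, 2] W + (- 2 * G) * coform x [4, 5] W))"
  have "wedge 2 4 (\<lambda>W. curvature A x (W 0) (W 1)) (bggg_psi x) V =
     wedge 2 4 (\<lambda>W. w1 W *\<^sub>R T 1 + w2 W *\<^sub>R T 2 + w3 W *\<^sub>R T 3) (bggg_psi x) V"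
  proof (rule wedge_cong_left)
    fix \<sigma> assume s: "\<sigma> permutes {..<2 + 4 :: nat}"
    have "\<sigma> 0 < 6" "\<sigma> 1 < 6" using permutes_in_image[OF s] by auto
    then have t: "V (\<sigma> 0) \<in> tangent x" "V (\<sigma> 1) \<in> tangent x" using V by auto
    show "curvature A x (V (\<sigma> 0)) (V (\<sigma> 1)) =
      w1 (\<lambda>i. V (\<sigma> i)) *\<^sub>R T 1 + w2 (\<lambda>i. V (\<sigma> i)) *\<^sub>R T 2 + w3 (\<lambda>i. V (\<sigma> i)) *\<^sub>R T 3"
      unfolding curv[OF t] curv_form_def w1_def w2_def w3_def pair by (simp add: coframe_def add_diff_eq)
  qed
  also have "\<dots> = wedge 2 4 w1 (bggg_psi x) V *\<^sub>R T 1 + wedge 2 4 w2 (bggg_psi x) V *\<^sub>R T 2 + wedge 2 4 w3 (bggg_psi x) V *\<^sub>R T 3"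
    by (simp only: wedge_add_left wedge_vector_left)
  also have "\<dots> = (- 8 * eq_f (rad x) F dF G * coform x [0, 1, 2, 3, 5, 6] V) *\<^sub>R T 1
    + (16 * bggg_A 2 (rad x) * eq_g (rad x) F G dG * coform x [0, 1, 2, 3, 4, 6] V) *\<^sub>R T 2
    + (- 16 * bggg_A 2 (rad x) * eq_g (rad x) F G dG * coform x [0, 1, 2, 3, 4, 5] V) *\<^sub>R T 3"
    unfolding w1_def w2_def w3_def wedge_psi[OF refl refl refl refl]
  proof (intro arg_cong2[of _ _ _ _ "(+)"] arg_cong2[of _ _ _ _ scaleR] arg_cong2[of _ _ _ _ "(*)"] refl)
    let ?t = "rad x"
    show "- 16 * bggg_A 2 ?t * bggg_B 2 ?t * bggg_A 2 ?t * bggg_B 2 ?t * dF - 8 * bggg_B 2 ?t * bggg_B 2 ?t * bggg_A 1 ?t * (2 * G\<^sup>2 - 2 * F)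
        + 8 * bggg_A 1 ?t * bggg_A 2 ?t * bggg_A 2 ?t * (- 2 * F) = - 8 * eq_f ?t F dF G"
      by (simp add: eq_f_def algebra_simps power2_eq_square)
    show "16 * bggg_A 1 ?t * bggg_B 1 ?t * bggg_A 2 ?t * bggg_B 2 ?t * dG + 8 * bggg_B 1 ?t * bggg_B 2 ?t * bggg_A 2 ?t * (2 * F * G - 2 * G)
        - 8 * bggg_A 1 ?t * bggg_A 2 ?t * bggg_A 2 ?t * (- 2 * G) = 16 * bggg_A 2 ?t * eq_g ?t F G dG"
      by (simp add: eq_g_def algebra_simps)
    show "- (16 * bggg_A 1 ?t * bggg_B 1 ?t * bggg_A 2 ?t * bggg_B 2 ?t * dG + 8 * bggg_B 1 ?t * bggg_B 2 ?t * bggg_A 2 ?t * (2 * F * G - 2 * G)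
        - 8 * bggg_A 1 ?t * bggg_A 2 ?t * bggg_A 2 ?t * (- 2 * G)) = - 16 * bggg_A 2 ?t * eq_g ?t F G dG"
      by (simp add: eq_g_def algebra_simps)
  qed
  finally show ?thesis .
qed

text \<open>The basis dual to \<open>coframe\<close>. Rescaling it by the metric coefficients gives
  \<open>bggg_frame\<close>.\<close>

definition dual_vec :: "point \<Rightarrow> nat \<Rightarrow> point" where
  "dual_vec x i = (if i = 0 then frame_vec x ((1 / rad x) *\<^sub>R qone) 0 else if i \<le> 3 then frame_vec x (T i) 0
     else frame_vec x (T (i - 3)) (T (i - 3)))"

lemma zero_su2: "0 \<in> su2" and T_su2: "T i \<in> su2"
  by (simp_all add: su2_def T_def)

lemma coframe_dual:
  assumes x: "x \<in> M" "fst x \<noteq> 0" and ij: "i < 7" "j < 7"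
  shows "coframe x i (dual_vec x j) = (if i = j then 1 else 0)"
proof -
  have r: "rad x \<noteq> 0" using x by (simp add: rad_def)
  have f: "coframe x 0 (frame_vec x \<xi> \<zeta>) = rad x * Re (fst \<xi>)"
     "coframe x 1 (frame_vec x \<xi> \<zeta>) = inner (\<xi> - \<zeta>) (T 1)" "coframe x 2 (frame_vec x \<xi> \<zeta>) = inner (\<xi> - \<zeta>) (T 2)"
     "coframe x 3 (frame_vec x \<xi> \<zeta>) = inner (\<xi> - \<zeta>) (T 3)" "coframe x 4 (frame_vec x \<xi> \<zeta>) = inner \<zeta> (T 1)"
     "coframe x 5 (frame_vec x \<xi> \<zeta>) = inner \<zeta> (T 2)" "coframe x 6 (frame_vec x \<xi> \<zeta>) = inner \<zeta> (T 3)"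
     if "\<zeta> \<in> su2" for \<xi> \<zeta>
    using frame_vec_forms[OF x that, of 1 \<xi>] frame_vec_forms[OF x that, of 2 \<xi>] frame_vec_forms[OF x that, of 3 \<xi>]
    by (simp_all add: coframe_def)
  have d: "dual_vec x 0 = frame_vec x ((1 / rad x) *\<^sub>R qone) 0" "dual_vec x 1 = frame_vec x (T 1) 0"
    "dual_vec x 2 = frame_vec x (T 2) 0" "dual_vec x 3 = frame_vec x (T 3) 0" "dual_vec x 4 = frame_vec x (T 1) (T 1)"
    "dual_vec x 5 = frame_vec x (T 2) (T 2)" "dual_vec x 6 = frame_vec x (T 3) (T 3)"
    by (simp_all add: dual_vec_def)
  have q: "inner qone (T 1) = 0" "inner qone (T 2) = 0" "inner qone (T 3) = 0" "Re (fst (T 1)) = 0" "Re (fst (T 2)) = 0" "Re (fst (T 3)) = 0"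
    "Re (fst qone) = 1"
    by (simp_all add: T_def qone_def inner_prod_def inner_complex_def)
  have tt: "inner (T 1) (T 1) = 1" "inner (T 1) (T 2) = 0" "inner (T 1) (T 3) = 0"
    "inner (T 2) (T 1) = 0" "inner (T 2) (T 2) = 1" "inner (T 2) (T 3) = 0"
    "inner (T 3) (T 1) = 0" "inner (T 3) (T 2) = 0" "inner (T 3) (T 3) = 1"
    by (rule trans[OF inner_T]; simp)+
  have rows: "coframe x i (dual_vec x 0) = (if i = 0 then 1 else 0) \<and> coframe x i (dual_vec x 1) = (if i = 1 then 1 else 0) \<and>
    coframe x i (dual_vec x 2) = (if i = 2 then 1 else 0) \<and> coframe x i (dual_vec x 3) = (if i = 3 then 1 else 0) \<and>
    coframe x i (dual_vec x 4) = (if i = 4 then 1 else 0) \<and> coframe x i (dual_vec x 5) = (if i = 5 then 1 else 0) \<and>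
    coframe x i (dual_vec x 6) = (if i = 6 then 1 else 0)"
  proof -
    have "i \<in> {0, 1, 2, 3, 4, 5, 6}" using ij(1) by auto
    then show ?thesis unfolding d
      by (elim insertE emptyE; hypsubst; simp only: f zero_su2 T_su2 q tt fst_scaleR complex_scaleR inner_scaleR_left diff_self diff_zero inner_zero_left; simp add: q tt r)
  qed
  have "j \<in> {0, 1, 2, 3, 4, 5, 6}" using ij(2) by auto
  then show ?thesis using rows by (elim insertE emptyE; hypsubst; blast)
qed

lemma dual_vec_tangent: "x \<in> M \<Longrightarrow> dual_vec x i \<in> tangent x"
  by (simp add: dual_vec_def frame_vec_tangent zero_su2 T_su2)

lemma coform_dual:
  assumes x: "x \<in> M" "fst x \<noteq> 0" and "distinct is" "set is \<subseteq> {..<7}"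
  shows "coform x is (\<lambda>i. dual_vec x (is ! i)) = 1"
  unfolding coform_def
proof (rule det_form_dual)
  fix i j assume ij: "i < length (map (coframe x) is)" "j < length (map (coframe x) is)"
  then have "is ! i < 7" "is ! j < 7" using assms(4) by (auto simp: subset_iff)
  then show "(map (coframe x) is ! i) (dual_vec x (is ! j)) = (if i = j then 1 else 0)"
    using ij assms(3) by (simp add: coframe_dual[OF x] nth_eq_iff_index_eq)
qed

section \<open>Instantons from solutions of the regularised equations\<close>

definition A1_sq :: "real \<Rightarrow> real" where
  "A1_sq z = z * (z + 6) / ((z + 2) * (z + 4))"

text \<open>Obtained by integrating the partial fractions
  \<open>3/4 + 1 / z - 2 / (z + 6) - 1 / (2 * (z + 3))\<close>, the logarithmic derivative that the
  equation for \<open>A_2 g^+\<close> forces when \<open>f^+ = 0\<close>.\<close>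

definition g_weight :: "real \<Rightarrow> real" where
  "g_weight z = exp (3 * z / 4) * z / ((z + 6)\<^sup>2 * sqrt (z + 3))"

definition A1_sq' :: "real \<Rightarrow> real" where
  "A1_sq' z = A1_sq z * (1 / z + 1 / (z + 6) - 1 / (z + 2) - 1 / (z + 4))"

definition g_weight' :: "real \<Rightarrow> real" where
  "g_weight' z = g_weight z * (3/4 + 1 / z - 2 / (z + 6) - 1 / (2 * (z + 3)))"

lemma A1_sq_pos: "0 < z \<Longrightarrow> 0 < A1_sq z"
  by (simp add: A1_sq_def)

lemma g_weight_pos: "0 < z \<Longrightarrow> 0 < g_weight z"
  by (simp add: g_weight_def)

lemma DERIV_A1_sq: "0 < z \<Longrightarrow> (A1_sq has_real_derivative A1_sq' z) (at z)"
proof -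
  assume z: "0 < z"
  have "((\<lambda>z. z * (z + 6) / ((z + 2) * (z + 4))) has_real_derivative
     ((1 * (z + 6) + 1 * z) * ((z + 2) * (z + 4)) - z * (z + 6) * (1 * (z + 4) + 1 * (z + 2))) / ((z + 2) * (z + 4) * ((z + 2) * (z + 4)))) (at z)"
    by (rule derivative_eq_intros refl | use z in simp)+
  moreover have "((1 * (z + 6) + 1 * z) * ((z + 2) * (z + 4)) - z * (z + 6) * (1 * (z + 4) + 1 * (z + 2))) / ((z + 2) * (z + 4) * ((z + 2) * (z + 4))) = A1_sq' z"
    unfolding A1_sq'_def A1_sq_def using z by (simp add: divide_simps) (simp add: algebra_simps)
  ultimately show ?thesis unfolding A1_sq_def[abs_def] by simp
qed

lemma DERIV_g_weight:
  assumes z: "0 < z" shows "(g_weight has_real_derivative g_weight' z) (at z)"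
proof -
  define r where "r = sqrt (z + 3)"
  have r: "r > 0" "z + 3 = r * r" using z by (auto simp: r_def)
  have "((\<lambda>z. exp (3 * z / 4) * z / ((z + 6)\<^sup>2 * sqrt (z + 3))) has_real_derivative
    ((exp (3 * z / 4) * (3/4) * z + exp (3 * z / 4)) * ((z + 6)\<^sup>2 * r)
     - exp (3 * z / 4) * z * (2 * (z + 6) * r + (z + 6)\<^sup>2 * (1 / (2 * r)))) / ((z + 6)\<^sup>2 * r * ((z + 6)\<^sup>2 * r))) (at z)"
    unfolding r_def by (rule derivative_eq_intros refl | use z in \<open>simp add: field_simps\<close>)+
  moreover have "((exp (3 * z / 4) * (3/4) * z + exp (3 * z / 4)) * ((z + 6)\<^sup>2 * r)
     - exp (3 * z / 4) * z * (2 * (z + 6) * r + (z + 6)\<^sup>2 * (1 / (2 * r)))) / ((z + 6)\<^sup>2 * r * ((z + 6)\<^sup>2 * r)) = g_weight' z"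
    unfolding g_weight'_def g_weight_def r_def[symmetric] r(2)
    using z r(1) by (simp add: divide_simps power2_eq_square) (simp add: algebra_simps)
  ultimately show ?thesis unfolding g_weight_def[abs_def] by simp
qed

text \<open>\<open>A1_sq\<close> solves the equation for \<open>A_1 f^+\<close> with
  \<open>g^+ = 0\<close> (fact \<open>h1\<close>), and the formula of \<open>flow_coeff\<close> is
  the one that makes \<open>h2\<close> true. The factor \<open>4/3 * bggg_A 1 t\<close> is
  \<open>dz / dt\<close>.\<close>

lemma eq_f_factor:
  assumes z: "0 < z" and t: "t = t_of z"
  shows "eq_f t (A1_sq z * \<phi>) (4/3 * bggg_A 1 t * (A1_sq' z * \<phi> + A1_sq z * \<phi>')) (g_weight z * w) =
     8/3 * bggg_A 1 t * (bggg_A 2 t)\<^sup>2 * (bggg_B 2 t)\<^sup>2 * A1_sq z * (\<phi>' + flow_coeff z * w\<^sup>2)"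
proof -
  have A2: "(bggg_A 2 t)\<^sup>2 = 3/16 * (z * (z + 4))" and B2: "(bggg_B 2 t)\<^sup>2 = 3/16 * ((z + 2) * (z + 6))"
    using bggg_AB(2,4)[of z t 2] z t by simp_all
  have k2: "(g_weight z)\<^sup>2 = exp (3 * z / 2) * z\<^sup>2 / ((z + 6)^4 * (z + 3))"
    using z by (simp add: g_weight_def power_mult_distrib power_divide exp_double[symmetric] power2_eq_square[of "exp _"] mult_exp_exp flip: power_mult)
  have h1: "(4/3) * (bggg_A 2 t)\<^sup>2 * (bggg_B 2 t)\<^sup>2 * A1_sq' z = ((bggg_B 2 t)\<^sup>2 - (bggg_A 2 t)\<^sup>2) * A1_sq z"
    unfolding A1_sq'_def A1_sq_def A2 B2 using z by (simp add: divide_simps) (simp add: algebra_simps)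
  have h2: "(g_weight z)\<^sup>2 = (4/3) * (bggg_A 2 t)\<^sup>2 * A1_sq z * flow_coeff z"
    unfolding k2 A1_sq_def flow_coeff_def A2 using z by (simp add: divide_simps) (simp add: algebra_simps power2_eq_square eval_nat_numeral)
  have "eq_f t (A1_sq z * \<phi>) (4/3 * bggg_A 1 t * (A1_sq' z * \<phi> + A1_sq z * \<phi>')) (g_weight z * w) =
    2 * bggg_A 1 t * (((4/3) * (bggg_A 2 t)\<^sup>2 * (bggg_B 2 t)\<^sup>2 * A1_sq' z) * \<phi> + (4/3) * (bggg_A 2 t)\<^sup>2 * (bggg_B 2 t)\<^sup>2 * A1_sq z * \<phi>'
      + (bggg_B 2 t)\<^sup>2 * ((g_weight z)\<^sup>2 * w\<^sup>2 - A1_sq z * \<phi>) + (bggg_A 2 t)\<^sup>2 * A1_sq z * \<phi>)"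
    by (simp add: eq_f_def algebra_simps power_mult_distrib)
  then show ?thesis unfolding h1 h2 by (simp add: algebra_simps)
qed

text \<open>The relation \<open>A_1 A_2 = z / (z + 2) * B_2\<close> confines the square roots to a
  common factor; then the equation of \<open>g_weight\<close> cancels the terms without
  \<open>\<phi>\<close> and \<open>w'\<close>.\<close>

lemma eq_g_factor:
  assumes z: "0 < z" and t: "t = t_of z"
  shows "eq_g t (A1_sq z * \<phi>) (g_weight z * w) (4/3 * bggg_A 1 t * (g_weight' z * w + g_weight z * w')) =
     4/3 * A1_sq z * bggg_B 1 t * bggg_B 2 t * g_weight z * (w' + 3/4 * \<phi> * w)"
proof -
  have A1: "bggg_A 1 t * bggg_A 1 t = A1_sq z" using bggg_AB(1)[of z t] z t by (simp add: A1_sq_def)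
  have "bggg_A 1 t * bggg_A 2 t = z / (z + 2) * bggg_B 2 t"
  proof -
    have "sqrt (z * (z + 6) / ((z + 2) * (z + 4))) * sqrt (3/16 * (z * (z + 4))) = sqrt ((z / (z + 2))\<^sup>2 * (3/16 * ((z + 2) * (z + 6))))"
      unfolding real_sqrt_mult[symmetric] using z by (intro arg_cong[where f = sqrt]) (simp add: divide_simps power2_eq_square)
    also have "\<dots> = \<bar>z / (z + 2)\<bar> * sqrt (3/16 * ((z + 2) * (z + 6)))"
      by (simp only: real_sqrt_mult real_sqrt_abs)
    also have "\<bar>z / (z + 2)\<bar> = z / (z + 2)" using z by simp
    finally show ?thesis using bggg_AB(1)[of z t] bggg_AB(2)[of z t 2] bggg_AB(4)[of z t 2] z t by simp
  qed
  also have "\<dots> = 2 * z / ((z + 2) * (z + 3)) * (bggg_B 1 t * bggg_B 2 t)"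
    using bggg_AB(3)[of z t] z t by (simp add: divide_simps)
  finally have AA: "bggg_A 1 t * bggg_A 2 t = 2 * z / ((z + 2) * (z + 3)) * (bggg_B 1 t * bggg_B 2 t)" .
  have k: "4/3 * A1_sq z * g_weight' z = (1 - 2 * z / ((z + 2) * (z + 3))) * g_weight z"
    unfolding g_weight'_def A1_sq_def using z by (simp add: divide_simps) (simp add: algebra_simps)
  have "eq_g t (A1_sq z * \<phi>) (g_weight z * w) (4/3 * bggg_A 1 t * (g_weight' z * w + g_weight z * w')) =
     (bggg_B 1 t * bggg_B 2 t) * ((4/3 * (bggg_A 1 t * bggg_A 1 t) * g_weight' z) * w + 4/3 * (bggg_A 1 t * bggg_A 1 t) * g_weight z * w' + A1_sq z * \<phi> * g_weight z * w - g_weight z * w)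
      + (bggg_A 1 t * bggg_A 2 t) * g_weight z * w"
    by (simp add: eq_g_def algebra_simps)
  then show ?thesis unfolding AA A1 k by (simp add: algebra_simps)
qed

lemma DERIV_radial:
  assumes z: "0 < z" and t: "t = t_of z"
    and P: "(P has_real_derivative P') (at (t\<^sup>2))"
    and F: "\<And>y. 0 < y \<Longrightarrow> F y = t_sq y * P (t_sq y)"
  shows "(F has_real_derivative (2 * t * (P (t\<^sup>2) + t\<^sup>2 * P')) * (3 / (4 * bggg_A 1 t))) (at z)"
proof -
  have d: "(t_of has_real_derivative 3/4 * sqrt ((z + 2) * (z + 4) / (z * (z + 6)))) (at z)" by (rule DERIV_t_of[OF z])
  have e: "3/4 * sqrt ((z + 2) * (z + 4) / (z * (z + 6))) = 3 / (4 * bggg_A 1 t)"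
    using bggg_AB(1)[of z t] z t by (simp add: real_sqrt_divide)
  have 2: "((\<lambda>z. (t_of z)\<^sup>2) has_real_derivative 2 * t * (3 / (4 * bggg_A 1 t))) (at z)"
    using d unfolding e t[symmetric] by (auto intro!: derivative_eq_intros simp: t)
  have "((\<lambda>z. P ((t_of z)\<^sup>2)) has_real_derivative P' * (2 * t * (3 / (4 * bggg_A 1 t)))) (at z)"
    by (rule DERIV_chain2[where f = P and g = "\<lambda>z. (t_of z)\<^sup>2", OF _ 2]) (use P t in simp)
  from DERIV_mult[OF 2 this] have "((\<lambda>z. (t_of z)\<^sup>2 * P ((t_of z)\<^sup>2)) has_real_derivative
     (2 * t * (P (t\<^sup>2) + t\<^sup>2 * P')) * (3 / (4 * bggg_A 1 t))) (at z)"
    by (rule DERIV_cong) (simp add: t[symmetric] algebra_simps)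
  then show ?thesis
    by (rule has_field_derivative_transform_within_open[where S = "{0<..}"]) (use z F t_of_sq in auto)
qed

text \<open>The inverse coordinate as a function of \<open>s = t\<^sup>2\<close>. For
  \<open>b < 0\<close> its domain is an open set containing all \<open>s \<ge> 0\<close>, which is
  the reason for solving the flow below 0.\<close>

definition z_of :: "real \<Rightarrow> real \<Rightarrow> real" where
  "z_of b = the_inv_into {b<..} t_sq"

lemma t_sq_inj: "-1 < b \<Longrightarrow> inj_on t_sq {b<..}"
  using t_sq_strict_mono by (intro linorder_inj_onI) (auto simp: less_imp_neq)

lemma z_of_t_sq: "-1 < b \<Longrightarrow> b < z \<Longrightarrow> z_of b (t_sq z) = z"
  unfolding z_of_def using t_sq_inj by (intro the_inv_into_f_f) auto

lemma t_sq_z_of: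
  assumes "-1 < b" "s \<in> t_sq ` {b<..}" shows "t_sq (z_of b s) = s" "b < z_of b s"
  using assms z_of_t_sq by auto

lemma continuous_on_t_sq: "-2 \<le> b \<Longrightarrow> continuous_on {b<..} t_sq"
  by (rule DERIV_continuous_on, rule has_field_derivative_at_within, rule DERIV_t_sq) auto

lemma t_sq_image_nonneg:
  assumes "b < 0" "0 \<le> s" shows "s \<in> t_sq ` {b<..}"
proof -
  obtain z where "0 \<le> z" "t_of z = sqrt s" using t_of_surj[of "sqrt s"] assms by auto
  then show ?thesis using t_of_sq[of z] assms by (auto intro!: image_eqI[of _ _ z])
qed

lemma open_t_sq_image:
  assumes "-1 < b" shows "open (t_sq ` {b<..})"
  by (rule invariance_of_domain[OF continuous_on_t_sq]) (use assms t_sq_inj in auto)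

lemma DERIV_z_of:
  assumes b: "-1 < b" and s: "s \<in> t_sq ` {b<..}"
  shows "(z_of b has_real_derivative inverse (3/2 * (t_ratio (z_of b s) * dt_factor (z_of b s)))) (at s)"
proof -
  let ?z = "z_of b s" and ?d = "3/2 * (t_ratio (z_of b s) * dt_factor (z_of b s))"
  have z: "b < ?z" "t_sq ?z = s" using t_sq_z_of[OF b s] by auto
  have d: "(t_sq has_derivative (\<lambda>h. ?d * h)) (at ?z)"
    by (rule DERIV_t_sq[unfolded has_field_derivative_def]) (use z b in simp)
  have "(z_of b has_derivative (\<lambda>h. inverse ?d * h)) (at s)"
  proof (rule has_derivative_inverse_strong_x[of "{b<..}" "z_of b" s t_sq "\<lambda>h. ?d * h"])
    show "(\<lambda>h. ?d * h) \<circ> (\<lambda>h. inverse ?d * h) = id"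
      using t_ratio_pos[of ?z] dt_factor_pos[of ?z] z b by (auto simp: fun_eq_iff)
  qed (use z d b z_of_t_sq continuous_on_t_sq in \<open>auto simp del: times_divide_eq_left\<close>)
  then show ?thesis unfolding has_field_derivative_def .
qed

text \<open>Bootstrap: the derivative of the inverse is a smooth function of the inverse
  itself.\<close>

lemma Ck_on_z_of:
  assumes b: "-1 < b" shows "Ck_on k (t_sq ` {b<..}) (z_of b)"
proof (induction k)
  case 0
  have "continuous_on (t_sq ` {b<..}) (z_of b)"
    by (rule DERIV_continuous_on, rule has_field_derivative_at_within, rule DERIV_z_of[OF b])
  then show ?case by simp
next
  case (Suc k)
  let ?J = "t_sq ` {b<..}"
  have "Ck_on k {-2<..} (\<lambda>z. inverse (3/2 * (t_ratio z * dt_factor z)))"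
    by (rule Ck_on_inverse[OF _ Ck_on_mult[OF _ Ck_on_const Ck_on_mult[OF _ Ck_on_t_ratio Ck_on_dt_factor]]]) (auto simp: t_ratio_pos dt_factor_pos)
  then have "Ck_on k ?J (\<lambda>s. inverse (3/2 * (t_ratio (z_of b s) * dt_factor (z_of b s))))"
    by (rule Ck_on_compose[OF open_t_sq_image[OF b] _ _ Suc, rotated]) (use t_sq_z_of[OF b] b in force)+
  note ck = this
  show ?case by (rule Ck_on_Suc_realI[OF open_t_sq_image[OF b] _ ck]) (rule DERIV_z_of[OF b])
qed

lemma Ck_on_flow_coeff: "Ck_on k {-1<..} flow_coeff"
  unfolding flow_coeff_def[abs_def]
  by (intro Ck_on_divide Ck_on_mult Ck_on_exp Ck_on_power Ck_on_add Ck_on_ident Ck_on_const open_greaterThan) auto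

text \<open>Bootstrap on both functions at once: the derivative of \<open>\<phi>\<close> is a smooth
  expression in \<open>z\<close> and \<open>L\<close>, and that of \<open>L\<close> is
  \<open>\<phi>\<close>.\<close>

lemma Ck_on_flow:
  assumes "flow p0 w0 b \<phi> L"
  shows "Ck_on k {b<..} \<phi> \<and> Ck_on k {b<..} L"
proof (induction k)
  case 0 show ?case using flow_cont[OF assms] by simp
next
  case (Suc k)
  have b: "{b<..} \<subseteq> {-1<..}" using assms by (auto simp: flow_def)
  have "Ck_on k {b<..} (\<lambda>z. - (w0\<^sup>2) * flow_coeff z * exp (- (3/2 * L z)))"
    by (intro Ck_on_mult Ck_on_exp Ck_on_minus Ck_on_const Ck_on_subset[OF Ck_on_flow_coeff b] open_greaterThan) (use Suc in auto)
  then have "Ck_on (Suc k) {b<..} \<phi>"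
    by (rule Ck_on_Suc_realI[rotated 2]) (use assms in \<open>auto simp: flow_def\<close>)
  moreover have "Ck_on (Suc k) {b<..} L"
    by (rule Ck_on_Suc_realI[of _ _ \<phi>]) (use assms Suc in \<open>auto simp: flow_def\<close>)
  ultimately show ?case by blast
qed

text \<open>
  The components \<open>A\<^sub>1 f\<^sup>+\<close> and \<open>A\<^sub>2 g\<^sup>+\<close> divided by \<open>t\<^sup>2\<close>, as functions of \<open>s = t\<^sup>2\<close>: in this form they
  are smooth across the singular orbit \<open>s = 0\<close>.
\<close>

definition sol_P :: "real \<Rightarrow> (real \<Rightarrow> real) \<Rightarrow> real \<Rightarrow> real" where
  "sol_P b \<phi> s = (let z = z_of b s in (z + 6) * \<phi> z / ((z + 2) * (z + 4) * (t_ratio z)\<^sup>2))"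

definition sol_Q :: "real \<Rightarrow> real \<Rightarrow> (real \<Rightarrow> real) \<Rightarrow> real \<Rightarrow> real" where
  "sol_Q w0 b L s = (let z = z_of b s in exp (3 * z / 4) * (w0 * exp (- (3/4 * L z))) / ((z + 6)\<^sup>2 * sqrt (z + 3) * (t_ratio z)\<^sup>2))"

lemma sol_t_sq:
  assumes "-1 < b" "b < z"
  shows "t_sq z * sol_P b \<phi> (t_sq z) = A1_sq z * \<phi> z"
    "t_sq z * sol_Q w0 b L (t_sq z) = g_weight z * (w0 * exp (- (3/4 * L z)))"
  using assms t_ratio_pos[of z] unfolding sol_P_def sol_Q_def z_of_t_sq[OF assms] Let_def
  by (simp_all add: t_sq_def A1_sq_def g_weight_def)

lemma Ck_on_sol:
  assumes f: "flow p0 w0 b \<phi> L"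
  shows "Ck_on k (t_sq ` {b<..}) (sol_P b \<phi>)" "Ck_on k (t_sq ` {b<..}) (sol_Q w0 b L)"
proof -
  have b: "-1 < b" using f by (simp add: flow_def)
  have mp: "0 < t_ratio z" if "b < z" for z using t_ratio_pos[of z] that b by simp
  then have m0: "t_ratio z \<noteq> 0" if "b < z" for z using that by force
  have m: "Ck_on k {b<..} t_ratio" by (rule Ck_on_subset[OF Ck_on_t_ratio]) (use b in auto)
  have "Ck_on k {b<..} (\<lambda>z. (z + 6) * \<phi> z / ((z + 2) * (z + 4) * (t_ratio z)\<^sup>2))"
    by (intro Ck_on_divide Ck_on_mult Ck_on_power Ck_on_add Ck_on_ident Ck_on_const open_greaterThan m)
      (use Ck_on_flow[OF f] b m0 in \<open>auto intro!: mult_pos_pos\<close>)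
  from Ck_on_compose[OF open_t_sq_image[OF b] _ this Ck_on_z_of[OF b]]
  show "Ck_on k (t_sq ` {b<..}) (sol_P b \<phi>)" unfolding sol_P_def[abs_def] Let_def
    using t_sq_z_of[OF b] by auto
  have "Ck_on k {b<..} (\<lambda>z. exp (3 * z / 4) * (w0 * exp (- (3/4 * L z))) / ((z + 6)\<^sup>2 * sqrt (z + 3) * (t_ratio z)\<^sup>2))"
    by (intro Ck_on_divide Ck_on_mult Ck_on_power Ck_on_exp Ck_on_minus Ck_on_sqrt Ck_on_add Ck_on_ident Ck_on_const open_greaterThan m)
      (use Ck_on_flow[OF f] b m0 in \<open>auto intro!: mult_pos_pos\<close>)
  from Ck_on_compose[OF open_t_sq_image[OF b] _ this Ck_on_z_of[OF b]]
  show "Ck_on k (t_sq ` {b<..}) (sol_Q w0 b L)" unfolding sol_Q_def[abs_def] Let_def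
    using t_sq_z_of[OF b] by auto
qed

definition flow_conn :: "real \<Rightarrow> real \<Rightarrow> (real \<Rightarrow> real) \<Rightarrow> (real \<Rightarrow> real) \<Rightarrow> conn" where
  "flow_conn w0 b \<phi> L = model (sol_P b \<phi>) (sol_Q w0 b L)"

lemma linear_cform: "linear (cform x)"
  by (rule linearI) (simp_all add: cform_def qmult_add algebra_simps)

lemma linear_model: "linear (model P Q x)"
  by (rule linearI) (simp_all add: model_def linear_add[OF linear_cform] linear_cmul[OF linear_cform] inner_add_left algebra_simps)

lemma model_su2: "model P Q x X \<in> su2"
  by (simp add: model_def su2_def T_def)

lemma Ck_on_cform: "Ck_on k UNIV (\<lambda>x. cform x X)"
  unfolding cform_def
  by (intro Ck_on_add Ck_on_scaleR bounded_bilinear.Ck_on_bilinear[OF bounded_bilinear_qmult] Ck_on_const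
      bounded_linear.Ck_on_linear[OF bounded_linear_fst] bounded_linear.Ck_on_linear[OF bounded_linear_snd]
      bounded_linear.Ck_on_linear[OF bounded_linear_compose[OF bounded_linear_qcnj bounded_linear_fst]] open_UNIV)

lemma Ck_on_model:
  assumes J: "open J" "\<And>s. 0 \<le> s \<Longrightarrow> s \<in> J" and P: "Ck_on k J P" and Q: "Ck_on k J Q"
  shows "Ck_on k UNIV (\<lambda>x. model P Q x X)"
proof -
  have n: "Ck_on k UNIV (\<lambda>x :: point. (norm (fst x))\<^sup>2)"
    unfolding power2_norm_eq_inner by (intro Ck_on_inner bounded_linear.Ck_on_linear[OF bounded_linear_fst] open_UNIV)
  have H: "Ck_on k UNIV (\<lambda>x :: point. H ((norm (fst x))\<^sup>2))" if "Ck_on k J H" for H :: "real \<Rightarrow> real"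
    by (rule Ck_on_compose[OF open_UNIV J(1) that n]) (simp add: J(2))
  show ?thesis unfolding model_def
    by (intro Ck_on_add Ck_on_scaleR Ck_on_mult Ck_on_inner Ck_on_cform Ck_on_const H P Q open_UNIV)
qed

lemma connection_flow_conn:
  assumes f: "flow p0 w0 b \<phi> L"
  shows "connection_P1 (flow_conn w0 b \<phi> L)"
proof -
  have b: "-1 < b" "b < 0" using f by (auto simp: flow_def)
  have "Ck_on k UNIV (\<lambda>x. flow_conn w0 b \<phi> L x X)" for k X
    unfolding flow_conn_def
    by (rule Ck_on_model[OF open_t_sq_image[OF b(1)] t_sq_image_nonneg[OF b(2)] Ck_on_sol[OF f]])
  then have "smooth_near M (\<lambda>x. flow_conn w0 b \<phi> L x X)" for X
    unfolding smooth_near_def by (intro exI[of _ UNIV]) auto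
  then show ?thesis by (auto simp: connection_P1_def flow_conn_def linear_model model_su2)
qed

lemma U1_SU2: "c \<in> U1 \<Longrightarrow> c \<in> SU2"
  by (auto simp: U1_def expT1_def SU2_def norm_Pair)

text \<open>Conjugation by \<open>exp (a T_1)\<close> fixes \<open>T 1\<close> and rotates the plane
  of \<open>T 2\<close> and \<open>T 3\<close>, so it commutes with scaling the line by
  \<open>h\<close> and the plane by \<open>k\<close>.\<close>

lemma U1_conj:
  assumes "c \<in> U1"
  shows "(h * inner (qcnj c \<odot> u \<odot> c) (T 1)) *\<^sub>R T 1 + (k * inner (qcnj c \<odot> u \<odot> c) (T 2)) *\<^sub>R T 2 + (k * inner (qcnj c \<odot> u \<odot> c) (T 3)) *\<^sub>R T 3
    = qcnj c \<odot> ((h * inner u (T 1)) *\<^sub>R T 1 + (k * inner u (T 2)) *\<^sub>R T 2 + (k * inner u (T 3)) *\<^sub>R T 3) \<odot> c"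
proof -
  obtain a where c: "c = (cis a, 0)" using assms by (auto simp: U1_def expT1_def)
  have cs: "cos a * (cos a * x) + sin a * (sin a * x) = x" for x
    by (simp add: mult.assoc[symmetric] distrib_right[symmetric] power2_eq_square[symmetric])
  show ?thesis
    unfolding c
    by (simp add: T_def qmult_def qcnj_def inner_prod_def inner_complex_def complex_eq_iff prod_eq_iff)
       (simp add: algebra_simps cs)
qed

text \<open>\<open>cform\<close> is invariant under \<open>SU(2)^2\<close> and is conjugated by
  \<open>c\<close> under right multiplication, while the coefficients depend on the norm
  only.\<close>

lemma invariant_model: "invariant_connection (model P Q)"
  unfolding invariant_connection_def
proof (intro allI impI conjI ballI)
  fix p q v w a1 a2 assume a: "a1 \<in> SU2" "a2 \<in> SU2"
  have n: "norm (a1 \<odot> p) = norm p"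
    using inner_qmult_left[of a1 p p] norm_SU2[OF a(1)] by (simp add: norm_eq_sqrt_inner)
  have "cform (a1 \<odot> p, a1 \<odot> q \<odot> qcnj a2) (a1 \<odot> v, a1 \<odot> w \<odot> qcnj a2) = cform (p, q) (v, w)"
    by (simp add: cform_def qmult_assoc SU2_cancel a)
  then show "model P Q (a1 \<odot> p, a1 \<odot> q \<odot> qcnj a2) (a1 \<odot> v, a1 \<odot> w \<odot> qcnj a2) = model P Q (p, q) (v, w)"
    by (simp add: model_def n)
next
  fix p q v w c assume c: "c \<in> U1"
  have n: "norm (p \<odot> c) = norm p"
    using inner_qmult_right[of p c p] norm_SU2[OF U1_SU2[OF c]] by (simp add: norm_eq_sqrt_inner)
  have "cform (p \<odot> c, q) (v \<odot> c, w) = qcnj c \<odot> cform (p, q) (v, w) \<odot> c"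
    by (simp add: cform_def qmult_assoc qmult_add)
  then show "model P Q (p \<odot> c, q) (v \<odot> c, w) = qcnj c \<odot> model P Q (p, q) (v, w) \<odot> c"
    unfolding model_def by (simp only: fst_conv n U1_conj[OF c])
qed

text \<open>The remaining factors in \<open>eq_f_factor\<close> and \<open>eq_g_factor\<close> are
  positive. The equivalence is used in both directions: \<open>K_flow\<close> constructs instantons
  with it, \<open>normal_form_ode\<close> recovers the flow from a given one.\<close>

lemma K_model:
  assumes z: "0 < z" and t: "t = t_of z"
    and P: "(P has_real_derivative P') (at (t\<^sup>2))" and Q: "(Q has_real_derivative Q') (at (t\<^sup>2))"
    and F: "\<And>y. 0 < y \<Longrightarrow> A1_sq y * \<phi> y = t_sq y * P (t_sq y)" and G: "\<And>y. 0 < y \<Longrightarrow> g_weight y * w y = t_sq y * Q (t_sq y)"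
    and d: "(\<phi> has_real_derivative \<phi>') (at z)" "(w has_real_derivative w') (at z)"
  shows "eq_f t (t\<^sup>2 * P (t\<^sup>2)) (2 * t * (P (t\<^sup>2) + t\<^sup>2 * P')) (t\<^sup>2 * Q (t\<^sup>2)) = 0 \<longleftrightarrow> \<phi>' = - flow_coeff z * (w z)\<^sup>2"
    "eq_g t (t\<^sup>2 * P (t\<^sup>2)) (t\<^sup>2 * Q (t\<^sup>2)) (2 * t * (Q (t\<^sup>2) + t\<^sup>2 * Q')) = 0 \<longleftrightarrow> w' = - (3/4) * \<phi> z * w z"
proof -
  have s: "t\<^sup>2 = t_sq z" using t_of_sq[of z] z t by simp
  have A: "0 < bggg_A 1 t" "0 < bggg_A 2 t" "0 < bggg_B 1 t" "0 < bggg_B 2 t"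
    using bggg_AB(1)[of z t] bggg_AB(2)[of z t 2] bggg_AB(3)[of z t] bggg_AB(4)[of z t 2] z t by simp_all
  have 1: "2 * t * (P (t\<^sup>2) + t\<^sup>2 * P') = 4/3 * bggg_A 1 t * (A1_sq' z * \<phi> z + A1_sq z * \<phi>')"
  proof -
    have "((\<lambda>z. A1_sq z * \<phi> z) has_real_derivative A1_sq' z * \<phi> z + A1_sq z * \<phi>') (at z)"
      using DERIV_mult[OF DERIV_A1_sq[OF z] d(1)] by (simp add: mult_ac add_ac)
    from DERIV_unique[OF this DERIV_radial[OF z t P F]] A(1) show ?thesis by (simp add: field_simps)
  qed
  have 2: "2 * t * (Q (t\<^sup>2) + t\<^sup>2 * Q') = 4/3 * bggg_A 1 t * (g_weight' z * w z + g_weight z * w')"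
  proof -
    have "((\<lambda>z. g_weight z * w z) has_real_derivative g_weight' z * w z + g_weight z * w') (at z)"
      using DERIV_mult[OF DERIV_g_weight[OF z] d(2)] by (simp add: mult_ac add_ac)
    from DERIV_unique[OF this DERIV_radial[OF z t Q G]] A(1) show ?thesis by (simp add: field_simps)
  qed
  have f: "t\<^sup>2 * P (t\<^sup>2) = A1_sq z * \<phi> z" "t\<^sup>2 * Q (t\<^sup>2) = g_weight z * w z" using F[OF z] G[OF z] s by simp_all
  show "eq_f t (t\<^sup>2 * P (t\<^sup>2)) (2 * t * (P (t\<^sup>2) + t\<^sup>2 * P')) (t\<^sup>2 * Q (t\<^sup>2)) = 0 \<longleftrightarrow> \<phi>' = - flow_coeff z * (w z)\<^sup>2"
    unfolding 1 f eq_f_factor[OF z t] using A A1_sq_pos[OF z] by auto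
  show "eq_g t (t\<^sup>2 * P (t\<^sup>2)) (t\<^sup>2 * Q (t\<^sup>2)) (2 * t * (Q (t\<^sup>2) + t\<^sup>2 * Q')) = 0 \<longleftrightarrow> w' = - (3/4) * \<phi> z * w z"
    unfolding 2 f eq_g_factor[OF z t] using A A1_sq_pos[OF z] g_weight_pos[OF z] by auto
qed

lemma DERIV_sol:
  assumes f: "flow p0 w0 b \<phi> L" and s: "0 \<le> s"
  shows "(sol_P b \<phi> has_real_derivative frechet_derivative (sol_P b \<phi>) (at s) 1) (at s)"
    "(sol_Q w0 b L has_real_derivative frechet_derivative (sol_Q w0 b L) (at s) 1) (at s)"
  using Ck_on_Suc_realD[OF Ck_on_sol(1)[OF f]] Ck_on_Suc_realD[OF Ck_on_sol(2)[OF f]] t_sq_image_nonneg[of b s] s f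
  by (auto simp: flow_def)

definition flow_w :: "real \<Rightarrow> (real \<Rightarrow> real) \<Rightarrow> real \<Rightarrow> real" where
  "flow_w w0 L z = w0 * exp (- (3/4 * L z))"

lemma flow_w_sq: "(flow_w w0 L z)\<^sup>2 = w0\<^sup>2 * exp (- (3/2 * L z))"
  by (simp add: flow_w_def power_mult_distrib power2_eq_square[of "exp _"] mult_exp_exp)

lemma DERIV_flow:
  assumes f: "flow p0 w0 b \<phi> L" and z: "b < z"
  shows "(\<phi> has_real_derivative - flow_coeff z * (flow_w w0 L z)\<^sup>2) (at z)"
    "(flow_w w0 L has_real_derivative - (3/4) * \<phi> z * flow_w w0 L z) (at z)"
proof -
  have "(\<phi> has_real_derivative - (w0\<^sup>2) * flow_coeff z * exp (- (3/2 * L z))) (at z)" using f z by (simp add: flow_def)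
  then show "(\<phi> has_real_derivative - flow_coeff z * (flow_w w0 L z)\<^sup>2) (at z)"
    by (rule DERIV_cong) (simp add: flow_w_sq)
  have d: "(L has_real_derivative \<phi> z) (at z)" using f z by (simp add: flow_def)
  show "(flow_w w0 L has_real_derivative - (3/4) * \<phi> z * flow_w w0 L z) (at z)"
    unfolding flow_w_def[abs_def] by (rule derivative_eq_intros d refl | simp)+
qed

lemma K_flow:
  assumes f: "flow p0 w0 b \<phi> L" and z: "0 < z" and t: "t = t_of z"
  defines "P \<equiv> sol_P b \<phi>" and "Q \<equiv> sol_Q w0 b L"
  shows "eq_f t (t\<^sup>2 * P (t\<^sup>2)) (2 * t * (P (t\<^sup>2) + t\<^sup>2 * frechet_derivative P (at (t\<^sup>2)) 1)) (t\<^sup>2 * Q (t\<^sup>2)) = 0"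
    "eq_g t (t\<^sup>2 * P (t\<^sup>2)) (t\<^sup>2 * Q (t\<^sup>2)) (2 * t * (Q (t\<^sup>2) + t\<^sup>2 * frechet_derivative Q (at (t\<^sup>2)) 1)) = 0"
proof -
  have b: "-1 < b" "b < 0" using f by (auto simp: flow_def)
  have F: "A1_sq y * \<phi> y = t_sq y * P (t_sq y)" "g_weight y * flow_w w0 L y = t_sq y * Q (t_sq y)" if "0 < y" for y
    unfolding P_def Q_def using sol_t_sq[of b y] that b by (simp_all add: flow_w_def)
  note K = K_model[OF z t DERIV_sol[OF f zero_le_power2, folded P_def Q_def] F DERIV_flow[OF f]]
  show "eq_f t (t\<^sup>2 * P (t\<^sup>2)) (2 * t * (P (t\<^sup>2) + t\<^sup>2 * frechet_derivative P (at (t\<^sup>2)) 1)) (t\<^sup>2 * Q (t\<^sup>2)) = 0"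
    "eq_g t (t\<^sup>2 * P (t\<^sup>2)) (t\<^sup>2 * Q (t\<^sup>2)) (2 * t * (Q (t\<^sup>2) + t\<^sup>2 * frechet_derivative Q (at (t\<^sup>2)) 1)) = 0"
    using K b z by simp_all
qed

lemma rad_pos_t_of:
  assumes "fst x \<noteq> 0" obtains z where "0 < z" "rad x = t_of z"
proof -
  have r: "0 < rad x" using assms by (simp add: rad_def)
  obtain z where z: "0 \<le> z" "t_of z = rad x" using t_of_surj[of "rad x"] r by auto
  moreover have "z \<noteq> 0" using z r by (auto simp: t_of_def)
  ultimately show ?thesis using that[of z] by auto
qed

lemma flow_conn_instanton:
  assumes f: "flow p0 w0 b \<phi> L"
  shows "bggg_instanton (flow_conn w0 b \<phi> L)"
  unfolding bggg_instanton_def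
proof (intro ballI impI allI)
  fix x and V :: "nat \<Rightarrow> point" assume x: "x \<in> M" "fst x \<noteq> 0" and V: "\<forall>i<6. V i \<in> tangent x"
  obtain z where z: "0 < z" "rad x = t_of z" using rad_pos_t_of[OF x(2)] .
  have V': "\<And>i. i < 6 \<Longrightarrow> V i \<in> tangent x" using V by blast
  show "wedge 2 4 (\<lambda>W. curvature (flow_conn w0 b \<phi> L) x (W 0) (W 1)) (bggg_psi x) V = 0"
    by (subst instanton_form[where A = "flow_conn w0 b \<phi> L", OF x V' curvature_model[OF x refl refl DERIV_sol[OF f zero_le_power2] refl refl refl refl, folded flow_conn_def]])
      (use K_flow[OF f z] in simp_all)
qed

text \<open>The vectors \<open>dual_vec\<close> are tangent to \<open>M\<close>, and the six-forms
  of \<open>instanton_form\<close> take the value 1 on them, which isolates the coefficients one by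
  one.\<close>

lemma instanton_K:
  assumes x: "x \<in> M" "fst x \<noteq> 0" and I: "bggg_instanton A"
    and d: "(P has_real_derivative P') (at ((rad x)\<^sup>2))" "(Q has_real_derivative Q') (at ((rad x)\<^sup>2))"
    and C: "\<And>X Y. X \<in> tangent x \<Longrightarrow> Y \<in> tangent x \<Longrightarrow> curvature A x X Y = curvature (model P Q) x X Y"
  shows "eq_f (rad x) ((rad x)\<^sup>2 * P ((rad x)\<^sup>2)) (2 * rad x * (P ((rad x)\<^sup>2) + (rad x)\<^sup>2 * P')) ((rad x)\<^sup>2 * Q ((rad x)\<^sup>2)) = 0"
    "eq_g (rad x) ((rad x)\<^sup>2 * P ((rad x)\<^sup>2)) ((rad x)\<^sup>2 * Q ((rad x)\<^sup>2)) (2 * rad x * (Q ((rad x)\<^sup>2) + (rad x)\<^sup>2 * Q')) = 0"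
proof -
  let ?k1 = "eq_f (rad x) ((rad x)\<^sup>2 * P ((rad x)\<^sup>2)) (2 * rad x * (P ((rad x)\<^sup>2) + (rad x)\<^sup>2 * P')) ((rad x)\<^sup>2 * Q ((rad x)\<^sup>2))"
  let ?k2 = "eq_g (rad x) ((rad x)\<^sup>2 * P ((rad x)\<^sup>2)) ((rad x)\<^sup>2 * Q ((rad x)\<^sup>2)) (2 * rad x * (Q ((rad x)\<^sup>2) + (rad x)\<^sup>2 * Q'))"
  obtain z where z: "0 < z" "rad x = t_of z" using rad_pos_t_of[OF x(2)] .
  have A2: "bggg_A 2 (rad x) \<noteq> 0" using bggg_AB(2)[of z "rad x" 2] z by simp
  have main: "(- 8 * ?k1 * coform x [0, 1, 2, 3, 5, 6] V) *\<^sub>R T 1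
    + (16 * bggg_A 2 (rad x) * ?k2 * coform x [0, 1, 2, 3, 4, 6] V) *\<^sub>R T 2
    + (- 16 * bggg_A 2 (rad x) * ?k2 * coform x [0, 1, 2, 3, 4, 5] V) *\<^sub>R T 3 = 0" if V: "\<And>i. V i \<in> tangent x" for V
  proof -
    have "wedge 2 4 (\<lambda>W. curvature A x (W 0) (W 1)) (bggg_psi x) V = 0"
      using I x V unfolding bggg_instanton_def by blast
    then show ?thesis
      using instanton_form[where A = A, OF x V trans[OF C curvature_model[OF x refl refl d refl refl refl refl]]] by simp
  qed
  have Tc: "a = 0 \<and> b = 0 \<and> c = 0" if "a *\<^sub>R T 1 + b *\<^sub>R T 2 + c *\<^sub>R T 3 = 0" for a b c
    using that by (simp add: T_def prod_eq_iff complex_eq_iff)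
  have "coform x [0, 1, 2, 3, 5, 6] (\<lambda>i. dual_vec x ([0, 1, 2, 3, 5, 6] ! i)) = 1"
    by (rule coform_dual[OF x]) auto
  with Tc[OF main[of "\<lambda>i. dual_vec x ([0, 1, 2, 3, 5, 6] ! i)"]] show "?k1 = 0"
    using dual_vec_tangent[OF x(1)] by simp
  have "coform x [0, 1, 2, 3, 4, 6] (\<lambda>i. dual_vec x ([0, 1, 2, 3, 4, 6] ! i)) = 1"
    by (rule coform_dual[OF x]) auto
  with Tc[OF main[of "\<lambda>i. dual_vec x ([0, 1, 2, 3, 4, 6] ! i)"]] show "?k2 = 0"
    using dual_vec_tangent[OF x(1)] A2 by simp
qed

lemma connection_P1_differentiable:
  assumes "connection_P1 A" "x \<in> M"
  shows "(\<lambda>y. A y X) differentiable (at x)"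
proof -
  obtain N where N: "M \<subseteq> N" "Ck_on (Suc 0) N (\<lambda>x. A x X)"
    using assms(1) unfolding connection_P1_def smooth_near_def by meson
  then show ?thesis using assms(2) by auto
qed

section \<open>Uniqueness and existence\<close>

text \<open>A slice that meets every orbit of \<open>SU(2)^2\<close>, along which the radial
  functions can be read off.\<close>

definition base_point :: "real \<Rightarrow> point" where
  "base_point t = (t *\<^sub>R qone, qone)"

lemma base_point: "base_point t \<in> M" "0 < t \<Longrightarrow> rad (base_point t) = t" "0 < t \<Longrightarrow> fst (base_point t) \<noteq> 0"
  by (simp_all add: base_point_def M_def SU2_def rad_def qone_def norm_Pair zero_prod_def)

text \<open>Regularity is inherited from the connection: up to the factor \<open>y\<close>, the
  radial functions are its components on the constant vectors \<open>(T i, 0)\<close> along the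
  slice.\<close>

lemma normal_form_radial:
  assumes A: "connection_P1 A"
    and n: "\<And>x X. x \<in> M \<Longrightarrow> fst x \<noteq> 0 \<Longrightarrow> X \<in> tangent x \<Longrightarrow>
      A x X = (F (rad x) * eta_plus 1 x X) *\<^sub>R T 1 + G (rad x) *\<^sub>R (eta_plus 2 x X *\<^sub>R T 2 + eta_plus 3 x X *\<^sub>R T 3)"
    and t: "0 < t"
  shows "F differentiable (at t)" "G differentiable (at t)"
proof -
  have l: "A (base_point y) (T i, 0) = (1 / y) *\<^sub>R A (base_point y) (field_plus i (base_point y))" if "0 < y" for y i
  proof -
    have "linear (A (base_point y))" using A base_point(1) by (simp add: connection_P1_def)
    from linear_cmul[OF this, of y "(T i, 0)"] show ?thesis using that by (simp add: field_plus_def base_point_def)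
  qed
  have tg: "field_plus i x \<in> tangent x" for i x by (simp add: field_plus_def tangent_def)
  have tt: "inner (T 1) (T 1) = 1" "inner (T 2) (T 2) = 1"  "inner (T 2) (T 1) = 0" "inner (T 3) (T 1) = 0" "inner (T 1) (T 2) = 0" "inner (T 3) (T 2) = 0"
    by (rule trans[OF inner_T]; simp)+
  have F: "y * inner (A (base_point y) (T 1, 0)) (T 1) = F y" "y * inner (A (base_point y) (T 2, 0)) (T 2) = G y" if y: "0 < y" for y
  proof -
    note b = base_point(1)[of y] base_point(3)[OF y]
    have e: "eta_plus 1 (base_point y) (field_plus 1 (base_point y)) = 1" "eta_plus 2 (base_point y) (field_plus 1 (base_point y)) = 0"
      "eta_plus 3 (base_point y) (field_plus 1 (base_point y)) = 0" "eta_plus 1 (base_point y) (field_plus 2 (base_point y)) = 0"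
      "eta_plus 2 (base_point y) (field_plus 2 (base_point y)) = 1" "eta_plus 3 (base_point y) (field_plus 2 (base_point y)) = 0"
      by (rule trans[OF eta_dual(1)[OF b]]; simp)+
    show "y * inner (A (base_point y) (T 1, 0)) (T 1) = F y" "y * inner (A (base_point y) (T 2, 0)) (T 2) = G y"
      unfolding l[OF y] n[OF b tg] e base_point(2)[OF y] using y tt by (simp_all add: inner_add_left)
  qed
  have bd: "base_point differentiable (at t)"
    unfolding base_point_def[abs_def] differentiable_def by (intro exI) (rule derivative_intros)+
  have "(\<lambda>y. A (base_point y) X) differentiable (at t)" for X
    using differentiable_chain_at[OF bd connection_P1_differentiable[OF A base_point(1)]] by (simp add: o_def)
  then have "(\<lambda>y. y * inner (A (base_point y) X) v) differentiable (at t)" for X v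
    by (intro differentiable_mult differentiable_inner differentiable_ident differentiable_const)
  note D = this
  have p: "0 < y" if "dist y t < t" for y :: real using that by (auto simp: dist_real_def)
  show "F differentiable (at t)"
    by (rule differentiable_transform_within[OF D[of "(T 1, 0)" "T 1"] t]) (use F(1) p in auto)
  show "G differentiable (at t)"
    by (rule differentiable_transform_within[OF D[of "(T 2, 0)" "T 2"] t]) (use F(2) p in auto)
qed

text \<open>Off the singular orbit the connection coincides on tangent vectors with a
  \<open>model\<close>, whose curvature is known. \<open>curvature_cong\<close> carries the formula
  over, and one point of each orbit gives the equations at each \<open>z\<close>.\<close>

lemma normal_form_ode:
  assumes A: "connection_P1 A" and I: "bggg_instanton A"
    and n: "\<And>x X. x \<in> M \<Longrightarrow> fst x \<noteq> 0 \<Longrightarrow> X \<in> tangent x \<Longrightarrow>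
      A x X = (F (rad x) * eta_plus 1 x X) *\<^sub>R T 1 + G (rad x) *\<^sub>R (eta_plus 2 x X *\<^sub>R T 2 + eta_plus 3 x X *\<^sub>R T 3)"
    and z: "0 < z"
  defines "\<phi> \<equiv> \<lambda>z. F (t_of z) / A1_sq z" and "w \<equiv> \<lambda>z. G (t_of z) / g_weight z"
  shows "(\<phi> has_real_derivative - flow_coeff z * (w z)\<^sup>2) (at z)" "(w has_real_derivative - (3/4) * \<phi> z * w z) (at z)"
proof -
  define P where "P s = F (sqrt s) / s" for s
  define Q where "Q s = G (sqrt s) / s" for s
  define t where "t = t_of z"
  have t: "0 < t" using t_of_pos z t_def by simp
  note dF = normal_form_radial[OF A n]
  have dPQ: "P differentiable (at s)" "Q differentiable (at s)" if s: "0 < s" for s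
  proof -
    have q: "sqrt differentiable (at s)"
      using s DERIV_real_sqrt real_differentiable_def by blast
    have "(\<lambda>s. F (sqrt s)) differentiable (at s)" "(\<lambda>s. G (sqrt s)) differentiable (at s)"
      using differentiable_chain_at[OF q dF(1)] differentiable_chain_at[OF q dF(2)] s by (simp_all add: o_def)
    then show "P differentiable (at s)" "Q differentiable (at s)"
      unfolding P_def[abs_def] Q_def[abs_def] using s by (auto intro!: differentiable_divide)
  qed
  obtain P' where P': "(P has_real_derivative P') (at (t\<^sup>2))" using dPQ(1)[of "t\<^sup>2"] t real_differentiable_def by auto
  obtain Q' where Q': "(Q has_real_derivative Q') (at (t\<^sup>2))" using dPQ(2)[of "t\<^sup>2"] t real_differentiable_def by auto
  have PF: "y\<^sup>2 * P (y\<^sup>2) = F y" "y\<^sup>2 * Q (y\<^sup>2) = G y" if "0 < y" for y using that by (simp_all add: P_def Q_def)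
  have eq: "A y X = model P Q y X" if "y \<in> M" "fst y \<noteq> 0" "X \<in> tangent y" for y X
  proof -
    have "0 < rad y" using that by (simp add: rad_def)
    then show ?thesis unfolding n[OF that] model_eta[OF that] by (simp add: PF)
  qed
  let ?x = "base_point t"
  note bx = base_point(1)[of t] base_point(3)[OF t]
  have C: "curvature A ?x X Y = curvature (model P Q) ?x X Y" if "X \<in> tangent ?x" "Y \<in> tangent ?x" for X Y
  proof (rule curvature_cong[OF bx(1) that, where N = "{y. fst y \<noteq> 0}"])
    show "(\<lambda>y. A y Z) differentiable (at ?x)" for Z by (rule connection_P1_differentiable[OF A bx(1)])
    have "(norm (fst ?x))\<^sup>2 = t\<^sup>2" using base_point(2)[OF t] by (simp add: rad_def)
    then show "(\<lambda>y. model P Q y Z) differentiable (at ?x)" for Z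
      using has_derivative_model[of P P' ?x Q Q' Z] P' Q' unfolding differentiable_def by auto
    show "open {y :: point. fst y \<noteq> 0}" by (intro open_Collect_neq continuous_intros)
    show "linear (A y)" if "y \<in> {y. fst y \<noteq> 0} \<inter> M" for y using A that by (simp add: connection_P1_def)
  qed (use bx eq linear_model in auto)
  have phi: "A1_sq y * \<phi> y = t_sq y * P (t_sq y)" "g_weight y * w y = t_sq y * Q (t_sq y)" if y: "0 < y" for y
    using PF[OF t_of_pos[OF y]] A1_sq_pos[OF y] g_weight_pos[OF y] t_of_sq[of y] y by (simp_all add: \<phi>_def w_def)
  have bd: "t_of differentiable (at z)" using DERIV_t_of[OF z] real_differentiable_def by blast
  have "(\<lambda>z. F (t_of z)) differentiable (at z)" "(\<lambda>z. G (t_of z)) differentiable (at z)"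
    using differentiable_chain_at[OF bd dF(1)] differentiable_chain_at[OF bd dF(2)] t unfolding t_def by (simp_all add: o_def)
  moreover have "A1_sq differentiable (at z)" "g_weight differentiable (at z)"
    using DERIV_A1_sq[OF z] DERIV_g_weight[OF z] real_differentiable_def by blast+
  ultimately have "\<phi> differentiable (at z)" "w differentiable (at z)"
    unfolding \<phi>_def w_def using A1_sq_pos[OF z] g_weight_pos[OF z] by (auto intro!: differentiable_divide)
  then obtain \<phi>' w' where d: "(\<phi> has_real_derivative \<phi>') (at z)" "(w has_real_derivative w') (at z)"
    using real_differentiable_def by blast
  note K = instanton_K[OF bx I, unfolded base_point(2)[OF t], OF P' Q' C]
  note K' = K_model[OF z t_def P' Q' phi d]
  show "(\<phi> has_real_derivative - flow_coeff z * (w z)\<^sup>2) (at z)" "(w has_real_derivative - (3/4) * \<phi> z * w z) (at z)"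
    using K K' d by simp_all
qed

section \<open>Initial values at the singular orbit\<close>

lemma tendsto_bigo_at_0:
  fixes f :: "real \<Rightarrow> real"
  assumes "(\<lambda>t. f t - c * t) \<in> O[at_right 0](\<lambda>t. t ^ 3)"
  shows "((\<lambda>t. f t / t) \<longlongrightarrow> c) (at_right 0)"
proof -
  obtain k where k: "\<forall>\<^sub>F t in at_right 0. norm (f t - c * t) \<le> k * norm (t ^ 3)"
    using assms by (elim landau_o.bigE)
  have "((\<lambda>t. f t / t - c) \<longlongrightarrow> 0) (at_right 0)"
  proof (rule Lim_null_comparison)
    show "\<forall>\<^sub>F t in at_right 0. norm (f t / t - c) \<le> k * t\<^sup>2"
      using k eventually_at_right_less[of 0]
    proof eventually_elim
      case (elim t)
      have "f t / t - c = (f t - c * t) / t" using elim by (simp add: field_simps)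
      then have "norm (f t / t - c) = norm (f t - c * t) / t" using elim by simp
      also have "\<dots> \<le> k * norm (t ^ 3) / t" using elim by (intro divide_right_mono) auto
      also have "\<dots> = k * t\<^sup>2" using elim by (simp add: power3_eq_cube power2_eq_square)
      finally show ?case .
    qed
    have "((\<lambda>t. k * t\<^sup>2) \<longlongrightarrow> k * 0\<^sup>2) (at_right 0)" by (intro tendsto_intros)
    then show "((\<lambda>t. k * t\<^sup>2) \<longlongrightarrow> 0) (at_right 0)" by simp
  qed
  then show ?thesis by (simp add: Lim_null[symmetric])
qed

lemma filterlim_t_of: "filterlim t_of (at_right 0) (at_right 0)"
proof -
  have "(t_of \<longlongrightarrow> t_of 0) (at 0 within {0..})"
    using continuous_on_t_of by (simp add: continuous_on_def)
  then have "(t_of \<longlongrightarrow> t_of 0) (at 0 within {0<..})" by (rule tendsto_within_subset) auto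
  then have "(t_of \<longlongrightarrow> 0) (at_right 0)" by (simp add: t_of_def)
  moreover have "\<forall>\<^sub>F z in at_right 0. 0 < t_of z"
    using eventually_at_right_less[of 0] by eventually_elim (rule t_of_pos)
  ultimately show ?thesis by (auto simp: filterlim_at elim: eventually_mono)
qed

text \<open>The limit of \<open>A_2 t / g_weight z\<close> at \<open>z = 0\<close>, the product of
  \<open>sqrt 3\<close>, \<open>sqrt 3 / 2\<close>, 36 and \<open>sqrt 3\<close>. It converts
  \<open>g_1^+\<close> into \<open>w(0)\<close>; the corresponding factor for \<open>f_1^+\<close>
  is 2.\<close>

definition w_scale :: real where "w_scale = 54 * sqrt 3"

text \<open>The quotients \<open>A\<^sub>1 t / A1_sq z\<close> and \<open>A\<^sub>2 t / g_weight z\<close>, in a form that extends to \<open>z = 0\<close>.\<close>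

definition ratio1 :: "real \<Rightarrow> real" where
  "ratio1 z = t_ratio z * sqrt ((z + 2) * (z + 4) / (z + 6))"

definition ratio2 :: "real \<Rightarrow> real" where
  "ratio2 z = t_ratio z * sqrt (3/16 * (z + 4)) * ((z + 6)\<^sup>2 * sqrt (z + 3)) / exp (3 * z / 4)"

lemma ratio_eq:
  assumes z: "0 < z"
  shows "bggg_A 1 (t_of z) * t_of z / A1_sq z = ratio1 z" "bggg_A 2 (t_of z) * t_of z / g_weight z = ratio2 z"
proof -
  have q: "sqrt z * sqrt z = z" using z by simp
  have "sqrt (z * (z + 6) / ((z + 2) * (z + 4))) * sqrt z = A1_sq z * sqrt ((z + 2) * (z + 4) / (z + 6))"
  proof -
    have "z * (z + 6) / ((z + 2) * (z + 4)) * z = (A1_sq z)\<^sup>2 * ((z + 2) * (z + 4) / (z + 6))"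
      using z by (simp add: A1_sq_def divide_simps power2_eq_square)
    then have "sqrt (z * (z + 6) / ((z + 2) * (z + 4)) * z) = sqrt ((A1_sq z)\<^sup>2 * ((z + 2) * (z + 4) / (z + 6)))" by simp
    then show ?thesis using A1_sq_pos[OF z] by (simp only: real_sqrt_mult real_sqrt_abs abs_of_pos)
  qed
  then have 1: "bggg_A 1 (t_of z) * sqrt z = A1_sq z * sqrt ((z + 2) * (z + 4) / (z + 6))"
    using bggg_AB(1)[of z "t_of z"] z by simp
  show "bggg_A 1 (t_of z) * t_of z / A1_sq z = ratio1 z"
    unfolding t_of_def[of z] mult.assoc[symmetric] 1[unfolded t_of_def[of z]] using A1_sq_pos[OF z] by (simp add: ratio1_def)
  have "sqrt (3/16 * (z * (z + 4))) * sqrt z = sqrt (3/16 * (z + 4)) * z"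
  proof -
    have "sqrt (3/16 * (z * (z + 4))) = sqrt (3/16 * (z + 4)) * sqrt z" by (simp add: real_sqrt_mult[symmetric] mult_ac)
    then show ?thesis using q by (simp only: mult.assoc)
  qed
  then have 2: "bggg_A 2 (t_of z) * sqrt z = sqrt (3/16 * (z + 4)) * z"
    using bggg_AB(2)[of z "t_of z" 2] z by simp
  show "bggg_A 2 (t_of z) * t_of z / g_weight z = ratio2 z"
    unfolding t_of_def[of z] mult.assoc[symmetric] 2[unfolded t_of_def[of z]] using z by (simp add: ratio2_def g_weight_def divide_simps)
qed

lemma Ck_on_ratio: "Ck_on k {-1<..} ratio1" "Ck_on k {-1<..} ratio2"
proof -
  have m: "Ck_on k {-1<..} t_ratio" by (rule Ck_on_subset[OF Ck_on_t_ratio]) auto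
  show "Ck_on k {-1<..} ratio1" unfolding ratio1_def[abs_def]
    by (intro Ck_on_divide Ck_on_mult Ck_on_sqrt Ck_on_add Ck_on_ident Ck_on_const open_greaterThan m) auto
  show "Ck_on k {-1<..} ratio2" unfolding ratio2_def[abs_def]
    by (intro Ck_on_divide Ck_on_mult Ck_on_power Ck_on_exp Ck_on_sqrt Ck_on_add Ck_on_ident Ck_on_const open_greaterThan m) auto
qed

lemma ratio_0: "ratio1 0 = 2" "ratio2 0 = w_scale"
proof -
  have q: "sqrt (8/6) = 2 / sqrt 3" "sqrt (3/4) = sqrt 3 / 2" by (simp_all add: real_sqrt_divide real_div_sqrt)
  show "ratio1 0 = 2" by (simp add: ratio1_def t_ratio_0 real_sqrt_divide)
  show "ratio2 0 = w_scale" by (simp add: ratio2_def t_ratio_0 w_scale_def real_sqrt_divide)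
qed

lemma ratio_pos: "-1 < z \<Longrightarrow> 0 < ratio1 z" "-1 < z \<Longrightarrow> 0 < ratio2 z"
  using t_ratio_pos[of z] by (simp_all add: ratio1_def ratio2_def)

lemma tendsto_ratio: "(ratio1 \<longlongrightarrow> 2) (at_right 0)" "(ratio2 \<longlongrightarrow> w_scale) (at_right 0)"
proof -
  have "isCont ratio1 0" "isCont ratio2 0"
    using Ck_on_ratio[of 0] by (auto simp: continuous_on_eq_continuous_at)
  then show "(ratio1 \<longlongrightarrow> 2) (at_right 0)" "(ratio2 \<longlongrightarrow> w_scale) (at_right 0)"
    unfolding isCont_def ratio_0 by (auto intro: tendsto_within_subset)
qed

lemma continuous_on_extend_0:
  fixes h :: "real \<Rightarrow> real"
  assumes "\<And>z. 0 < z \<Longrightarrow> isCont h z" "(h \<longlongrightarrow> c) (at_right 0)"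
  shows "continuous_on {0..} (\<lambda>z. if z = 0 then c else h z)"
  unfolding continuous_on_def
proof
  fix z :: real assume z: "z \<in> {0..}"
  show "((\<lambda>z. if z = 0 then c else h z) \<longlongrightarrow> (if z = 0 then c else h z)) (at z within {0..})"
  proof (cases "z = 0")
    case True
    have e: "at 0 within {0..} = at_right (0::real)"
    proof -
      have "{0..} - {0} = {0<..} - {0::real}" by auto
      then show ?thesis by (metis at_within_def)
    qed
    have "((\<lambda>z. if z = 0 then c else h z) \<longlongrightarrow> c) (at_right 0)"
      by (rule Lim_transform_eventually[OF assms(2)]) (use eventually_at_right_less[of 0] in \<open>eventually_elim, simp\<close>)
    then show ?thesis using True e by simp
  next
    case False
    then have "0 < z" using z by simp
    then have "(h \<longlongrightarrow> h z) (at z)" using assms(1) by (simp add: isCont_def)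
    moreover have "\<forall>\<^sub>F y in at z. h y = (if y = 0 then c else h y)"
    proof -
      have "\<forall>\<^sub>F y in at z. y \<in> {0<..}" using \<open>0 < z\<close> by (intro eventually_at_in_open') auto
      then show ?thesis by (rule eventually_mono) auto
    qed
    ultimately have "((\<lambda>z. if z = 0 then c else h z) \<longlongrightarrow> h z) (at z)" by (rule Lim_transform_eventually)
    then show ?thesis using False by (auto intro: tendsto_within_subset)
  qed
qed

text \<open>Off the singular orbit the coefficients of both connections solve the same regular
  initial value problem. On the orbit the values agree by continuity along the segment from
  \<open>(s, q)\<close> to \<open>(0, q)\<close>.\<close>

theorem instanton_at_unique:
  assumes I: "instanton_at (f1, g1) A" and fl: "flow (2 * f1) (w_scale * g1) b \<phi> L"
    and x: "x \<in> M" and X: "X \<in> tangent x"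
  shows "A x X = flow_conn (w_scale * g1) b \<phi> L x X"
proof -
  let ?w0 = "w_scale * g1"
  let ?B = "flow_conn ?w0 b \<phi> L"
  have AC: "connection_P1 A" and AI: "bggg_instanton A" using I by (auto simp: instanton_at_def invariant_instanton_def)
  obtain f g where fO: "(\<lambda>t. f t - f1 * t) \<in> O[at_right 0](\<lambda>t. t ^ 3)" and gO: "(\<lambda>t. g t - g1 * t) \<in> O[at_right 0](\<lambda>t. t ^ 3)"
    and n0: "\<And>x X. x \<in> M \<Longrightarrow> fst x \<noteq> 0 \<Longrightarrow> X \<in> tangent x \<Longrightarrow>
           A x X = (bggg_A 1 (rad x) * f (rad x) * eta_plus 1 x X) *\<^sub>R T 1
                 + (bggg_A 2 (rad x) * g (rad x)) *\<^sub>R (eta_plus 2 x X *\<^sub>R T 2 + eta_plus 3 x X *\<^sub>R T 3)"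
    using I unfolding instanton_at_def fst_conv snd_conv by blast
  define F where "F t = bggg_A 1 t * f t" for t
  define G where "G t = bggg_A 2 t * g t" for t
  have n: "A x X = (F (rad x) * eta_plus 1 x X) *\<^sub>R T 1 + G (rad x) *\<^sub>R (eta_plus 2 x X *\<^sub>R T 2 + eta_plus 3 x X *\<^sub>R T 3)"
    if "x \<in> M" "fst x \<noteq> 0" "X \<in> tangent x" for x X
    unfolding F_def G_def by (rule n0[OF that])
  define h where "h z = F (t_of z) / A1_sq z" for z
  define k where "k z = G (t_of z) / g_weight z" for z
  have d: "(h has_real_derivative - flow_coeff z * (k z)\<^sup>2) (at z)" "(k has_real_derivative - (3/4) * h z * k z) (at z)" if "0 < z" for z
    using normal_form_ode[OF AC AI n that] unfolding h_def[abs_def] k_def[abs_def] by auto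
  have lf: "((\<lambda>z. f (t_of z) / t_of z) \<longlongrightarrow> f1) (at_right 0)" "((\<lambda>z. g (t_of z) / t_of z) \<longlongrightarrow> g1) (at_right 0)"
    using filterlim_compose[OF tendsto_bigo_at_0[OF fO] filterlim_t_of] filterlim_compose[OF tendsto_bigo_at_0[OF gO] filterlim_t_of] by auto
  have hl: "(h \<longlongrightarrow> 2 * f1) (at_right 0)"
  proof (rule Lim_transform_eventually[OF tendsto_mult[OF tendsto_ratio(1) lf(1)]])
    show "\<forall>\<^sub>F z in at_right 0. ratio1 z * (f (t_of z) / t_of z) = h z"
      using eventually_at_right_less[of 0]
    proof eventually_elim
      case (elim z)
      have "t_of z \<noteq> 0" using t_of_pos[OF elim] by simp
      then show ?case by (simp add: h_def F_def flip: ratio_eq[OF elim])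
    qed
  qed
  have kl: "(k \<longlongrightarrow> ?w0) (at_right 0)"
  proof (rule Lim_transform_eventually[OF tendsto_mult[OF tendsto_ratio(2) lf(2)]])
    show "\<forall>\<^sub>F z in at_right 0. ratio2 z * (g (t_of z) / t_of z) = k z"
      using eventually_at_right_less[of 0]
    proof eventually_elim
      case (elim z)
      have "t_of z \<noteq> 0" using t_of_pos[OF elim] by simp
      then show ?case by (simp add: k_def G_def flip: ratio_eq[OF elim])
    qed
  qed
  \<comment> \<open>\<open>h\<close> and \<open>k\<close> come from the connection for
    \<open>z > 0\<close> only; their limits are filled in at 0 to meet the form required by
    \<open>flow_unique\<close>.\<close>
  define h0 where "h0 z = (if z = 0 then 2 * f1 else h z)" for z
  define k0 where "k0 z = (if z = 0 then ?w0 else k z)" for z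
  have b: "-1 < b" "b < 0" using fl by (auto simp: flow_def)
  have eqz: "h z = \<phi> z \<and> k z = flow_w ?w0 L z" if z: "0 < z" for z
  proof -
    have "h0 z = \<phi> z \<and> k0 z = flow_w ?w0 L z"
    proof (rule flow_unique[where ?p1.0 = h0 and ?p2.0 = \<phi> and ?w1.0 = k0 and ?w2.0 = "flow_w ?w0 L"])
      show "continuous_on {0..} h0" unfolding h0_def[abs_def] using d(1) hl by (intro continuous_on_extend_0) (auto intro: DERIV_isCont)
      show "continuous_on {0..} k0" unfolding k0_def[abs_def] using d(2) kl by (intro continuous_on_extend_0) (auto intro: DERIV_isCont)
      show "continuous_on {0..} \<phi>" using flow_cont(1)[OF fl] b by (auto elim: continuous_on_subset)
      show "continuous_on {0..} (flow_w ?w0 L)" unfolding flow_w_def[abs_def]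
        by (intro continuous_intros continuous_on_subset[OF flow_cont(2)[OF fl]]) (use b in auto)
      show "h0 0 = \<phi> 0" "k0 0 = flow_w ?w0 L 0" using fl by (simp_all add: h0_def k0_def flow_w_def flow_def)
      fix y :: real assume y: "0 < y"
      show "(\<phi> has_real_derivative - flow_coeff y * (flow_w ?w0 L y)\<^sup>2) (at y)"
        "(flow_w ?w0 L has_real_derivative - (3/4) * \<phi> y * flow_w ?w0 L y) (at y)"
        using DERIV_flow[OF fl, of y] y b by auto
      have "(h0 has_real_derivative - flow_coeff y * (k y)\<^sup>2) (at y)"
        by (rule has_field_derivative_transform_within_open[OF d(1)[OF y], of "{0<..}"]) (use y in \<open>auto simp: h0_def\<close>)
      then show "(h0 has_real_derivative - flow_coeff y * (k0 y)\<^sup>2) (at y)" using y by (simp add: k0_def)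
      have "(k0 has_real_derivative - (3/4) * h y * k y) (at y)"
        by (rule has_field_derivative_transform_within_open[OF d(2)[OF y], of "{0<..}"]) (use y in \<open>auto simp: k0_def\<close>)
      then show "(k0 has_real_derivative - (3/4) * h0 y * k0 y) (at y)" using y by (simp add: k0_def h0_def)
    qed (use z in simp)
    then show ?thesis using z by (simp add: h0_def k0_def)
  qed
  have off: "A y Y = ?B y Y" if y: "y \<in> M" "fst y \<noteq> 0" "Y \<in> tangent y" for y Y
  proof -
    obtain z where z: "0 < z" "rad y = t_of z" using rad_pos_t_of[OF y(2)] .
    have s: "(rad y)\<^sup>2 = t_sq z" using z t_of_sq[of z] by simp
    have bz: "b < z" using b z by simp
    have "F (rad y) = t_sq z * sol_P b \<phi> (t_sq z)" "G (rad y) = t_sq z * sol_Q ?w0 b L (t_sq z)"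
      unfolding sol_t_sq[OF b(1) bz] using eqz[OF z(1)] A1_sq_pos[OF z(1)] g_weight_pos[OF z(1)]
      by (auto simp: h_def k_def z(2) flow_w_def field_simps)
    then show ?thesis unfolding n[OF y] flow_conn_def model_eta[OF y] s by simp
  qed
  show ?thesis
  proof (cases "fst x = 0")
    case False then show ?thesis using off x X by blast
  next
    case True
    define \<gamma> where "\<gamma> s = (s *\<^sub>R qone, snd x)" for s :: real
    have \<gamma>0: "\<gamma> 0 = x" using True by (simp add: \<gamma>_def prod_eq_iff)
    have \<gamma>M: "\<gamma> s \<in> M" for s using x by (auto simp: \<gamma>_def M_def)
    have \<gamma>c: "isCont \<gamma> 0" unfolding \<gamma>_def[abs_def] by (intro continuous_intros)
    have lim: "((\<lambda>s. C (\<gamma> s) X) \<longlongrightarrow> C x X) (at_right 0)" if "connection_P1 C" for C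
    proof -
      have "isCont (\<lambda>y. C y X) (\<gamma> 0)"
        using connection_P1_differentiable[OF that x, of X] \<gamma>0 by (simp add: differentiable_imp_continuous_within)
      from isCont_o2[OF \<gamma>c this] show ?thesis unfolding isCont_def \<gamma>0 by (auto intro: tendsto_within_subset)
    qed
    have "\<forall>\<^sub>F s in at_right 0. A (\<gamma> s) X = ?B (\<gamma> s) X"
      using eventually_at_right_less[of 0]
    proof eventually_elim
      case (elim s)
      show ?case by (rule off[OF \<gamma>M]) (use elim X in \<open>auto simp: \<gamma>_def tangent_def qone_def zero_prod_def\<close>)
    qed
    from Lim_transform_eventually[OF lim[OF AC] this] lim[OF connection_flow_conn[OF fl]]
    show ?thesis using tendsto_unique trivial_limit_at_right_real by blast
  qed
qed

text \<open>The remainder is \<open>t ^ 3\<close> times the difference quotient of \<open>k\<close>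
  at 0, taken at \<open>t\<^sup>2\<close>.\<close>

lemma DERIV_bigo:
  fixes k :: "real \<Rightarrow> real"
  assumes "(k has_real_derivative D) (at 0)"
  shows "(\<lambda>t. t * k (t\<^sup>2) - k 0 * t) \<in> O[at_right 0](\<lambda>t. t ^ 3)"
proof -
  have "((\<lambda>s. (k s - k 0) / s) \<longlongrightarrow> D) (at 0)" using assms by (simp add: has_field_derivative_iff)
  moreover have "filterlim (\<lambda>t::real. t\<^sup>2) (at 0) (at_right 0)"
    unfolding filterlim_at
  proof
    show "\<forall>\<^sub>F t in at_right 0. t\<^sup>2 \<in> UNIV \<and> t\<^sup>2 \<noteq> (0::real)"
      using eventually_at_right_less[of 0] by eventually_elim simp
    show "((\<lambda>t::real. t\<^sup>2) \<longlongrightarrow> 0) (at_right 0)"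
    proof -
      have "((\<lambda>t::real. t\<^sup>2) \<longlongrightarrow> 0\<^sup>2) (at_right 0)" by (intro tendsto_intros)
      then show ?thesis by simp
    qed
  qed
  ultimately have "((\<lambda>t. (k (t\<^sup>2) - k 0) / t\<^sup>2) \<longlongrightarrow> D) (at_right 0)" by (rule filterlim_compose)
  moreover have "\<forall>\<^sub>F t in at_right 0. (k (t\<^sup>2) - k 0) / t\<^sup>2 = (t * k (t\<^sup>2) - k 0 * t) / t ^ 3"
    using eventually_at_right_less[of 0] by eventually_elim (simp add: divide_simps power2_eq_square power3_eq_cube algebra_simps)
  ultimately have l: "((\<lambda>t. (t * k (t\<^sup>2) - k 0 * t) / t ^ 3) \<longlongrightarrow> D) (at_right 0)" by (rule Lim_transform_eventually)
  show ?thesis by (rule bigoI_tendsto[OF l]) (use eventually_at_right_less[of 0] in \<open>eventually_elim, simp\<close>)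
qed

text \<open>The remainders of third order come from writing \<open>f t = t * kf (t\<^sup>2)\<close>
  and \<open>g t = t * kg (t\<^sup>2)\<close> with \<open>kf\<close>, \<open>kg\<close>
  differentiable at 0.\<close>

theorem instanton_at_flow_conn:
  assumes fl: "flow (2 * f1) (w_scale * g1) b \<phi> L"
  shows "instanton_at (f1, g1) (flow_conn (w_scale * g1) b \<phi> L)"
proof -
  let ?w0 = "w_scale * g1"
  let ?B = "flow_conn ?w0 b \<phi> L"
  have b: "-1 < b" "b < 0" using fl by (auto simp: flow_def)
  define kf where "kf s = \<phi> (z_of b s) / ratio1 (z_of b s)" for s
  define kg where "kg s = flow_w ?w0 L (z_of b s) / ratio2 (z_of b s)" for s
  define f where "f t = t\<^sup>2 * sol_P b \<phi> (t\<^sup>2) / bggg_A 1 t" for t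
  define g where "g t = t\<^sup>2 * sol_Q ?w0 b L (t\<^sup>2) / bggg_A 2 t" for t
  have fk: "f t = t * kf (t\<^sup>2)" "g t = t * kg (t\<^sup>2)" "bggg_A 1 t \<noteq> 0" "bggg_A 2 t \<noteq> 0" if t: "0 < t" for t
  proof -
    obtain z where z: "0 \<le> z" "t_of z = t" using t_of_surj[of t] t by auto
    then have z0: "0 < z" using t by (cases "z = 0") (auto simp: t_of_def)
    have s: "t\<^sup>2 = t_sq z" using t_of_sq[of z] z by simp
    have bz: "b < z" using b z0 by simp
    have A: "0 < bggg_A 1 t" "0 < bggg_A 2 t"
      using bggg_AB(1)[of z t] bggg_AB(2)[of z t 2] z z0 by simp_all
    then show "bggg_A 1 t \<noteq> 0" "bggg_A 2 t \<noteq> 0" by auto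
    show "f t = t * kf (t\<^sup>2)" "g t = t * kg (t\<^sup>2)"
      unfolding f_def g_def kf_def kg_def s z_of_t_sq[OF b(1) bz] sol_t_sq[OF b(1) bz] ratio_eq[OF z0, symmetric] z(2)
      using A t A1_sq_pos[OF z0] g_weight_pos[OF z0] by (simp_all add: flow_w_def field_simps)
  qed
  have Z0: "z_of b 0 = 0" using z_of_t_sq[OF b] by (simp add: t_sq_def)
  have z0: "0 \<in> t_sq ` {b<..}" using t_sq_image_nonneg[OF b(2)] by simp
  have rb: "Ck_on (Suc 0) {b<..} ratio1" "Ck_on (Suc 0) {b<..} ratio2"
    by (rule Ck_on_subset[OF Ck_on_ratio(1)]; use b in auto)
       (rule Ck_on_subset[OF Ck_on_ratio(2)]; use b in auto)
  have J: "open (t_sq ` {b<..})" by (rule open_t_sq_image[OF b(1)])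
  have "Ck_on (Suc 0) {b<..} (\<lambda>z. \<phi> z / ratio1 z)" "Ck_on (Suc 0) {b<..} (\<lambda>z. flow_w ?w0 L z / ratio2 z)"
    unfolding flow_w_def
    by (intro Ck_on_divide Ck_on_mult Ck_on_exp Ck_on_minus Ck_on_const open_greaterThan rb conjunct1[OF Ck_on_flow[OF fl]]
        conjunct2[OF Ck_on_flow[OF fl]] ratio_pos; use b in simp)+
  from Ck_on_compose[OF J open_greaterThan this(1) Ck_on_z_of[OF b(1)]] Ck_on_compose[OF J open_greaterThan this(2) Ck_on_z_of[OF b(1)]]
  have "Ck_on (Suc 0) (t_sq ` {b<..}) kf" "Ck_on (Suc 0) (t_sq ` {b<..}) kg"
    unfolding kf_def[abs_def] kg_def[abs_def] using t_sq_z_of[OF b(1)] by auto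
  note dk = Ck_on_Suc_realD[OF this(1) z0] Ck_on_Suc_realD[OF this(2) z0]
  have k0: "kf 0 = f1" "kg 0 = g1"
    using fl ratio_0 ratio_pos(2)[of 0] by (simp_all add: kf_def kg_def Z0 flow_def flow_w_def)
  have ev: "\<forall>\<^sub>F t in at_right 0. t * kf (t\<^sup>2) - kf 0 * t = f t - f1 * t" "\<forall>\<^sub>F t in at_right 0. t * kg (t\<^sup>2) - kg 0 * t = g t - g1 * t"
    using eventually_at_right_less[of 0] by (eventually_elim, simp add: fk k0)+
  have O: "(\<lambda>t. f t - f1 * t) \<in> O[at_right 0](\<lambda>t. t ^ 3)" "(\<lambda>t. g t - g1 * t) \<in> O[at_right 0](\<lambda>t. t ^ 3)"
    using landau_o.big.in_cong[OF ev(1)] landau_o.big.in_cong[OF ev(2)] DERIV_bigo[OF dk(1)] DERIV_bigo[OF dk(2)] by auto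
  have "invariant_instanton ?B"
    unfolding invariant_instanton_def using connection_flow_conn[OF fl] flow_conn_instanton[OF fl] invariant_model
    by (auto simp: flow_conn_def)
  moreover have "?B x X = (bggg_A 1 (rad x) * f (rad x) * eta_plus 1 x X) *\<^sub>R T 1
                 + (bggg_A 2 (rad x) * g (rad x)) *\<^sub>R (eta_plus 2 x X *\<^sub>R T 2 + eta_plus 3 x X *\<^sub>R T 3)"
    if "x \<in> M" "fst x \<noteq> 0" "X \<in> tangent x" for x X
  proof -
    have "0 < rad x" using that by (simp add: rad_def)
    then have "bggg_A 1 (rad x) * f (rad x) = (rad x)\<^sup>2 * sol_P b \<phi> ((rad x)\<^sup>2)" "bggg_A 2 (rad x) * g (rad x) = (rad x)\<^sup>2 * sol_Q ?w0 b L ((rad x)\<^sup>2)"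
      using fk(3,4)[of "rad x"] by (simp_all add: f_def g_def)
    then show ?thesis unfolding flow_conn_def model_eta[OF that] by simp
  qed
  ultimately show ?thesis unfolding instanton_at_def fst_conv snd_conv using O by blast
qed

section \<open>Curvature decay\<close>

lemma scaleR_frame_vec: "c *\<^sub>R frame_vec x \<xi> \<zeta> = frame_vec x (c *\<^sub>R \<xi>) (c *\<^sub>R \<zeta>)"
  by (simp add: frame_vec_def)

lemma coframe_scale:
  assumes x: "x \<in> M" "fst x \<noteq> 0" "X \<in> tangent x" and k: "k < 7"
  shows "coframe x k (c *\<^sub>R X) = c * coframe x k X"
proof -
  obtain \<xi> \<zeta> where X: "\<zeta> \<in> su2" "X = frame_vec x \<xi> \<zeta>" using tangent_frame_vec[OF x] .
  have z: "c *\<^sub>R \<zeta> \<in> su2" using X(1) by (simp add: su2_def)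
  consider "k = 0" | "0 < k" "k \<le> 3" | "3 < k" by linarith
  then show ?thesis
  proof cases
    case 1
    show ?thesis unfolding 1 X(2) scaleR_frame_vec
      using frame_vec_forms(1)[OF x(1,2) X(1), of 1] frame_vec_forms(1)[OF x(1,2) z, of 1] by (simp add: coframe_def)
  next
    case 2
    then have i: "k \<in> {1..3}" by auto
    show ?thesis unfolding X(2) scaleR_frame_vec using 2
      by (simp add: coframe_def frame_vec_forms(2)[OF x(1,2) X(1) i] frame_vec_forms(2)[OF x(1,2) z i] inner_diff_left algebra_simps)
  next
    case 3
    then have i: "k - 3 \<in> {1..3}" using k by auto
    show ?thesis unfolding X(2) scaleR_frame_vec using 3
      by (simp add: coframe_def frame_vec_forms(3)[OF x(1,2) X(1) i] frame_vec_forms(3)[OF x(1,2) z i])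
  qed
qed

definition frame_scale :: "real \<Rightarrow> nat \<Rightarrow> real" where
  "frame_scale t i = (if i = 0 then 1 else if i \<le> 3 then 1 / (2 * bggg_A i t) else 1 / (2 * bggg_B (i - 3) t))"

lemma bggg_frame_dual:
  assumes "fst x \<noteq> 0"
  shows "bggg_frame x i = frame_scale (rad x) i *\<^sub>R dual_vec x i"
proof -
  have r: "rad x \<noteq> 0" using assms by (simp add: rad_def)
  have "(2 / (rad x)\<^sup>2) *\<^sub>R (fst x \<odot> T j \<odot> qcnj (fst x) \<odot> snd x) = 2 *\<^sub>R (fib1 x \<odot> T j \<odot> qcnj (fib2 x))" for j
    by (simp add: fib1_def fib2_def qmult_assoc power2_eq_square)
  then have "field_minus j x = frame_vec x (T j) (T j)" for j by (simp add: field_minus_def frame_vec_def)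
  moreover have "field_plus j x = frame_vec x (T j) 0" for j by (simp add: field_plus_def frame_vec_def zero_prod_def[symmetric])
  moreover have "(fib1 x, 0) = frame_vec x ((1 / rad x) *\<^sub>R qone) 0" by (simp add: fib1_def frame_vec_def)
  ultimately show ?thesis by (simp add: bggg_frame_def frame_scale_def dual_vec_def)
qed

lemma bggg_frame_tangent:
  assumes "x \<in> M" "fst x \<noteq> 0" shows "bggg_frame x i \<in> tangent x"
proof -
  have "c *\<^sub>R X \<in> tangent x" if "X \<in> tangent x" for c X using that by (simp add: tangent_def)
  then show ?thesis unfolding bggg_frame_dual[OF assms(2)] using dual_vec_tangent[OF assms(1)] by blast
qed

lemma coframe_bggg_frame:
  assumes x: "x \<in> M" "fst x \<noteq> 0" and "k < 7" "i < 7"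
  shows "\<bar>coframe x k (bggg_frame x i)\<bar> \<le> \<bar>frame_scale (rad x) k\<bar>"
  unfolding bggg_frame_dual[OF x(2)] coframe_scale[OF x dual_vec_tangent[OF x(1)] assms(3)] coframe_dual[OF x assms(3,4)]
  by simp

lemma norm_T: "norm (T i) = 1"
  by (simp add: T_def norm_Pair)

lemma abs_wedge_le:
  fixes a b c d :: real
  assumes "\<bar>a\<bar> \<le> p" "\<bar>b\<bar> \<le> q" "\<bar>c\<bar> \<le> p" "\<bar>d\<bar> \<le> q"
  shows "\<bar>a * b - c * d\<bar> \<le> 2 * p * q"
proof -
  have "\<bar>a * b\<bar> \<le> p * q" "\<bar>c * d\<bar> \<le> p * q" unfolding abs_mult using assms by (auto intro!: mult_mono)
  then show ?thesis by linarith
qed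

lemma abs_mult_le:
  fixes a b :: real
  assumes "\<bar>a\<bar> \<le> p" "\<bar>b\<bar> \<le> q" shows "\<bar>a * b\<bar> \<le> p * q"
  unfolding abs_mult using assms by (auto intro!: mult_mono)

lemma abs_sum3_le:
  fixes a b c :: real
  assumes "\<bar>a\<bar> \<le> p" "\<bar>b\<bar> \<le> q" "\<bar>c\<bar> \<le> r" "p + q + r \<le> s"
  shows "\<bar>a + b - c\<bar> \<le> s"
  using assms by linarith

text \<open>On the orthonormal frame \<open>dt\<close> and \<open>\<eta>_1^+\<close> are bounded
  while the other five forms are O(1/z), as \<open>A_1\<close> tends to a constant and the other
  coefficients grow linearly. The equations give \<open>dF\<close> = O(1/z^2) and \<open>dG\<close>
  = O(1/z); since \<open>G\<close> = O(1/z), every term of the curvature is O(1/z^2).\<close>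

lemma instanton_curvature_bound:
  assumes x: "x \<in> M" "fst x \<noteq> 0" and z: "1 \<le> z" "rad x = t_of z"
    and C: "\<And>X Y. X \<in> tangent x \<Longrightarrow> Y \<in> tangent x \<Longrightarrow> curvature A x X Y = curv_form F dF G dG x X Y"
    and K: "eq_f (rad x) F dF G = 0" "eq_g (rad x) F G dG = 0"
    and N: "1 \<le> N" "\<bar>F\<bar> \<le> N" "\<bar>G\<bar> \<le> N / z" and ij: "i < 7" "j < 7"
  shows "norm (curvature A x (bggg_frame x i) (bggg_frame x j)) \<le> 300 * N\<^sup>2 / z\<^sup>2"
proof -
  let ?t = "rad x"
  define y where "y = 1 / z"
  have y: "0 < y" "y \<le> 1" using z by (auto simp: y_def)
  note AB = bggg_AB[OF _ z(2)]
  have A1: "1/2 \<le> bggg_A 1 ?t" "bggg_A 1 ?t \<le> 1"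
  proof -
    have "(1/2)\<^sup>2 \<le> z * (z + 6) / ((z + 2) * (z + 4))"
      using z mult_mono[of 1 z 1 z] by (simp add: pos_le_divide_eq power2_eq_square algebra_simps)
    then have "1/2 \<le> sqrt (z * (z + 6) / ((z + 2) * (z + 4)))" by (rule real_le_rsqrt)
    then show "1/2 \<le> bggg_A 1 ?t" unfolding AB(1)[OF order_trans[OF zero_le_one z(1)]] .
    have "z * (z + 6) \<le> (z + 2) * (z + 4)" by (simp add: algebra_simps)
    then have "z * (z + 6) / ((z + 2) * (z + 4)) \<le> 1" using z by (intro divide_le_eq_1_pos[THEN iffD2]) auto
    then have "sqrt (z * (z + 6) / ((z + 2) * (z + 4))) \<le> 1" by simp
    then show "bggg_A 1 ?t \<le> 1" unfolding AB(1)[OF order_trans[OF zero_le_one z(1)]] .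
  qed
  have sq: "(bggg_A 2 ?t)\<^sup>2 = 3/16 * (z * (z + 4))" "(bggg_B 2 ?t)\<^sup>2 = 3/16 * ((z + 2) * (z + 6))"
    using AB(2)[of 2] AB(4)[of 2] z by simp_all
  have low: "z / 3 \<le> bggg_A 2 ?t" "bggg_A 2 ?t \<le> bggg_B 2 ?t" "z / 2 \<le> bggg_B 1 ?t"
  proof -
    have "(z / 3)\<^sup>2 \<le> 3/16 * (z * (z + 4))" using z by (simp add: power2_eq_square algebra_simps)
    then have "z / 3 \<le> sqrt (3/16 * (z * (z + 4)))" by (rule real_le_rsqrt)
    then show "z / 3 \<le> bggg_A 2 ?t" using AB(2)[of 2] z by simp
    show "bggg_A 2 ?t \<le> bggg_B 2 ?t" using AB(2)[of 2] AB(4)[of 2] z by (simp add: algebra_simps)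
    show "z / 2 \<le> bggg_B 1 ?t" using AB(3) z by simp
  qed
  have pos: "0 < bggg_A 1 ?t" "0 < bggg_A 2 ?t" "0 < bggg_B 1 ?t" "0 < bggg_B 2 ?t"
    using A1 low z by (auto intro: less_le_trans[of 0 "z / 3"] less_le_trans[of 0 "z / 2"])
  have inv: "1 / bggg_A 2 ?t \<le> 3 * y" "1 / bggg_B 2 ?t \<le> 3 * y" "1 / bggg_B 1 ?t \<le> 2 * y" "1 / bggg_A 1 ?t \<le> 2"
  proof -
    show 1: "1 / bggg_A 2 ?t \<le> 3 * y" using low(1) pos z by (simp add: y_def divide_simps)
    have "1 / bggg_B 2 ?t \<le> 1 / bggg_A 2 ?t" using low(2) pos by (intro divide_left_mono) auto
    with 1 show "1 / bggg_B 2 ?t \<le> 3 * y" by linarith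
    show "1 / bggg_B 1 ?t \<le> 2 * y" using low(3) pos z by (simp add: y_def divide_simps)
    show "1 / bggg_A 1 ?t \<le> 2" using A1 pos by (simp add: divide_simps)
  qed
  have 3: "bggg_A 3 ?t = bggg_A 2 ?t" "bggg_B 3 ?t = bggg_B 2 ?t" by (simp_all add: bggg_A_def bggg_B_def)
  have fs: "\<bar>frame_scale ?t 0\<bar> \<le> 1" "\<bar>frame_scale ?t 1\<bar> \<le> 1" "\<bar>frame_scale ?t 2\<bar> \<le> 2 * y" "\<bar>frame_scale ?t 3\<bar> \<le> 2 * y"
    "\<bar>frame_scale ?t 4\<bar> \<le> 2 * y" "\<bar>frame_scale ?t 5\<bar> \<le> 2 * y" "\<bar>frame_scale ?t 6\<bar> \<le> 2 * y"
    using inv pos y A1 by (simp_all add: frame_scale_def 3 abs_of_pos)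
  define Xi where "Xi = bggg_frame x i"
  define Xj where "Xj = bggg_frame x j"
  have co: "\<bar>coframe x k Xi\<bar> \<le> c" "\<bar>coframe x k Xj\<bar> \<le> c" if "\<bar>frame_scale ?t k\<bar> \<le> c" "k < 7" for k c
    unfolding Xi_def Xj_def using coframe_bggg_frame[OF x that(2) ij(1)] coframe_bggg_frame[OF x that(2) ij(2)] that by auto
  have cf: "coframe x 0 = d_rad x" "coframe x 1 = eta_plus 1 x" "coframe x 2 = eta_plus 2 x" "coframe x 3 = eta_plus 3 x" "coframe x 4 = eta_minus 1 x" "coframe x 5 = eta_minus 2 x" "coframe x 6 = eta_minus 3 x"
    by (simp_all add: coframe_def)
  have b0: "\<bar>d_rad x Xi\<bar> \<le> 1" "\<bar>d_rad x Xj\<bar> \<le> 1"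
    by (rule co[OF fs(1), unfolded cf]; simp)+
  have b1: "\<bar>eta_plus 1 x Xi\<bar> \<le> 1" "\<bar>eta_plus 1 x Xj\<bar> \<le> 1"
    by (rule co[OF fs(2), unfolded cf]; simp)+
  have b2: "\<bar>eta_plus 2 x Xi\<bar> \<le> 2 * y" "\<bar>eta_plus 2 x Xj\<bar> \<le> 2 * y"
    by (rule co[OF fs(3), unfolded cf]; simp)+
  have b3: "\<bar>eta_plus 3 x Xi\<bar> \<le> 2 * y" "\<bar>eta_plus 3 x Xj\<bar> \<le> 2 * y"
    by (rule co[OF fs(4), unfolded cf]; simp)+
  have b4: "\<bar>eta_minus 1 x Xi\<bar> \<le> 2 * y" "\<bar>eta_minus 1 x Xj\<bar> \<le> 2 * y"
    by (rule co[OF fs(5), unfolded cf]; simp)+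
  have b5: "\<bar>eta_minus 2 x Xi\<bar> \<le> 2 * y" "\<bar>eta_minus 2 x Xj\<bar> \<le> 2 * y"
    by (rule co[OF fs(6), unfolded cf]; simp)+
  have b6: "\<bar>eta_minus 3 x Xi\<bar> \<le> 2 * y" "\<bar>eta_minus 3 x Xj\<bar> \<le> 2 * y"
    by (rule co[OF fs(7), unfolded cf]; simp)+
  note b = b0(1) b1(1) b2(1) b3(1) b4(1) b5(1) b6(1)
    b0(2) b1(2) b2(2) b3(2) b4(2) b5(2) b6(2)
  have N0: "0 \<le> N" "N \<le> N\<^sup>2" using N by (simp_all add: power2_eq_square)
  have G: "\<bar>G\<bar> \<le> N * y" "\<bar>G\<bar> \<le> N"
  proof -
    show "\<bar>G\<bar> \<le> N * y" using N(3) by (simp add: y_def)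
    also have "\<dots> \<le> N * 1" using y N0 by (intro mult_left_mono) auto
    finally show "\<bar>G\<bar> \<le> N" by simp
  qed
  have G2: "\<bar>G\<^sup>2\<bar> \<le> N\<^sup>2" using abs_mult_le[OF G(2) G(2)] by (simp add: power2_eq_square)
  have FG2: "\<bar>F - G\<^sup>2\<bar> \<le> 2 * N\<^sup>2" "\<bar>F\<bar> \<le> N\<^sup>2" "\<bar>1 - F\<bar> \<le> 2 * N" using G2 N N0 by linarith+
  \<comment> \<open>Solved for \<open>dF\<close>, the equation has only the denominators
    \<open>A_2\<^sup>2\<close> and \<open>B_2\<^sup>2\<close>, both of order
    \<open>z\<^sup>2\<close>.\<close>
  have dF: "\<bar>dF\<bar> \<le> 27 * N\<^sup>2 * y\<^sup>2"
  proof -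
    have e: "dF = bggg_A 1 ?t * ((F - G\<^sup>2) * ((1 / bggg_A 2 ?t) * (1 / bggg_A 2 ?t))) + bggg_A 1 ?t * (- F * ((1 / bggg_B 2 ?t) * (1 / bggg_B 2 ?t))) - 0"
      using K(1) pos by (simp add: eq_f_def field_simps power2_eq_square)
    have 1: "\<bar>bggg_A 1 ?t * ((F - G\<^sup>2) * ((1 / bggg_A 2 ?t) * (1 / bggg_A 2 ?t)))\<bar> \<le> 1 * ((2 * N\<^sup>2) * ((3 * y) * (3 * y)))"
      by (intro abs_mult_le) (use A1 pos inv FG2 in auto)
    have 2: "\<bar>bggg_A 1 ?t * (- F * ((1 / bggg_B 2 ?t) * (1 / bggg_B 2 ?t)))\<bar> \<le> 1 * (N\<^sup>2 * ((3 * y) * (3 * y)))"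
      by (intro abs_mult_le) (use A1 pos inv FG2 in auto)
    show ?thesis unfolding e by (rule abs_sum3_le[OF 1 2, of 0 0]) (simp_all add: power2_eq_square)
  qed
  have dG: "\<bar>dG\<bar> \<le> 6 * N\<^sup>2 * y"
  proof -
    have e: "dG = (1 - F) * G * (1 / bggg_A 1 ?t) + (- G) * ((bggg_A 2 ?t / bggg_B 2 ?t) * (1 / bggg_B 1 ?t)) - 0"
      using K(2) pos by (simp add: eq_g_def field_simps)
    have 1: "\<bar>(1 - F) * G * (1 / bggg_A 1 ?t)\<bar> \<le> (2 * N) * (N * y) * 2"
      by (intro abs_mult_le G) (use A1 pos inv FG2 in auto)
    have 2: "\<bar>(- G) * ((bggg_A 2 ?t / bggg_B 2 ?t) * (1 / bggg_B 1 ?t))\<bar> \<le> (N * y) * (1 * 2)"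
      by (intro abs_mult_le) (use G pos inv low y in auto)
    have "N * y * (1 * 2) \<le> 2 * N\<^sup>2 * y" using N0 y by (simp add: mult_right_mono)
    then show ?thesis unfolding e by (intro abs_sum3_le[OF 1 2, of 0 0]) (simp_all add: power2_eq_square)
  qed
  have yy: "y\<^sup>2 * N \<le> y\<^sup>2 * N\<^sup>2" using N0 by (intro mult_left_mono) auto
  have FG: "\<bar>2 * F * G - 2 * G\<bar> \<le> 4 * N\<^sup>2 * y"
  proof -
    have "\<bar>(2 * (F - 1)) * G\<bar> \<le> (4 * N) * (N * y)" by (rule abs_mult_le[OF _ G(1)]) (unfold right_diff_distrib, use N(1,2) in linarith)
    then show ?thesis by (simp add: algebra_simps power2_eq_square)
  qed
  have FG': "\<bar>2 * G\<^sup>2 - 2 * F\<bar> \<le> 4 * N\<^sup>2" using G2 N N0 by linarith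
  have t1: "\<bar>dF * (d_rad x Xi * eta_plus 1 x Xj - d_rad x Xj * eta_plus 1 x Xi)
       + (2 * G\<^sup>2 - 2 * F) * (eta_plus 2 x Xi * eta_plus 3 x Xj - eta_plus 2 x Xj * eta_plus 3 x Xi)
       - 2 * F * (eta_minus 2 x Xi * eta_minus 3 x Xj - eta_minus 2 x Xj * eta_minus 3 x Xi)\<bar> \<le> 102 * (N\<^sup>2 * y\<^sup>2)"
  proof -
    have 1: "\<bar>dF * (d_rad x Xi * eta_plus 1 x Xj - d_rad x Xj * eta_plus 1 x Xi)\<bar> \<le> (27 * N\<^sup>2 * y\<^sup>2) * (2 * 1 * 1)"
      by (intro abs_mult_le abs_wedge_le b dF)
    have 2: "\<bar>(2 * G\<^sup>2 - 2 * F) * (eta_plus 2 x Xi * eta_plus 3 x Xj - eta_plus 2 x Xj * eta_plus 3 x Xi)\<bar> \<le> (4 * N\<^sup>2) * (2 * (2 * y) * (2 * y))"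
      by (intro abs_mult_le abs_wedge_le b FG')
    have 3: "\<bar>2 * F * (eta_minus 2 x Xi * eta_minus 3 x Xj - eta_minus 2 x Xj * eta_minus 3 x Xi)\<bar> \<le> (2 * N\<^sup>2) * (2 * (2 * y) * (2 * y))"
      by (intro abs_mult_le abs_wedge_le b) (use N N0 in auto)
    show ?thesis by (rule abs_sum3_le[OF 1 2 3]) (simp add: power2_eq_square)
  qed
  have t2: "\<bar>dG * (d_rad x Xi * e1 - d_rad x Xj * e1') + (2 * F * G - 2 * G) * e2 - 2 * G * e3\<bar> \<le> 56 * (N\<^sup>2 * y\<^sup>2)"
    if "\<bar>e1\<bar> \<le> 2 * y" "\<bar>e1'\<bar> \<le> 2 * y" "\<bar>e2\<bar> \<le> 4 * y" "\<bar>e3\<bar> \<le> 8 * y" for e1 e1' e2 e3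
  proof -
    have 1: "\<bar>dG * (d_rad x Xi * e1 - d_rad x Xj * e1')\<bar> \<le> (6 * N\<^sup>2 * y) * (2 * 1 * (2 * y))"
      by (intro abs_mult_le abs_wedge_le b dG that)
    have 2: "\<bar>(2 * F * G - 2 * G) * e2\<bar> \<le> (4 * N\<^sup>2 * y) * (4 * y)" by (intro abs_mult_le FG that)
    have 3: "\<bar>2 * G * e3\<bar> \<le> (2 * (N * y)) * (8 * y)" by (intro abs_mult_le that) (use G in auto)
    have "(2 * (N * y)) * (8 * y) \<le> 16 * (N\<^sup>2 * y\<^sup>2)" using yy by (simp add: power2_eq_square mult_ac)
    then show ?thesis by (intro abs_sum3_le[OF 1 2 3]) (simp add: power2_eq_square)
  qed
  have y8: "2 * (2 * y) * (2 * y) \<le> 8 * y" using y by (simp add: mult_left_le)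
  have m31: "\<bar>eta_minus 3 x Xi * eta_minus 1 x Xj - eta_minus 3 x Xj * eta_minus 1 x Xi\<bar> \<le> 8 * y"
    and m12: "\<bar>eta_minus 1 x Xi * eta_minus 2 x Xj - eta_minus 1 x Xj * eta_minus 2 x Xi\<bar> \<le> 8 * y"
    using abs_wedge_le[OF b(7) b(12) b(14) b(5)] abs_wedge_le[OF b(5) b(13) b(12) b(6)] y8 by linarith+
  have e31: "\<bar>eta_plus 3 x Xi * eta_plus 1 x Xj - eta_plus 3 x Xj * eta_plus 1 x Xi\<bar> \<le> 4 * y"
    and e12: "\<bar>eta_plus 1 x Xi * eta_plus 2 x Xj - eta_plus 1 x Xj * eta_plus 2 x Xi\<bar> \<le> 4 * y"
    using abs_wedge_le[OF b(4) b(9) b(11) b(2)] abs_wedge_le[OF b(2) b(10) b(9) b(3)] by linarith+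
  have nT: "norm (a *\<^sub>R T 1 + c *\<^sub>R T 2 + d *\<^sub>R T 3) \<le> \<bar>a\<bar> + \<bar>c\<bar> + \<bar>d\<bar>" for a c d
    using norm_triangle_ineq[of "a *\<^sub>R T 1 + c *\<^sub>R T 2" "d *\<^sub>R T 3"] norm_triangle_ineq[of "a *\<^sub>R T 1" "c *\<^sub>R T 2"] by (simp add: norm_T)
  have tg: "Xi \<in> tangent x" "Xj \<in> tangent x" unfolding Xi_def Xj_def using bggg_frame_tangent[OF x] by auto
  have "norm (curvature A x Xi Xj) \<le> 102 * (N\<^sup>2 * y\<^sup>2) + 56 * (N\<^sup>2 * y\<^sup>2) + 56 * (N\<^sup>2 * y\<^sup>2)"
    unfolding C[OF tg] curv_form_def
    by (rule order_trans[OF nT]) (intro add_mono t1 t2 b m31 m12 e31 e12)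
  also have "\<dots> \<le> 300 * (N\<^sup>2 * y\<^sup>2)" using N0 by simp
  finally show ?thesis by (simp add: Xi_def Xj_def y_def power_divide)
qed

text \<open>The decay of \<open>flow_w\<close> more than offsets the factor
  \<open>exp (3 * z / 4)\<close> in \<open>g_weight\<close>; the remaining quotient of
  \<open>g_weight\<close> is at most \<open>1 / z\<close>.\<close>

lemma sol_bounds:
  assumes fl: "flow p0 w0 b \<phi> L" and z: "1 \<le> z"
  shows "\<bar>A1_sq z * \<phi> z\<bar> \<le> p0 + 1 + \<bar>w0\<bar>" "\<bar>g_weight z * flow_w w0 L z\<bar> \<le> (p0 + 1 + \<bar>w0\<bar>) / z"
proof -
  have b: "b < z" using fl z by (auto simp: flow_def)
  have p: "2 \<le> \<phi> z" "\<phi> z \<le> p0 + 1" using fl b by (auto simp: flow_def)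
  have "0 < A1_sq z" using A1_sq_pos z by simp
  moreover have "A1_sq z \<le> 1"
  proof -
    have "z * (z + 6) \<le> (z + 2) * (z + 4)" by (simp add: algebra_simps)
    then show ?thesis unfolding A1_sq_def using z by (intro divide_le_eq_1_pos[THEN iffD2]) auto
  qed
  ultimately have "A1_sq z * \<phi> z \<le> 1 * (p0 + 1)" using p by (intro mult_mono) auto
  then show "\<bar>A1_sq z * \<phi> z\<bar> \<le> p0 + 1 + \<bar>w0\<bar>" using \<open>0 < A1_sq z\<close> p by (simp add: abs_mult)
  have k: "0 < g_weight z" using g_weight_pos z by simp
  have "g_weight z \<le> exp (3 * z / 4) * (1 / z)"
  proof -
    have "z * z \<le> (z + 6)\<^sup>2 * 1" using z by (simp add: power2_eq_square algebra_simps)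
    also have "\<dots> \<le> (z + 6)\<^sup>2 * sqrt (z + 3)" using z by (intro mult_left_mono) auto
    finally have "z / ((z + 6)\<^sup>2 * sqrt (z + 3)) \<le> 1 / z" using z by (simp add: divide_simps)
    then have "exp (3 * z / 4) * (z / ((z + 6)\<^sup>2 * sqrt (z + 3))) \<le> exp (3 * z / 4) * (1 / z)" by (intro mult_left_mono) auto
    then show ?thesis by (simp add: g_weight_def)
  qed
  moreover have "\<bar>flow_w w0 L z\<bar> \<le> \<bar>w0\<bar> * exp (- (3 * z / 4))"
  proof -
    have "exp (- (3/4 * L z)) \<le> exp (- (3 * z / 4))" using flow_L_ge[OF fl, of z] z by simp
    then have "\<bar>w0\<bar> * exp (- (3/4 * L z)) \<le> \<bar>w0\<bar> * exp (- (3 * z / 4))" by (intro mult_left_mono) auto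
    then show ?thesis by (simp add: flow_w_def abs_mult)
  qed
  ultimately have "\<bar>g_weight z * flow_w w0 L z\<bar> \<le> (exp (3 * z / 4) * (1 / z)) * (\<bar>w0\<bar> * exp (- (3 * z / 4)))"
    using k by (intro abs_mult_le) auto
  also have "\<dots> = \<bar>w0\<bar> / z" by (simp add: exp_minus field_simps)
  also have "\<dots> \<le> (p0 + 1 + \<bar>w0\<bar>) / z" using p z by (intro divide_right_mono) auto
  finally show "\<bar>g_weight z * flow_w w0 L z\<bar> \<le> (p0 + 1 + \<bar>w0\<bar>) / z" .
qed

theorem instanton_decay:
  assumes I: "instanton_at (f1, g1) A" and fl: "flow (2 * f1) (w_scale * g1) b \<phi> L"
  shows "quadratic_curvature_decay A"
proof -
  let ?w0 = "w_scale * g1" and ?p0 = "2 * f1"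
  let ?B = "flow_conn ?w0 b \<phi> L"
  let ?P = "sol_P b \<phi>" and ?Q = "sol_Q ?w0 b L"
  have b: "-1 < b" "b < 0" using fl by (auto simp: flow_def)
  have AC: "connection_P1 A" using I by (auto simp: instanton_at_def invariant_instanton_def)
  note BC = connection_flow_conn[OF fl]
  define N where "N = ?p0 + 1 + \<bar>?w0\<bar>"
  have "2 \<le> \<phi> 0" "\<phi> 0 = ?p0" using fl b by (auto simp: flow_def)
  then have N1: "1 \<le> N" by (simp add: N_def)
  \<comment> \<open>With this value \<open>t_of z \<le> c * z\<close> for \<open>z \<ge> 1\<close>,
    which converts \<open>1 / z\<^sup>2\<close> into \<open>1 / t\<^sup>2\<close>.\<close>
  define c where "c = t_of 1 + 3/2"
  have c: "0 < c" using t_of_nonneg[of 1] by (simp add: c_def)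
  have "curvature_norm A x \<le> (7 * (300 * N\<^sup>2 * c\<^sup>2)) / (rad x)\<^sup>2" if x: "x \<in> M" "t_of 1 \<le> rad x" for x
  proof -
    have rp: "0 < rad x" using x(2) t_of_pos[of 1] by simp
    then have xf: "fst x \<noteq> 0" by (auto simp: rad_def)
    obtain z where z: "0 < z" "rad x = t_of z" using rad_pos_t_of[OF xf] .
    have z1: "1 \<le> z"
    proof (rule ccontr)
      assume "\<not> 1 \<le> z"
      then show False using t_of_strict_mono[of z 1] z x(2) by simp
    qed
    have s: "(rad x)\<^sup>2 = t_sq z" using z t_of_sq[of z] by simp
    have bz: "b < z" using b z by simp
    have FG: "(rad x)\<^sup>2 * ?P ((rad x)\<^sup>2) = A1_sq z * \<phi> z" "(rad x)\<^sup>2 * ?Q ((rad x)\<^sup>2) = g_weight z * flow_w ?w0 L z"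
      unfolding s sol_t_sq[OF b(1) bz] by (simp_all add: flow_w_def)
    have cA: "curvature A x X Y = curvature (model ?P ?Q) x X Y" if "X \<in> tangent x" "Y \<in> tangent x" for X Y
      unfolding flow_conn_def[symmetric]
    proof (rule curvature_cong[OF x(1) that, where N = UNIV])
      show "A y Z = ?B y Z" if "y \<in> UNIV \<inter> M" "Z \<in> tangent y" for y Z using instanton_at_unique[OF I fl] that by auto
    qed (use connection_P1_differentiable[OF AC x(1)] connection_P1_differentiable[OF BC x(1)] AC BC in \<open>auto simp: connection_P1_def\<close>)
    have bd: "norm (curvature A x (bggg_frame x i) (bggg_frame x j)) \<le> 300 * N\<^sup>2 / z\<^sup>2" if "i < 7" "j < 7" for i j
      by (rule instanton_curvature_bound[OF x(1) xf z1 z(2) trans[OF cA curvature_model[OF x(1) xf refl refl DERIV_sol[OF fl zero_le_power2] refl refl refl refl]]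
          K_flow[OF fl z]])
        (use that N1 sol_bounds[OF fl z1] in \<open>simp_all add: FG N_def z(2)[symmetric]\<close>)
    let ?k = "300 * N\<^sup>2 / z\<^sup>2"
    \<comment> \<open>The sum over pairs is enlarged to 49 equal terms because this is a perfect
      square: the root is 7 times the bound.\<close>
    have "(\<Sum>j<7. \<Sum>i<j. (norm (curvature A x (bggg_frame x i) (bggg_frame x j)))\<^sup>2) \<le> (\<Sum>j<(7::nat). \<Sum>i<(7::nat). ?k\<^sup>2)"
    proof (rule sum_mono)
      fix j :: nat assume j: "j \<in> {..<7}"
      have "(\<Sum>i<j. (norm (curvature A x (bggg_frame x i) (bggg_frame x j)))\<^sup>2) \<le> (\<Sum>i<j. ?k\<^sup>2)"
        using j by (intro sum_mono power_mono bd) auto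
      also have "\<dots> \<le> (\<Sum>i<(7::nat). ?k\<^sup>2)" using j by (intro sum_mono2) auto
      finally show "(\<Sum>i<j. (norm (curvature A x (bggg_frame x i) (bggg_frame x j)))\<^sup>2) \<le> (\<Sum>i<(7::nat). ?k\<^sup>2)" .
    qed
    also have "\<dots> = (7 * ?k)\<^sup>2" by (simp add: power2_eq_square)
    finally have "curvature_norm A x \<le> sqrt ((7 * ?k)\<^sup>2)" unfolding curvature_norm_def by (rule real_sqrt_le_mono)
    also have "\<dots> = 7 * ?k" by (subst real_sqrt_abs) simp
    also have "\<dots> \<le> (7 * (300 * N\<^sup>2 * c\<^sup>2)) / (rad x)\<^sup>2"
    proof -
      have "rad x \<le> c * z" using t_of_le[OF z1] z1 t_of_nonneg[of 1] mult_left_mono[of 1 z "t_of 1"] by (simp add: z(2) c_def algebra_simps)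
      then have "(rad x)\<^sup>2 \<le> (c * z)\<^sup>2" using rp by (intro power_mono) auto
      then have "(rad x)\<^sup>2 * N\<^sup>2 \<le> (c * z)\<^sup>2 * N\<^sup>2" by (intro mult_right_mono) auto
      then show ?thesis using rp z(1) by (simp add: divide_simps power_mult_distrib mult_ac)
    qed
    finally show ?thesis .
  qed
  then show ?thesis unfolding quadratic_curvature_decay_def by blast
qed

section \<open>Holonomy\<close>

text \<open>\<open>exp (\<theta> T_i)\<close> in closed form, available because \<open>T i\<close>
  squares to \<open>- qone\<close>.\<close>

definition qexp :: "nat \<Rightarrow> real \<Rightarrow> quat" where
  "qexp i \<theta> = cos \<theta> *\<^sub>R qone + sin \<theta> *\<^sub>R T i"

lemma expT1_qexp: "expT1 \<theta> = qexp 1 \<theta>"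
  by (simp add: expT1_def qexp_def T_def qone_def prod_eq_iff complex_eq_iff)

lemma qexp_0 [simp]: "qexp i 0 = qone"
  by (simp add: qexp_def)

lemma T_square: "T i \<odot> T i = - qone"
  by (simp add: T_def qmult_def qone_def prod_eq_iff complex_eq_iff)

lemma qexp_SU2: "qexp i \<theta> \<in> SU2"
proof -
  have "(norm (qexp i \<theta>))\<^sup>2 = 1"
    unfolding norm_quat_sq by (simp add: qexp_def qone_def T_def)
  then show ?thesis by (simp add: SU2_def power2_eq_1_iff) (smt (verit) norm_ge_zero)
qed

lemma qexp_deriv:
  "((\<lambda>s. qexp i (a * s)) has_vector_derivative a *\<^sub>R (qexp i (a * s) \<odot> T i)) (at s within S)"
proof -
  have "((\<lambda>s. cos (a * s) *\<^sub>R qone + sin (a * s) *\<^sub>R T i) has_vector_derivative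
     (- sin (a * s) * a) *\<^sub>R qone + (cos (a * s) * a) *\<^sub>R T i) (at s within S)"
    by (rule derivative_eq_intros refl | simp)+
  moreover have "(- sin (a * s) * a) *\<^sub>R qone + (cos (a * s) * a) *\<^sub>R T i = a *\<^sub>R (qexp i (a * s) \<odot> T i)"
    by (simp add: qexp_def qmult_add T_square scaleR_add_right scaleR_diff_right mult.commute)
  ultimately show ?thesis by (simp add: qexp_def[abs_def])
qed

lemma continuous_on_qexp: "continuous_on S (\<lambda>s. qexp i (a * s))"
  unfolding qexp_def by (intro continuous_intros)

lemma has_vector_derivative_qmult:
  assumes "(f has_vector_derivative f') (at x within S)" "(g has_vector_derivative g') (at x within S)"
  shows "((\<lambda>x. f x \<odot> g x) has_vector_derivative (f x \<odot> g' + f' \<odot> g x)) (at x within S)"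
  by (rule bounded_bilinear.has_vector_derivative[OF bounded_bilinear_qmult assms])

text \<open>On a radial vector \<open>cform\<close> is a real multiple of \<open>qone\<close>:
  connections of this form are in radial gauge.\<close>

lemma model_radial:
  "model P Q (c *\<^sub>R p, q) (d *\<^sub>R p, 0) = 0"
proof -
  have "cform (c *\<^sub>R p, q) (d *\<^sub>R p, 0) = (c * d * (norm p)\<^sup>2) *\<^sub>R qone"
    by (simp add: cform_def qcnj_mult_self)
  moreover have "inner qone (T 1) = 0" "inner qone (T 2) = 0" "inner qone (T 3) = 0"
    by (simp_all add: T_def qone_def inner_prod_def inner_complex_def)
  ultimately show ?thesis by (simp add: model_def)
qed

definition model_coeff :: "(real \<Rightarrow> real) \<Rightarrow> (real \<Rightarrow> real) \<Rightarrow> nat \<Rightarrow> real \<Rightarrow> real" where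
  "model_coeff P Q i s = s * (if i = 1 then P s else Q s)"

lemma model_arc:
  assumes "i \<in> {1..3}"
  shows "model P Q (p, q) (a *\<^sub>R (p \<odot> T i), 0) = (a * model_coeff P Q i ((norm p)\<^sup>2)) *\<^sub>R T i"
proof -
  have c: "cform (p, q) (a *\<^sub>R (p \<odot> T i), 0) = (a * (norm p)\<^sup>2) *\<^sub>R T i"
    by (simp add: cform_def qcnj_cancel)
  have "i \<in> {1, 2, 3}" using assms by auto
  moreover have "inner (T 1) (T 1) = 1" "inner (T 1) (T 2) = 0" "inner (T 1) (T 3) = 0"
    "inner (T 2) (T 1) = 0" "inner (T 2) (T 2) = 1" "inner (T 2) (T 3) = 0"
    "inner (T 3) (T 1) = 0" "inner (T 3) (T 2) = 0" "inner (T 3) (T 3) = 1"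
    by (rule trans[OF inner_T]; simp)+
  ultimately show ?thesis unfolding model_def c
    by (elim insertE emptyE) (simp_all add: model_coeff_def)
qed

definition exp_arc :: "quat \<Rightarrow> quat \<Rightarrow> nat \<Rightarrow> real \<Rightarrow> real \<Rightarrow> point" where
  "exp_arc p q i a s = (p \<odot> qexp i (a * s), q)"

lemma exp_arc_deriv: "(exp_arc p q i a has_vector_derivative (a *\<^sub>R (p \<odot> qexp i (a * s) \<odot> T i), 0)) (at s within S)"
proof -
  have "((\<lambda>s. p \<odot> qexp i (a * s)) has_vector_derivative (p \<odot> (a *\<^sub>R (qexp i (a * s) \<odot> T i)) + 0 \<odot> qexp i (a * s))) (at s within S)"
    by (rule has_vector_derivative_qmult[OF has_vector_derivative_const qexp_deriv])
  then have "((\<lambda>s. (p \<odot> qexp i (a * s), q)) has_vector_derivative (p \<odot> (a *\<^sub>R (qexp i (a * s) \<odot> T i)) + 0 \<odot> qexp i (a * s), 0)) (at s within S)"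
    by (rule has_vector_derivative_Pair) (rule has_vector_derivative_const)
  then show ?thesis by (simp add: exp_arc_def[abs_def] qmult_assoc)
qed

lemma norm_qmult_SU2: "c \<in> SU2 \<Longrightarrow> norm (p \<odot> c) = norm p"
  using inner_qmult_right[of p c p] norm_SU2[of c] by (simp add: norm_eq_sqrt_inner)

text \<open>Along the arc the connection takes a constant value, a multiple of \<open>T i\<close>,
  so the transport is a one-parameter subgroup.\<close>

lemma transport_arc:
  assumes eq: "\<And>x X. x \<in> M \<Longrightarrow> X \<in> tangent x \<Longrightarrow> A x X = model P Q x X" and q: "q \<in> SU2" and i: "i \<in> {1..3}"
  shows "transport A (exp_arc p q i a) (\<lambda>s. qexp i (a * model_coeff P Q i ((norm p)\<^sup>2) * s))"
proof -
  let ?h = "a * model_coeff P Q i ((norm p)\<^sup>2)"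
  have val: "A (exp_arc p q i a s) (vector_derivative (exp_arc p q i a) (at s)) = ?h *\<^sub>R T i" for s
  proof -
    have "A (exp_arc p q i a s) (a *\<^sub>R (p \<odot> qexp i (a * s) \<odot> T i), 0) = model P Q (exp_arc p q i a s) (a *\<^sub>R (p \<odot> qexp i (a * s) \<odot> T i), 0)"
      by (rule eq) (use q in \<open>auto simp: exp_arc_def M_def tangent_def\<close>)
    also have "\<dots> = ?h *\<^sub>R T i" unfolding exp_arc_def model_arc[OF i] norm_qmult_SU2[OF qexp_SU2] ..
    finally show ?thesis unfolding vector_derivative_at[OF exp_arc_deriv] .
  qed
  show ?thesis unfolding transport_def
  proof (intro conjI exI[of _ "{}"] ballI)
    show "exp_arc p q i a differentiable at s" for s
      using exp_arc_deriv[of p q i a s UNIV] by (simp add: differentiableI_vector)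
    show "((\<lambda>s. qexp i (?h * s)) has_vector_derivative qexp i (?h * s) \<odot> A (exp_arc p q i a s) (vector_derivative (exp_arc p q i a) (at s))) (at s within {0..1})" for s
      unfolding val using qexp_deriv[of i ?h s "{0..1}"] by simp
  qed (auto intro: continuous_on_qexp)
qed

text \<open>The product of \<open>u s\<close> with \<open>exp (- h s T_1)\<close> is constant,
  \<open>h\<close> being the constant coefficient of the connection. Uniqueness is called for
  because \<open>holonomy\<close> is a definite description.\<close>

lemma transport_circle_unique:
  assumes eq: "\<And>x X. x \<in> M \<Longrightarrow> X \<in> tangent x \<Longrightarrow> A x X = model P Q x X" and q: "q \<in> SU2"
    and u: "transport A (exp_arc p q 1 a) u"
  shows "u 1 = qexp 1 (a * model_coeff P Q 1 ((norm p)\<^sup>2))"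
proof -
  let ?h = "a * model_coeff P Q 1 ((norm p)\<^sup>2)"
  have val: "A (exp_arc p q 1 a s) (vector_derivative (exp_arc p q 1 a) (at s)) = ?h *\<^sub>R T 1" for s
  proof -
    have "A (exp_arc p q 1 a s) (a *\<^sub>R (p \<odot> qexp 1 (a * s) \<odot> T 1), 0) = model P Q (exp_arc p q 1 a s) (a *\<^sub>R (p \<odot> qexp 1 (a * s) \<odot> T 1), 0)"
      by (rule eq) (use q in \<open>auto simp: exp_arc_def M_def tangent_def\<close>)
    also have "\<dots> = ?h *\<^sub>R T 1" unfolding exp_arc_def by (subst model_arc) (simp_all add: norm_qmult_SU2[OF qexp_SU2])
    finally show ?thesis unfolding vector_derivative_at[OF exp_arc_deriv] .
  qed
  obtain S where S: "finite S" and uc: "continuous_on {0..1} u" and u0: "u 0 = qone"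
    and ud: "\<And>s. s \<in> {0..1} - S \<Longrightarrow> (u has_vector_derivative (u s \<odot> (?h *\<^sub>R T 1))) (at s within {0..1})"
    using u unfolding transport_def val by blast
  define w where "w s = u s \<odot> qexp 1 ((- ?h) * s)" for s
  have comm: "T i \<odot> qexp i \<theta> = qexp i \<theta> \<odot> T i" for i \<theta> by (simp add: qexp_def qmult_add)
  have "w 1 = qone"
  proof (rule has_derivative_zero_unique_strong_interval[OF S])
    show "continuous_on {0..1} w" unfolding w_def[abs_def]
      by (intro bounded_bilinear.continuous_on[OF bounded_bilinear_qmult] uc continuous_on_qexp)
    show "w 0 = qone" by (simp add: w_def u0)
    fix s assume s: "s \<in> {0..1} - S"
    have "(w has_vector_derivative u s \<odot> ((- ?h) *\<^sub>R (qexp 1 ((- ?h) * s) \<odot> T 1)) + (u s \<odot> (?h *\<^sub>R T 1)) \<odot> qexp 1 ((- ?h) * s)) (at s within {0..1})"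
      unfolding w_def[abs_def] by (rule has_vector_derivative_qmult[OF ud[OF s] qexp_deriv])
    also have "u s \<odot> ((- ?h) *\<^sub>R (qexp 1 ((- ?h) * s) \<odot> T 1)) + (u s \<odot> (?h *\<^sub>R T 1)) \<odot> qexp 1 ((- ?h) * s) = 0"
      by (simp add: qmult_assoc comm)
    finally show "(w has_derivative (\<lambda>h. 0)) (at s within {0..1})" by (simp add: has_vector_derivative_def)
  qed auto
  then have "u 1 \<odot> qexp 1 (- ?h) = qone" by (simp add: w_def)
  moreover have "qcnj (qexp 1 ?h) = qexp 1 (- ?h)" by (simp add: qexp_def)
  ultimately have "(u 1 \<odot> qcnj (qexp 1 ?h)) \<odot> qexp 1 ?h = qexp 1 ?h" by simp
  then show ?thesis by (simp add: qmult_assoc SU2_inverse qexp_SU2)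
qed

lemma circle_at_arc: "circle_at t = exp_arc (t *\<^sub>R qone) qone 1 (2 * pi)"
  by (rule ext) (simp add: circle_at_def orbit_chart_def exp_arc_def expT1_qexp SU2_inverse qexp_SU2)

lemma norm_qone: "norm qone = 1"
  by (simp add: qone_def norm_Pair)

lemma holonomy_circle:
  assumes eq: "\<And>x X. x \<in> M \<Longrightarrow> X \<in> tangent x \<Longrightarrow> A x X = model P Q x X"
  shows "holonomy A (circle_at t) = expT1 (2 * pi * (t\<^sup>2 * P (t\<^sup>2)))"
proof -
  have q: "qone \<in> SU2" by (simp add: SU2_def norm_qone)
  have n: "(norm (t *\<^sub>R qone))\<^sup>2 = t\<^sup>2" by (simp add: norm_qone)
  show ?thesis unfolding holonomy_def circle_at_arc
  proof (rule the_equality)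
    show "\<exists>u. transport A (exp_arc (t *\<^sub>R qone) qone 1 (2 * pi)) u \<and> expT1 (2 * pi * (t\<^sup>2 * P (t\<^sup>2))) = u 1"
    proof -
      have "transport A (exp_arc (t *\<^sub>R qone) qone 1 (2 * pi)) (\<lambda>s. qexp 1 (2 * pi * model_coeff P Q 1 ((norm (t *\<^sub>R qone))\<^sup>2) * s))"
        by (rule transport_arc[OF eq q]) auto
      then show ?thesis unfolding n by (intro exI conjI) (assumption, simp add: model_coeff_def expT1_qexp)
    qed
    show "h = expT1 (2 * pi * (t\<^sup>2 * P (t\<^sup>2)))" if "\<exists>u. transport A (exp_arc (t *\<^sub>R qone) qone 1 (2 * pi)) u \<and> h = u 1" for h
    proof -
      from that obtain u where u: "transport A (exp_arc (t *\<^sub>R qone) qone 1 (2 * pi)) u" "h = u 1" by blast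
      have "u 1 = qexp 1 (2 * pi * model_coeff P Q 1 ((norm (t *\<^sub>R qone))\<^sup>2))"
        by (rule transport_circle_unique[OF eq q u(1)])
      then show ?thesis unfolding n u(2) by (simp add: model_coeff_def expT1_qexp)
    qed
  qed
qed

section \<open>Composition of parallel transports and irreducibility\<close>

definition path_trans :: "conn \<Rightarrow> point \<Rightarrow> point \<Rightarrow> quat \<Rightarrow> bool" where
  "path_trans A x y h \<longleftrightarrow> (\<exists>\<gamma> u. valid_path \<gamma> \<and> path_image \<gamma> \<subseteq> M \<and> pathstart \<gamma> = x \<and> pathfinish \<gamma> = y \<and> transport A \<gamma> u \<and> h = u 1)"

text \<open>The transport equation is invariant under left multiplication, so on the second half the
  solution is the end value of \<open>u1\<close> times \<open>u2\<close>. The factor 2 of the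
  reparametrisation passes through \<open>A\<close> by linearity.\<close>

lemma transport_join:
  assumes lin: "\<And>x. x \<in> M \<Longrightarrow> linear (A x)" and im: "path_image \<gamma>1 \<subseteq> M" "path_image \<gamma>2 \<subseteq> M"
    and t: "transport A \<gamma>1 u1" "transport A \<gamma>2 u2"
  shows "transport A (\<gamma>1 +++ \<gamma>2) (u1 +++ (\<lambda>s. u1 1 \<odot> u2 s))"
proof -
  obtain S1 where S1: "finite S1" "\<And>s. s \<in> {0..1} - S1 \<Longrightarrow> \<gamma>1 differentiable at s"
    "\<And>s. s \<in> {0..1} - S1 \<Longrightarrow> (u1 has_vector_derivative (u1 s \<odot> A (\<gamma>1 s) (vector_derivative \<gamma>1 (at s)))) (at s within {0..1})"
    and u1: "u1 0 = qone" "continuous_on {0..1} u1"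
    using t(1) unfolding transport_def by blast
  obtain S2 where S2: "finite S2" "\<And>s. s \<in> {0..1} - S2 \<Longrightarrow> \<gamma>2 differentiable at s"
    "\<And>s. s \<in> {0..1} - S2 \<Longrightarrow> (u2 has_vector_derivative (u2 s \<odot> A (\<gamma>2 s) (vector_derivative \<gamma>2 (at s)))) (at s within {0..1})"
    and u2: "u2 0 = qone" "continuous_on {0..1} u2"
    using t(2) unfolding transport_def by blast
  \<comment> \<open>Besides the rescaled exceptional points the joint and the end points are
    removed, so that the two-sided derivatives of both pieces are available.\<close>
  define S where "S = {0, 1/2, 1} \<union> (\<lambda>s. s / 2) ` S1 \<union> (\<lambda>s. (s + 1) / 2) ` S2"
  let ?g = "\<gamma>1 +++ \<gamma>2" and ?u = "u1 +++ (\<lambda>s. u1 1 \<odot> u2 s)"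
  have "path ?u"
  proof (rule path_join_imp)
    show "path (\<lambda>s. u1 1 \<odot> u2 s)" unfolding path_def
      by (intro bounded_bilinear.continuous_on[OF bounded_bilinear_qmult] u2 continuous_on_const)
  qed (use u1 u2 in \<open>auto simp: path_def pathfinish_def pathstart_def\<close>)
  then have c: "continuous_on {0..1} ?u" by (simp add: path_def)
  have D: "?g differentiable at s \<and> (?u has_vector_derivative (?u s \<odot> A (?g s) (vector_derivative ?g (at s)))) (at s within {0..1})"
    if s: "s \<in> {0..1} - S" for s
  proof (cases "s < 1/2")
    case True
    let ?r = "2 * s"
    have "?r \<notin> S1"
    proof
      assume "?r \<in> S1" then have "?r / 2 \<in> (\<lambda>s. s / 2) ` S1" by blast
      then show False using s by (simp add: S_def)
    qed
    then have r: "?r \<in> {0..1} - S1" "0 < ?r" "?r < 1" using s True by (auto simp: S_def)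
    have m: "((\<lambda>s. 2 * s :: real) has_vector_derivative 2) (at s)" by (auto intro!: derivative_eq_intros)
    have "(\<gamma>1 has_vector_derivative vector_derivative \<gamma>1 (at ?r)) (at ?r)" using S1(2)[OF r(1)] by (simp add: vector_derivative_works)
    from vector_diff_chain_at[OF m this] have "((\<gamma>1 \<circ> (\<lambda>s. 2 * s)) has_vector_derivative 2 *\<^sub>R vector_derivative \<gamma>1 (at ?r)) (at s)" .
    then have g: "(?g has_vector_derivative 2 *\<^sub>R vector_derivative \<gamma>1 (at ?r)) (at s)"
      by (rule has_vector_derivative_transform_within_open[of _ _ _ "{..<1/2}"]) (use True in \<open>auto simp: joinpaths_def\<close>)
    have l: "linear (A (\<gamma>1 ?r))" using im(1) r by (intro lin) (auto simp: path_image_def)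
    have "(u1 has_vector_derivative (u1 ?r \<odot> A (\<gamma>1 ?r) (vector_derivative \<gamma>1 (at ?r)))) (at ?r)"
      using S1(3)[OF r(1)] at_within_Icc_at[OF r(2,3)] by simp
    from vector_diff_chain_at[OF m this] have "((u1 \<circ> (\<lambda>s. 2 * s)) has_vector_derivative 2 *\<^sub>R (u1 ?r \<odot> A (\<gamma>1 ?r) (vector_derivative \<gamma>1 (at ?r)))) (at s)" .
    then have "(?u has_vector_derivative 2 *\<^sub>R (u1 ?r \<odot> A (\<gamma>1 ?r) (vector_derivative \<gamma>1 (at ?r)))) (at s)"
      by (rule has_vector_derivative_transform_within_open[of _ _ _ "{..<1/2}"]) (use True in \<open>auto simp: joinpaths_def\<close>)
    moreover have "2 *\<^sub>R (u1 ?r \<odot> A (\<gamma>1 ?r) (vector_derivative \<gamma>1 (at ?r))) = ?u s \<odot> A (?g s) (vector_derivative ?g (at s))"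
      unfolding vector_derivative_at[OF g] using True linear_cmul[OF l] by (simp add: joinpaths_def)
    ultimately show ?thesis using g by (auto intro: differentiableI_vector has_vector_derivative_at_within)
  next
    case False
    let ?r = "2 * s - 1"
    have "?r \<notin> S2"
    proof
      assume "?r \<in> S2" then have "(?r + 1) / 2 \<in> (\<lambda>s. (s + 1) / 2) ` S2" by blast
      then show False using s by (simp add: S_def)
    qed
    then have r: "?r \<in> {0..1} - S2" "0 < ?r" "?r < 1" "1/2 < s" using s False by (auto simp: S_def)
    have m: "((\<lambda>s. 2 * s - 1 :: real) has_vector_derivative 2) (at s)" by (auto intro!: derivative_eq_intros)
    have "(\<gamma>2 has_vector_derivative vector_derivative \<gamma>2 (at ?r)) (at ?r)" using S2(2)[OF r(1)] by (simp add: vector_derivative_works)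
    from vector_diff_chain_at[OF m this] have "((\<gamma>2 \<circ> (\<lambda>s. 2 * s - 1)) has_vector_derivative 2 *\<^sub>R vector_derivative \<gamma>2 (at ?r)) (at s)" .
    then have g: "(?g has_vector_derivative 2 *\<^sub>R vector_derivative \<gamma>2 (at ?r)) (at s)"
      by (rule has_vector_derivative_transform_within_open[of _ _ _ "{1/2<..}"]) (use r in \<open>auto simp: joinpaths_def\<close>)
    have l: "linear (A (\<gamma>2 ?r))" using im(2) r by (intro lin) (auto simp: path_image_def)
    have "(u2 has_vector_derivative (u2 ?r \<odot> A (\<gamma>2 ?r) (vector_derivative \<gamma>2 (at ?r)))) (at ?r)"
      using S2(3)[OF r(1)] at_within_Icc_at[OF r(2,3)] by simp
    from vector_diff_chain_at[OF m this] have "((u2 \<circ> (\<lambda>s. 2 * s - 1)) has_vector_derivative 2 *\<^sub>R (u2 ?r \<odot> A (\<gamma>2 ?r) (vector_derivative \<gamma>2 (at ?r)))) (at s)" .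
    from has_vector_derivative_qmult[OF has_vector_derivative_const[of "u1 1"] this]
    have "((\<lambda>s. u1 1 \<odot> u2 (2 * s - 1)) has_vector_derivative 2 *\<^sub>R (u1 1 \<odot> (u2 ?r \<odot> A (\<gamma>2 ?r) (vector_derivative \<gamma>2 (at ?r))))) (at s)"
      by (simp add: o_def)
    then have "(?u has_vector_derivative 2 *\<^sub>R (u1 1 \<odot> (u2 ?r \<odot> A (\<gamma>2 ?r) (vector_derivative \<gamma>2 (at ?r))))) (at s)"
      by (rule has_vector_derivative_transform_within_open[of _ _ _ "{1/2<..}"]) (use r in \<open>auto simp: joinpaths_def\<close>)
    moreover have "2 *\<^sub>R (u1 1 \<odot> (u2 ?r \<odot> A (\<gamma>2 ?r) (vector_derivative \<gamma>2 (at ?r)))) = ?u s \<odot> A (?g s) (vector_derivative ?g (at s))"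
      unfolding vector_derivative_at[OF g] using r linear_cmul[OF l] by (simp add: joinpaths_def qmult_assoc)
    ultimately show ?thesis using g by (auto intro: differentiableI_vector has_vector_derivative_at_within)
  qed
  have "finite S" using S1(1) S2(1) by (simp add: S_def)
  moreover have "?u 0 = qone" using u1 by (simp add: joinpaths_def)
  moreover have "\<forall>s\<in>{0..1} - S. ?g differentiable at s \<and>
     (?u has_vector_derivative (?u s \<odot> A (?g s) (vector_derivative ?g (at s)))) (at s within {0..1})"
    by (rule ballI) (rule D)
  ultimately show ?thesis unfolding transport_def using c by (intro conjI exI[of _ S])
qed

lemma path_trans_join:
  assumes lin: "\<And>x. x \<in> M \<Longrightarrow> linear (A x)" and "path_trans A x y h" "path_trans A y z k"
  shows "path_trans A x z (h \<odot> k)"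
proof -
  obtain \<gamma>1 u1 where 1: "valid_path \<gamma>1" "path_image \<gamma>1 \<subseteq> M" "pathstart \<gamma>1 = x" "pathfinish \<gamma>1 = y" "transport A \<gamma>1 u1" "h = u1 1"
    using assms(2) unfolding path_trans_def by blast
  obtain \<gamma>2 u2 where 2: "valid_path \<gamma>2" "path_image \<gamma>2 \<subseteq> M" "pathstart \<gamma>2 = y" "pathfinish \<gamma>2 = z" "transport A \<gamma>2 u2" "k = u2 1"
    using assms(3) unfolding path_trans_def by blast
  let ?g = "\<gamma>1 +++ \<gamma>2" and ?u = "u1 +++ (\<lambda>s. u1 1 \<odot> u2 s)"
  have pf: "pathfinish \<gamma>1 = pathstart \<gamma>2" using 1(4) 2(3) by simp
  have "valid_path ?g" by (rule valid_path_join[OF 1(1) 2(1) pf])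
  moreover have "path_image ?g \<subseteq> M" unfolding path_image_join[OF pf] using 1(2) 2(2) by (rule Un_least)
  moreover have "pathstart ?g = x" "pathfinish ?g = z" using 1(3) 2(4) by simp_all
  moreover have "transport A ?g ?u" by (rule transport_join[OF lin 1(2) 2(2) 1(5) 2(5)])
  moreover have "h \<odot> k = ?u 1" using 1(6) 2(6) by (simp add: joinpaths_def)
  ultimately show ?thesis unfolding path_trans_def by (intro exI conjI)
qed

lemma path_trans_radial:
  assumes q: "q \<in> SU2"
  shows "path_trans (model P Q) (c *\<^sub>R p, q) (d *\<^sub>R p, q) qone"
proof -
  let ?g = "linepath (c *\<^sub>R p, q) (d *\<^sub>R p, q)"
  have g: "?g s = ((c + s * (d - c)) *\<^sub>R p, q)" for s by (simp add: linepath_def algebra_simps)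
  have gd: "(?g has_vector_derivative ((d - c) *\<^sub>R p, 0)) (at s)" for s
    using has_vector_derivative_linepath_within[of "(c *\<^sub>R p, q)" "(d *\<^sub>R p, q)" s UNIV] by (simp add: scaleR_diff_left)
  have "transport (model P Q) ?g (\<lambda>s. qone)"
    unfolding transport_def
  proof (intro conjI exI[of _ "{}"] ballI)
    show "?g differentiable at s" for s using gd differentiableI_vector by blast
    show "((\<lambda>s. qone) has_vector_derivative qone \<odot> model P Q (?g s) (vector_derivative ?g (at s))) (at s within {0..1})" for s
      unfolding vector_derivative_at[OF gd] g model_radial by simp
  qed auto
  moreover have "path_image ?g \<subseteq> M" unfolding path_image_def g using q by (auto simp: M_def)
  moreover have "valid_path ?g" "pathstart ?g = (c *\<^sub>R p, q)" "pathfinish ?g = (d *\<^sub>R p, q)" by simp_all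
  ultimately show ?thesis unfolding path_trans_def by (intro exI conjI) (assumption+, rule refl)
qed

lemma path_trans_arc:
  assumes q: "q \<in> SU2" and i: "i \<in> {1..3}"
  shows "path_trans (model P Q) (p, q) (p \<odot> qexp i a, q) (qexp i (a * model_coeff P Q i ((norm p)\<^sup>2)))"
proof -
  have "valid_path (exp_arc p q i a)"
  proof -
    have "continuous_on {0..1} (\<lambda>s. (a *\<^sub>R (p \<odot> qexp i (a * s) \<odot> T i), 0 :: quat))"
      by (rule continuous_on_Pair[OF continuous_on_scaleR[OF continuous_on_const
            bounded_bilinear.continuous_on[OF bounded_bilinear_qmult bounded_bilinear.continuous_on[OF bounded_bilinear_qmult
                continuous_on_const continuous_on_qexp] continuous_on_const]] continuous_on_const])
    then have "exp_arc p q i a C1_differentiable_on {0..1}"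
      unfolding C1_differentiable_on_def
      by (intro exI[of _ "\<lambda>s. (a *\<^sub>R (p \<odot> qexp i (a * s) \<odot> T i), 0)"] conjI ballI exp_arc_deriv)
    then show ?thesis unfolding valid_path_def by (rule C1_differentiable_imp_piecewise)
  qed
  moreover have "path_image (exp_arc p q i a) \<subseteq> M" using q by (auto simp: path_image_def M_def exp_arc_def)
  moreover have "transport (model P Q) (exp_arc p q i a) (\<lambda>s. qexp i (a * model_coeff P Q i ((norm p)\<^sup>2) * s))"
    by (rule transport_arc[OF refl q i])
  moreover have "pathstart (exp_arc p q i a) = (p, q)" "pathfinish (exp_arc p q i a) = (p \<odot> qexp i a, q)"
    by (simp_all add: pathstart_def pathfinish_def exp_arc_def)
  ultimately show ?thesis unfolding path_trans_def
    by (intro exI[of _ "exp_arc p q i a"] exI[of _ "\<lambda>s. qexp i (a * model_coeff P Q i ((norm p)\<^sup>2) * s)"] conjI) simp_all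
qed

text \<open>Euler angles from polar coordinates of the two complex components: the moduli are
  \<open>cos \<beta>\<close> and \<open>sin \<beta>\<close>, and the arguments are
  \<open>\<alpha> + \<gamma>\<close> and \<open>\<alpha> - \<gamma>\<close>.\<close>

lemma SU2_euler:
  assumes "h \<in> SU2"
  shows "\<exists>\<alpha> \<beta> \<gamma>. h = qexp 1 \<alpha> \<odot> qexp 2 \<beta> \<odot> qexp 1 \<gamma>"
proof -
  have n: "(norm (fst h))\<^sup>2 + (norm (snd h))\<^sup>2 = 1" using assms by (simp add: SU2_def norm_prod_def)
  then obtain \<beta> where \<beta>: "norm (fst h) = cos \<beta>" "norm (snd h) = sin \<beta>" using sincos_total_pi_half[of "norm (fst h)" "norm (snd h)"] by auto
  obtain a where a: "fst h = norm (fst h) *\<^sub>R cis a" using Arg_eq rcis_cmod_Arg[of "fst h"] by (metis rcis_def scaleR_conv_of_real)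
  obtain b where b: "snd h = norm (snd h) *\<^sub>R cis b" using rcis_cmod_Arg[of "snd h"] by (metis rcis_def scaleR_conv_of_real)
  have q2: "qexp 2 \<beta> = (complex_of_real (cos \<beta>), complex_of_real (sin \<beta>))" by (simp add: qexp_def qone_def T_def prod_eq_iff complex_eq_iff)
  have "qexp 1 ((a + b) / 2) \<odot> qexp 2 \<beta> \<odot> qexp 1 ((a - b) / 2) = (cos \<beta> *\<^sub>R cis a, sin \<beta> *\<^sub>R cis b)"
  proof -
    have 1: "cis ((a + b) / 2) * cis ((a - b) / 2) = cis a" by (simp add: cis_mult add_divide_distrib[symmetric])
    have 2: "cis ((a + b) / 2) * cnj (cis ((a - b) / 2)) = cis b" by (simp add: cis_cnj cis_mult diff_divide_distrib[symmetric])
    show ?thesis unfolding expT1_qexp[symmetric] q2 1[symmetric] 2[symmetric]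
      by (simp add: expT1_def qmult_def scaleR_conv_of_real mult_ac)
  qed
  then have "h = qexp 1 ((a + b) / 2) \<odot> qexp 2 \<beta> \<odot> qexp 1 ((a - b) / 2)" using a b \<beta> by (simp add: prod_eq_iff)
  then show ?thesis by blast
qed

text \<open>On tangent vectors \<open>A\<close> takes imaginary values, and \<open>u\<close> is
  orthogonal to \<open>u\<close> times an imaginary quaternion, so the norm of \<open>u\<close> is
  constant.\<close>

lemma transport_SU2:
  assumes A: "connection_P1 A" and im: "path_image \<gamma> \<subseteq> M" and t: "transport A \<gamma> u"
  shows "u 1 \<in> SU2"
proof -
  obtain S where S: "finite S" "\<And>s. s \<in> {0..1} - S \<Longrightarrow> \<gamma> differentiable at s"
    "\<And>s. s \<in> {0..1} - S \<Longrightarrow> (u has_vector_derivative (u s \<odot> A (\<gamma> s) (vector_derivative \<gamma> (at s)))) (at s within {0..1})"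
    and u: "u 0 = qone" "continuous_on {0..1} u"
    using t unfolding transport_def by blast
  have "inner (u 1) (u 1) = 1"
  \<comment> \<open>The end points join the exceptional set because the two-sided velocity of
    \<open>\<gamma>\<close> is seen to be tangent to \<open>M\<close> only where
    \<open>\<gamma>\<close> lies in \<open>M\<close> on both sides.\<close>
  proof (rule has_derivative_zero_unique_strong_interval[where f = "\<lambda>s. inner (u s) (u s)" and k = "S \<union> {0, 1}" and a = 0 and b = 1])
    show "finite (S \<union> {0, 1})" using S by simp
    show "continuous_on {0..1} (\<lambda>s. inner (u s) (u s))" by (intro continuous_intros u)
    show "inner (u 0) (u 0) = 1" using u norm_qone by (simp add: dot_square_norm)
    fix s :: real assume s: "s \<in> {0..1} - (S \<union> {0, 1})"
    then have s': "s \<in> {0..1} - S" "0 < s" "s < 1" by auto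
    let ?d = "vector_derivative \<gamma> (at s)"
    have gM: "\<gamma> r \<in> M" if "0 < r" "r < 1" for r using im that by (auto simp: path_image_def)
    have gd: "(\<gamma> has_vector_derivative ?d) (at s)" using S(2)[OF s'(1)] by (simp add: vector_derivative_works)
    have "((\<lambda>r. snd (\<gamma> r)) has_vector_derivative snd ?d) (at s)"
      by (rule bounded_linear.has_vector_derivative[OF bounded_linear_snd gd])
    from bounded_bilinear.has_vector_derivative[OF bounded_bilinear_inner this this]
    have "((\<lambda>r. inner (snd (\<gamma> r)) (snd (\<gamma> r))) has_vector_derivative inner (snd (\<gamma> s)) (snd ?d) + inner (snd ?d) (snd (\<gamma> s))) (at s)" .
    moreover have "((\<lambda>r. inner (snd (\<gamma> r)) (snd (\<gamma> r))) has_vector_derivative 0) (at s)"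
    proof (rule has_vector_derivative_transform_within_open[of "\<lambda>r. 1" _ _ "{0<..<1}"])
      show "1 = inner (snd (\<gamma> r)) (snd (\<gamma> r))" if "r \<in> {0<..<1}" for r
        using gM[of r] that by (auto simp: M_def SU2_def dot_square_norm)
    qed (use s' in auto)
    ultimately have "inner (snd (\<gamma> s)) (snd ?d) + inner (snd ?d) (snd (\<gamma> s)) = 0" by (rule vector_derivative_unique_at)
    then have "?d \<in> tangent (\<gamma> s)" by (simp add: tangent_def inner_commute)
    then have "A (\<gamma> s) ?d \<in> su2" using A gM[OF s'(2,3)] by (simp add: connection_P1_def)
    then have z: "inner (u s) (u s \<odot> A (\<gamma> s) ?d) = 0"
      using inner_qmult_left[of "u s" qone "A (\<gamma> s) ?d"] by (simp add: inner_qone su2_def)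
    from bounded_bilinear.has_vector_derivative[OF bounded_bilinear_inner S(3)[OF s'(1)] S(3)[OF s'(1)]]
    have "((\<lambda>s. inner (u s) (u s)) has_vector_derivative 0) (at s within {0..1})" using z by (simp add: inner_commute)
    then show "((\<lambda>s. inner (u s) (u s)) has_derivative (\<lambda>h. 0)) (at s within {0..1})" by (simp add: has_vector_derivative_def)
  qed auto
  then show ?thesis by (simp add: SU2_def norm_eq_sqrt_inner)
qed

text \<open>
  Parallel transport is trivial along radial segments, so going out to radius \<open>t\<close> from the singular orbit, along
  arcs of arbitrary length and back produces \<open>exp (\<alpha> T\<^sub>1) exp (\<beta> T\<^sub>2) exp (\<gamma> T\<^sub>1)\<close> for all \<open>\<alpha>, \<beta>, \<gamma>\<close>.
\<close>

theorem flow_conn_irreducible: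
  assumes fl: "flow p0 w0 b \<phi> L" and w: "w0 \<noteq> 0"
  shows "irreducible_connection (flow_conn w0 b \<phi> L)"
  unfolding irreducible_connection_def
proof
  fix x assume x: "x \<in> M"
  obtain p q where pq: "x = (p, q)" "q \<in> SU2" using x by (cases x) (auto simp: M_def)
  let ?P = "sol_P b \<phi>" and ?Q = "sol_Q w0 b L" and ?B = "flow_conn w0 b \<phi> L"
  have b: "-1 < b" "b < 0" using fl by (auto simp: flow_def)
  have bz: "b < 1" using b by simp
  \<comment> \<open>Any radius with both coefficients nonzero would do;
    \<open>\<phi> \<ge> 2\<close> ensures the first and \<open>w0 \<noteq> 0\<close> the
    second.\<close>
  define t where "t = t_of 1"
  have t: "0 < t" "t\<^sup>2 = t_sq 1" using t_of_pos[of 1] t_of_sq[of 1] by (simp_all add: t_def)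
  have ph: "2 \<le> \<phi> 1" using fl bz by (simp add: flow_def)
  have F: "model_coeff ?P ?Q 1 (t\<^sup>2) \<noteq> 0" and G: "model_coeff ?P ?Q 2 (t\<^sup>2) \<noteq> 0"
    using sol_t_sq(1)[OF b(1) bz, of \<phi>] sol_t_sq(2)[OF b(1) bz, of w0 L] A1_sq_pos[of 1] g_weight_pos[of 1] w ph by (auto simp: model_coeff_def t(2))
  have lin: "linear (model ?P ?Q y)" for y by (rule linear_model)
  have "holonomy_group ?B x \<subseteq> SU2"
    unfolding holonomy_group_def using transport_SU2[OF connection_flow_conn[OF fl]] by auto
  moreover have "h \<in> holonomy_group ?B x" if h: "h \<in> SU2" for h
  proof -
    obtain \<alpha> \<beta> \<gamma> where e: "h = qexp 1 \<alpha> \<odot> qexp 2 \<beta> \<odot> qexp 1 \<gamma>" using SU2_euler[OF h] by blast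
    let ?F = "model_coeff ?P ?Q 1 (t\<^sup>2)" and ?G = "model_coeff ?P ?Q 2 (t\<^sup>2)"
    define p1 where "p1 = t *\<^sub>R qone"
    define p2 where "p2 = p1 \<odot> qexp 1 (\<alpha> / ?F)"
    define p3 where "p3 = p2 \<odot> qexp 2 (\<beta> / ?G)"
    define p4 where "p4 = p3 \<odot> qexp 1 (\<gamma> / ?F)"
    have n: "(norm p1)\<^sup>2 = t\<^sup>2" "(norm p2)\<^sup>2 = t\<^sup>2" "(norm p3)\<^sup>2 = t\<^sup>2"
      by (simp_all add: p1_def p2_def p3_def norm_qmult_SU2[OF qexp_SU2] norm_SU2[OF qexp_SU2] norm_qone)
    note j = path_trans_join[where A = "model ?P ?Q", OF lin]
    have 1: "path_trans (model ?P ?Q) (p, q) (0, q) qone" using path_trans_radial[OF pq(2), of ?P ?Q 1 p 0] by (simp add: zero_prod_def)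
    have 2: "path_trans (model ?P ?Q) (0, q) (p1, q) qone" using path_trans_radial[OF pq(2), of ?P ?Q 0 p1 1] by (simp add: zero_prod_def)
    have 3: "path_trans (model ?P ?Q) (p1, q) (p2, q) (qexp 1 \<alpha>)"
      using path_trans_arc[OF pq(2), of 1 ?P ?Q p1 "\<alpha> / ?F"] F by (simp add: p2_def n)
    have 4: "path_trans (model ?P ?Q) (p2, q) (p3, q) (qexp 2 \<beta>)"
      using path_trans_arc[OF pq(2), of 2 ?P ?Q p2 "\<beta> / ?G"] G by (simp add: p3_def n)
    have 5: "path_trans (model ?P ?Q) (p3, q) (p4, q) (qexp 1 \<gamma>)"
      using path_trans_arc[OF pq(2), of 1 ?P ?Q p3 "\<gamma> / ?F"] F by (simp add: p4_def n)
    \<comment> \<open>The arcs end at \<open>p4\<close> and not at \<open>p1\<close>, yet the loop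
      closes: radial segments from all directions end at the same point \<open>(0, q)\<close> of the
      singular orbit.\<close>
    have 6: "path_trans (model ?P ?Q) (p4, q) (0, q) qone" using path_trans_radial[OF pq(2), of ?P ?Q 1 p4 0] by (simp add: zero_prod_def)
    have 7: "path_trans (model ?P ?Q) (0, q) (p, q) qone" using path_trans_radial[OF pq(2), of ?P ?Q 0 p 1] by (simp add: zero_prod_def)
    have "path_trans ?B x x h"
      using j[OF j[OF j[OF j[OF j[OF j[OF 1 2] 3] 4] 5] 6] 7] by (simp add: e pq(1) flow_conn_def)
    then show ?thesis unfolding path_trans_def holonomy_group_def by blast
  qed
  ultimately show "holonomy_group ?B x = SU2" by blast
qed

section \<open>Gauge transformations\<close>

lemma invariant_gaugeD:
  assumes "invariant_gauge u" "(p, q) \<in> M"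
  shows "a1 \<in> SU2 \<Longrightarrow> a2 \<in> SU2 \<Longrightarrow> u (a1 \<odot> p, a1 \<odot> q \<odot> qcnj a2) = u (p, q)"
    "c \<in> U1 \<Longrightarrow> u (p \<odot> c, q) = qcnj c \<odot> u (p, q) \<odot> c"
  using assms unfolding invariant_gauge_def by blast+

text \<open>The group element \<open>(a, a)\<close> moves \<open>(t, 1)\<close> to
  \<open>(t a, 1)\<close>.\<close>

lemma invariant_gauge_sphere:
  assumes u: "invariant_gauge u" and a: "a \<in> SU2"
  shows "u (t *\<^sub>R a, qone) = u (base_point t)"
proof -
  have "u (a \<odot> (t *\<^sub>R qone), a \<odot> qone \<odot> qcnj a) = u (t *\<^sub>R qone, qone)"
    by (rule invariant_gaugeD(1)[OF u base_point(1)[unfolded base_point_def] a a])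
  then show ?thesis using SU2_inverse(2)[OF a] by (simp add: base_point_def)
qed

text \<open>Right multiplication by \<open>c\<close> keeps the base point within its
  \<open>SU(2)^2\<close>-orbit, so equivariance makes \<open>u\<close> commute with \<open>c\<close>
  there. The angle \<open>pi / 2\<close> gives \<open>c = T 1\<close>, and commuting with it already
  kills the second complex component.\<close>

lemma invariant_gauge_U1:
  assumes u: "invariant_gauge u"
  shows "snd (u (base_point t)) = 0"
proof -
  let ?c = "expT1 (pi / 2)"
  have c: "?c \<in> U1" by (simp add: U1_def)
  have "u ((t *\<^sub>R qone) \<odot> ?c, qone) = qcnj ?c \<odot> u (t *\<^sub>R qone, qone) \<odot> ?c"
    by (rule invariant_gaugeD(2)[OF u base_point(1)[unfolded base_point_def] c])
  moreover have "u ((t *\<^sub>R qone) \<odot> ?c, qone) = u (base_point t)"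
    using invariant_gauge_sphere[OF u U1_SU2[OF c], of t] by simp
  ultimately have "u (base_point t) = qcnj ?c \<odot> u (base_point t) \<odot> ?c" by (simp add: base_point_def)
  then show ?thesis
    by (simp add: expT1_def qmult_def qcnj_def prod_eq_iff complex_eq_iff)
qed

lemma invariant_gauge_differentiable:
  assumes "invariant_gauge u" "x \<in> M"
  shows "u differentiable (at x)"
proof -
  obtain N where N: "M \<subseteq> N" "Ck_on (Suc 0) N u"
    using assms(1) unfolding invariant_gauge_def smooth_near_def by meson
  then show ?thesis using assms(2) by auto
qed

text \<open>\<open>u\<close> is constant along the arc with this velocity. Hence the inhomogeneous
  term of a gauge transformation vanishes on these vectors, and the connection is merely conjugated
  there.\<close>

lemma invariant_gauge_tangential:
  assumes u: "invariant_gauge u"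
  shows "frechet_derivative u (at (base_point t)) (t *\<^sub>R T i, 0) = 0"
proof -
  have d: "(u has_derivative frechet_derivative u (at (base_point t))) (at (base_point t))"
    using invariant_gauge_differentiable[OF u base_point(1)] by (simp add: frechet_derivative_works)
  have g: "(exp_arc (t *\<^sub>R qone) qone i 1 has_vector_derivative (t *\<^sub>R T i, 0)) (at 0)"
    using exp_arc_deriv[of "t *\<^sub>R qone" qone i 1 0 UNIV] by simp
  have "exp_arc (t *\<^sub>R qone) qone i 1 0 = base_point t" by (simp add: exp_arc_def base_point_def)
  with d have "(u has_derivative frechet_derivative u (at (base_point t))) (at (exp_arc (t *\<^sub>R qone) qone i 1 0))" by simp
  from diff_chain_at[OF g[unfolded has_vector_derivative_def] this]
  have "((\<lambda>s. u (exp_arc (t *\<^sub>R qone) qone i 1 s)) has_derivative (\<lambda>h. frechet_derivative u (at (base_point t)) (h *\<^sub>R (t *\<^sub>R T i, 0)))) (at 0)"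
    by (simp add: o_def)
  moreover have "u (exp_arc (t *\<^sub>R qone) qone i 1 s) = u (base_point t)" for s
    using invariant_gauge_sphere[OF u qexp_SU2, of t i s] by (simp add: exp_arc_def)
  ultimately have "((\<lambda>s :: real. u (base_point t)) has_derivative (\<lambda>h. frechet_derivative u (at (base_point t)) (h *\<^sub>R (t *\<^sub>R T i, 0)))) (at 0)"
    by simp
  from has_derivative_unique[OF this has_derivative_const] have "(\<lambda>h. frechet_derivative u (at (base_point t)) (h *\<^sub>R (t *\<^sub>R T i, 0))) = (\<lambda>h :: real. 0)" .
  from fun_cong[OF this, of 1] show ?thesis by simp
qed

lemma instanton_at_base_point:
  assumes "instanton_at \<pi> A"
  shows "\<exists>f g. (\<lambda>t. f t - fst \<pi> * t) \<in> O[at_right 0](\<lambda>t. t ^ 3) \<and> (\<lambda>t. g t - snd \<pi> * t) \<in> O[at_right 0](\<lambda>t. t ^ 3) \<and>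
    (\<forall>t>0. A (base_point t) (t *\<^sub>R T 1, 0) = (bggg_A 1 t * f t) *\<^sub>R T 1 \<and>
      A (base_point t) (t *\<^sub>R T 2, 0) = (bggg_A 2 t * g t) *\<^sub>R T 2)"
proof -
  obtain f g where fO: "(\<lambda>t. f t - fst \<pi> * t) \<in> O[at_right 0](\<lambda>t. t ^ 3)" and gO: "(\<lambda>t. g t - snd \<pi> * t) \<in> O[at_right 0](\<lambda>t. t ^ 3)"
    and n: "\<And>x X. x \<in> M \<Longrightarrow> fst x \<noteq> 0 \<Longrightarrow> X \<in> tangent x \<Longrightarrow>
           A x X = (bggg_A 1 (rad x) * f (rad x) * eta_plus 1 x X) *\<^sub>R T 1
                 + (bggg_A 2 (rad x) * g (rad x)) *\<^sub>R (eta_plus 2 x X *\<^sub>R T 2 + eta_plus 3 x X *\<^sub>R T 3)"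
    using assms unfolding instanton_at_def by blast
  have fp: "field_plus i (base_point t) = (t *\<^sub>R T i, 0)" for i t by (simp add: field_plus_def base_point_def)
  have tg: "field_plus i x \<in> tangent x" for i x by (simp add: field_plus_def tangent_def)
  have v: "A (base_point t) (t *\<^sub>R T 1, 0) = (bggg_A 1 t * f t) *\<^sub>R T 1" "A (base_point t) (t *\<^sub>R T 2, 0) = (bggg_A 2 t * g t) *\<^sub>R T 2" if t: "0 < t" for t
  proof -
    note b = base_point(1)[of t] base_point(3)[OF t]
    have e: "eta_plus 1 (base_point t) (field_plus 1 (base_point t)) = 1" "eta_plus 2 (base_point t) (field_plus 1 (base_point t)) = 0"
      "eta_plus 3 (base_point t) (field_plus 1 (base_point t)) = 0" "eta_plus 1 (base_point t) (field_plus 2 (base_point t)) = 0"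
      "eta_plus 2 (base_point t) (field_plus 2 (base_point t)) = 1" "eta_plus 3 (base_point t) (field_plus 2 (base_point t)) = 0"
      by (rule trans[OF eta_dual(1)[OF b]]; simp)+
    show "A (base_point t) (t *\<^sub>R T 1, 0) = (bggg_A 1 t * f t) *\<^sub>R T 1" "A (base_point t) (t *\<^sub>R T 2, 0) = (bggg_A 2 t * g t) *\<^sub>R T 2"
      unfolding fp[symmetric] n[OF b tg] e base_point(2)[OF t] by simp_all
  qed
  then show ?thesis using fO gO by blast
qed

lemma bggg_A_pos:
  assumes "0 < t" shows "0 < bggg_A 1 t" "0 < bggg_A 2 t"
proof -
  obtain z where z: "0 \<le> z" "t_of z = t" using t_of_surj[of t] assms by auto
  then have "0 < z" using assms by (cases "z = 0") (auto simp: t_of_def)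
  then show "0 < bggg_A 1 t" "0 < bggg_A 2 t" using bggg_AB(1)[of z t] bggg_AB(2)[of z t 2] z by simp_all
qed

text \<open>
  An invariant gauge transformation commutes with \<open>U(1)\<close> and is constant off the singular orbit, so it can only
  rotate \<open>T\<^sub>2, T\<^sub>3\<close> by a fixed angle, that is, change the sign of \<open>g\<^sup>+\<close>.
\<close>

theorem gauge_equivalent_params:
  assumes A: "instanton_at \<pi> A" and B: "instanton_at \<rho> B" and e: "gauge_equivalent A B"
  shows "fst \<pi> = fst \<rho>" "\<bar>snd \<pi>\<bar> = \<bar>snd \<rho>\<bar>"
proof -
  obtain u where u: "invariant_gauge u" and eq: "\<And>x X. x \<in> M \<Longrightarrow> X \<in> tangent x \<Longrightarrow>
        B x X = qcnj (u x) \<odot> A x X \<odot> u x + qcnj (u x) \<odot> frechet_derivative u (at x) X"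
    using e unfolding gauge_equivalent_def by blast
  obtain f g where f: "(\<lambda>t. f t - fst \<pi> * t) \<in> O[at_right 0](\<lambda>t. t ^ 3)" "(\<lambda>t. g t - snd \<pi> * t) \<in> O[at_right 0](\<lambda>t. t ^ 3)"
    "\<And>t. 0 < t \<Longrightarrow> A (base_point t) (t *\<^sub>R T 1, 0) = (bggg_A 1 t * f t) *\<^sub>R T 1"
    "\<And>t. 0 < t \<Longrightarrow> A (base_point t) (t *\<^sub>R T 2, 0) = (bggg_A 2 t * g t) *\<^sub>R T 2" using instanton_at_base_point[OF A] by blast
  obtain f' g' where f': "(\<lambda>t. f' t - fst \<rho> * t) \<in> O[at_right 0](\<lambda>t. t ^ 3)" "(\<lambda>t. g' t - snd \<rho> * t) \<in> O[at_right 0](\<lambda>t. t ^ 3)"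
    "\<And>t. 0 < t \<Longrightarrow> B (base_point t) (t *\<^sub>R T 1, 0) = (bggg_A 1 t * f' t) *\<^sub>R T 1"
    "\<And>t. 0 < t \<Longrightarrow> B (base_point t) (t *\<^sub>R T 2, 0) = (bggg_A 2 t * g' t) *\<^sub>R T 2" using instanton_at_base_point[OF B] by blast
  have key: "f' t = f t \<and> \<bar>g' t\<bar> = \<bar>g t\<bar>" if t: "0 < t" for t
  proof -
    let ?v = "u (base_point t)"
    have vS: "?v \<in> SU2" using u base_point(1) unfolding invariant_gauge_def by blast
    have v0: "snd ?v = 0" by (rule invariant_gauge_U1[OF u])
    have tg: "(t *\<^sub>R T i, 0) \<in> tangent (base_point t)" for i by (simp add: tangent_def)
    have conj: "B (base_point t) (t *\<^sub>R T i, 0) = qcnj ?v \<odot> A (base_point t) (t *\<^sub>R T i, 0) \<odot> ?v" for i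
      unfolding eq[OF base_point(1) tg] invariant_gauge_tangential[OF u] by simp
    have comm: "T 1 \<odot> ?v = ?v \<odot> T 1" using v0 by (simp add: T_def qmult_def prod_eq_iff)
    have "(bggg_A 1 t * f' t) *\<^sub>R T 1 = (bggg_A 1 t * f t) *\<^sub>R T 1"
      using conj[of 1] unfolding f(3)[OF t] f'(3)[OF t] by (simp add: qmult_assoc comm[unfolded One_nat_def] SU2_cancel[OF vS])
    then have "f' t = f t" using bggg_A_pos[OF t] by (simp add: T_def prod_eq_iff complex_eq_iff)
    moreover have "\<bar>g' t\<bar> = \<bar>g t\<bar>"
    proof -
      have n: "norm (qcnj ?v \<odot> w \<odot> ?v) = norm w" for w
        using inner_qmult_left[of "qcnj ?v" w w] norm_SU2[OF SU2_qcnj[OF vS]] norm_qmult_SU2[OF vS]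
        by (simp add: norm_eq_sqrt_inner)
      have "norm ((bggg_A 2 t * g' t) *\<^sub>R T 2) = norm ((bggg_A 2 t * g t) *\<^sub>R T 2)"
        using conj[of 2] n unfolding f(4)[OF t] f'(4)[OF t] by simp
      then show ?thesis using bggg_A_pos[OF t] by (simp add: norm_T abs_mult)
    qed
    ultimately show ?thesis by blast
  qed
  have "((\<lambda>t. f t / t) \<longlongrightarrow> fst \<rho>) (at_right 0)"
    by (rule Lim_transform_eventually[OF tendsto_bigo_at_0[OF f'(1)]])
      (use eventually_at_right_less[of 0] in \<open>eventually_elim, use key in simp\<close>)
  then show "fst \<pi> = fst \<rho>" using tendsto_bigo_at_0[OF f(1)] tendsto_unique trivial_limit_at_right_real by blast
  have "((\<lambda>t. \<bar>g t / t\<bar>) \<longlongrightarrow> \<bar>snd \<rho>\<bar>) (at_right 0)"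
    by (rule Lim_transform_eventually[OF tendsto_rabs[OF tendsto_bigo_at_0[OF f'(2)]]])
      (use eventually_at_right_less[of 0] in \<open>eventually_elim, use key in \<open>simp add: abs_divide\<close>\<close>)
  then show "\<bar>snd \<pi>\<bar> = \<bar>snd \<rho>\<bar>"
    using tendsto_rabs[OF tendsto_bigo_at_0[OF f(2)]] tendsto_unique trivial_limit_at_right_real by blast
qed

lemma gauge_equivalent_refl: "gauge_equivalent A A"
  unfolding gauge_equivalent_def
proof (intro exI[of _ "\<lambda>_. qone"] conjI ballI)
  show "invariant_gauge (\<lambda>_. qone)"
    unfolding invariant_gauge_def smooth_near_def
    using Ck_on_const U1_SU2 SU2_inverse by (auto simp: SU2_def norm_qone intro!: exI[of _ UNIV])
qed (simp add: frechet_derivative_const)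

text \<open>The angle at radius \<open>t\<close> is \<open>2 * pi\<close> times
  \<open>A_1 f^+\<close>, which is \<open>A1_sq z * \<phi> z\<close>, and \<open>A1_sq\<close> tends
  to 1.\<close>

lemma holonomy_limit:
  assumes I: "instanton_at (f1, g1) A" and fl: "flow (2 * f1) (w_scale * g1) b \<phi> L" and l: "(\<phi> \<longlongrightarrow> l) at_top"
  shows "((\<lambda>t. holonomy A (circle_at t)) \<longlongrightarrow> expT1 (2 * pi * l)) at_top"
proof -
  let ?P = "sol_P b \<phi>" and ?Q = "sol_Q (w_scale * g1) b L"
  have b: "-1 < b" "b < 0" using fl by (auto simp: flow_def)
  have hol: "holonomy A (circle_at t) = expT1 (2 * pi * (t\<^sup>2 * ?P (t\<^sup>2)))" for t
    by (rule holonomy_circle[where Q = ?Q]) (use instanton_at_unique[OF I fl] in \<open>simp add: flow_conn_def\<close>)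
  have Z: "filterlim (\<lambda>t. z_of b (t\<^sup>2)) at_top at_top"
    unfolding filterlim_at_top
  proof
    fix K :: real
    have "K \<le> z_of b (t\<^sup>2)" if t: "t_of (max 0 K) \<le> t" for t
    proof -
      have t0: "0 \<le> t" using t_of_nonneg[of "max 0 K"] t by simp
      obtain z where z: "0 \<le> z" "t_of z = t" using t_of_surj[OF t0] .
      have bz: "b < z" using b z by simp
      have "\<not> z < max 0 K"
      proof
        assume "z < max 0 K"
        from t_of_strict_mono[OF z(1) this] z(2) t show False by linarith
      qed
      moreover have "t\<^sup>2 = t_sq z" using t_of_sq[of z] z by simp
      ultimately show ?thesis using z_of_t_sq[OF b(1) bz] by simp
    qed
    then show "\<forall>\<^sub>F t in at_top. K \<le> z_of b (t\<^sup>2)" unfolding eventually_at_top_linorder by blast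
  qed
  have "(A1_sq \<longlongrightarrow> 1) at_top" unfolding A1_sq_def by real_asymp
  from filterlim_compose[OF tendsto_mult[OF this l] Z]
  have "((\<lambda>t. A1_sq (z_of b (t\<^sup>2)) * \<phi> (z_of b (t\<^sup>2))) \<longlongrightarrow> 1 * l) at_top" .
  moreover have "A1_sq (z_of b (t\<^sup>2)) * \<phi> (z_of b (t\<^sup>2)) = t\<^sup>2 * ?P (t\<^sup>2)" for t
    using sol_t_sq(1)[OF b(1) t_sq_z_of(2)[OF b(1)], of "t\<^sup>2" \<phi>] t_sq_z_of(1)[OF b(1), of "t\<^sup>2"] t_sq_image_nonneg[OF b(2)] by simp
  ultimately have "((\<lambda>t. t\<^sup>2 * ?P (t\<^sup>2)) \<longlongrightarrow> l) at_top" by simp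
  then have "((\<lambda>t. expT1 (2 * pi * (t\<^sup>2 * ?P (t\<^sup>2)))) \<longlongrightarrow> expT1 (2 * pi * l)) at_top"
    unfolding expT1_qexp qexp_def by (intro tendsto_intros)
  then show ?thesis by (simp add: hol)
qed

section \<open>Parameter region and surjectivity of the holonomy\<close>

lemma flow_lim_diff:
  assumes w: "w0\<^sup>2 \<le> 1/8" and f: "flow p0 w0 b \<phi> L" "flow p1 w0 b' \<phi>' L'" and l: "(\<phi> \<longlongrightarrow> l) at_top" "(\<phi>' \<longlongrightarrow> l') at_top"
  shows "\<bar>l - l'\<bar> \<le> 2 * \<bar>p0 - p1\<bar>"
proof (rule tendsto_upperbound)
  show "((\<lambda>z. \<bar>\<phi> z - \<phi>' z\<bar>) \<longlongrightarrow> \<bar>l - l'\<bar>) at_top" by (intro tendsto_intros l)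
  show "\<forall>\<^sub>F z in at_top. \<bar>\<phi> z - \<phi>' z\<bar> \<le> 2 * \<bar>p0 - p1\<bar>"
    using eventually_ge_at_top[of 0] by eventually_elim (rule flow_lipschitz[OF w f])
qed simp

text \<open>The bounds on \<open>f\<close> and on the square are those of
  \<open>flow_exists\<close>. \<open>0 < g\<close> secures irreducibility and selects one of the
  gauge equivalent parameters \<open>g\<close> and \<open>- g\<close>; unboundedness comes from the
  direction of \<open>f\<close>.\<close>

definition param_region :: "(real \<times> real) set" where
  "param_region = {(f, g). 3 < 2 * f \<and> 0 < g \<and> (w_scale * g)\<^sup>2 < 1/8}"

lemma param_region_flow:
  assumes "(f, g) \<in> param_region"
  shows "\<exists>b \<phi> L. flow (2 * f) (w_scale * g) b \<phi> L"
  using assms by (intro flow_exists) (auto simp: param_region_def)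

lemma w_scale_pos: "0 < w_scale"
  by (simp add: w_scale_def)

lemma param_region_topology:
  "open param_region" "\<not> bounded param_region"
  and param_region_line: "\<exists>g. 0 < g \<and> (w_scale * g)\<^sup>2 < 1/8"
proof -
  have e: "param_region = {x. 3 < 2 * fst x} \<inter> {x. 0 < snd x} \<inter> {x. (w_scale * snd x)\<^sup>2 < 1/8}"
    by (auto simp: param_region_def)
  show "open param_region" unfolding e by (intro open_Int open_Collect_less continuous_intros)
  show ex: "\<exists>g. 0 < g \<and> (w_scale * g)\<^sup>2 < 1/8"
    by (rule exI[of _ "1 / (4 * w_scale)"]) (use w_scale_pos in \<open>simp add: power2_eq_square\<close>)
  then obtain g where g: "0 < g" "(w_scale * g)\<^sup>2 < 1/8" by blast
  show "\<not> bounded param_region"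
  proof
    assume "bounded param_region"
    then obtain C where C: "\<And>x. x \<in> param_region \<Longrightarrow> norm x \<le> C" by (auto simp: bounded_iff)
    have "(\<bar>C\<bar> + 2, g) \<in> param_region" using g by (auto simp: param_region_def)
    from C[OF this] norm_fst_le[of "\<bar>C\<bar> + 2" g] show False by simp
  qed
qed

text \<open>Injectivity of \<open>gauge_class_at\<close> on \<open>U\<close> is what makes
  \<open>U\<close> a subset of the moduli space. Decay and holonomy are asserted for every instanton
  with parameters in \<open>U\<close>; each one coincides on tangent vectors with a flow
  connection.\<close>

theorem theorem3:
  shows "\<exists>U :: (real \<times> real) set. U \<noteq> {} \<and> open U \<and> \<not> bounded U \<and>
    gauge_class_at ` U \<subseteq> moduli_space \<and> inj_on gauge_class_at U \<and>
    (\<forall>\<pi>\<in>U. \<forall>A. instanton_at \<pi> A \<longrightarrow> quadratic_curvature_decay A) \<and>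
    (\<exists>Hol_inf :: real \<times> real \<Rightarrow> quat.
       (\<forall>\<pi>\<in>U. \<forall>A. instanton_at \<pi> A \<longrightarrow>
          ((\<lambda>t. holonomy A (circle_at t)) \<longlongrightarrow> Hol_inf \<pi>) at_top) \<and>
       Hol_inf ` U = U1)"
proof -
  let ?U = param_region
  have ex: "\<exists>b \<phi> L. flow (2 * fst \<pi>) (w_scale * snd \<pi>) b \<phi> L" if "\<pi> \<in> ?U" for \<pi>
    using param_region_flow[of "fst \<pi>" "snd \<pi>"] that by simp
  then obtain b \<phi> L where fl: "\<And>\<pi>. \<pi> \<in> ?U \<Longrightarrow> flow (2 * fst \<pi>) (w_scale * snd \<pi>) (b \<pi>) (\<phi> \<pi>) (L \<pi>)" by metis
  define A0 where "A0 \<pi> = flow_conn (w_scale * snd \<pi>) (b \<pi>) (\<phi> \<pi>) (L \<pi>)" for \<pi> :: "real \<times> real"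
  have A0: "instanton_at \<pi> (A0 \<pi>)" if "\<pi> \<in> ?U" for \<pi>
    using instanton_at_flow_conn[OF fl[OF that]] by (simp add: A0_def)
  have irr: "A0 \<pi> \<in> irreducible_instantons" if "\<pi> \<in> ?U" for \<pi>
  proof -
    have "w_scale * snd \<pi> \<noteq> 0" using that w_scale_pos by (auto simp: param_region_def)
    then show ?thesis using flow_conn_irreducible[OF fl[OF that]] A0[OF that]
      by (simp add: irreducible_instantons_def A0_def instanton_at_def)
  qed
  have un: "A x X = A0 \<pi> x X" if "\<pi> \<in> ?U" "instanton_at \<pi> A" "x \<in> M" "X \<in> tangent x" for \<pi> A x X
    using instanton_at_unique[of "fst \<pi>" "snd \<pi>" A, OF _ fl[OF that(1)] that(3,4)] that(2) by (simp add: A0_def)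
  \<comment> \<open>By uniqueness all instantons with parameters \<open>\<pi>\<close> agree with
    \<open>A0 \<pi>\<close> on tangent vectors, so the connections gauge equivalent to any of them
    form a single class.\<close>
  have cls: "gauge_class_at \<pi> = gauge_rel `` {A0 \<pi>}" if p: "\<pi> \<in> ?U" for \<pi>
  proof
    show "gauge_rel `` {A0 \<pi>} \<subseteq> gauge_class_at \<pi>" using A0[OF p] by (auto simp: gauge_class_at_def)
    show "gauge_class_at \<pi> \<subseteq> gauge_rel `` {A0 \<pi>}"
    proof
      fix B assume "B \<in> gauge_class_at \<pi>"
      then obtain A where A: "instanton_at \<pi> A" "(A, B) \<in> gauge_rel" by (auto simp: gauge_class_at_def)
      then have "gauge_equivalent A B" "B \<in> irreducible_instantons" by (auto simp: gauge_rel_def)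
      then have "gauge_equivalent (A0 \<pi>) B" unfolding gauge_equivalent_def using un[OF p A(1)] by auto
      then show "B \<in> gauge_rel `` {A0 \<pi>}" using irr[OF p] \<open>B \<in> irreducible_instantons\<close> by (auto simp: gauge_rel_def)
    qed
  qed
  have self: "A0 \<pi> \<in> gauge_class_at \<pi>" if "\<pi> \<in> ?U" for \<pi>
    unfolding cls[OF that] using irr[OF that] gauge_equivalent_refl by (auto simp: gauge_rel_def)
  have inj: "inj_on gauge_class_at ?U"
  proof (rule inj_onI)
    fix \<pi> \<rho> assume p: "\<pi> \<in> ?U" "\<rho> \<in> ?U" and e: "gauge_class_at \<pi> = gauge_class_at \<rho>"
    have "A0 \<rho> \<in> gauge_class_at \<pi>" using self[OF p(2)] e by simp
    then obtain A where A: "instanton_at \<pi> A" "gauge_equivalent A (A0 \<rho>)" by (auto simp: gauge_class_at_def gauge_rel_def)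
    from gauge_equivalent_params[OF A(1) A0[OF p(2)] A(2)] show "\<pi> = \<rho>"
      using p by (auto simp: param_region_def prod_eq_iff)
  qed
  have "\<exists>l. (\<phi> \<pi> \<longlongrightarrow> l) at_top \<and> 2 * fst \<pi> - 1 \<le> l \<and> l \<le> 2 * fst \<pi>" if "\<pi> \<in> ?U" for \<pi>
    by (rule flow_lim[OF fl[OF that]])
  then obtain l where l: "\<And>\<pi>. \<pi> \<in> ?U \<Longrightarrow> (\<phi> \<pi> \<longlongrightarrow> l \<pi>) at_top" "\<And>\<pi>. \<pi> \<in> ?U \<Longrightarrow> 2 * fst \<pi> - 1 \<le> l \<pi> \<and> l \<pi> \<le> 2 * fst \<pi>" by metis
  define H where "H \<pi> = expT1 (2 * pi * l \<pi>)" for \<pi> :: "real \<times> real"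
  obtain g where g: "0 < g" "(w_scale * g)\<^sup>2 < 1/8" using param_region_line by blast
  have lin: "(f, g) \<in> ?U" if "2 \<le> f" for f using that g by (auto simp: param_region_def)
  have Hsurj: "H ` ?U = U1"
  proof
    show "H ` ?U \<subseteq> U1" by (auto simp: H_def U1_def)
    show "U1 \<subseteq> H ` ?U"
    proof
      fix c assume "c \<in> U1"
      then obtain \<theta> where c: "c = expT1 \<theta>" by (auto simp: U1_def)
      \<comment> \<open>The limit is at most 4 at \<open>f = 2\<close> and at least 5 at
        \<open>f = 3\<close>, so it passes through this value, which is
        \<open>\<theta> / (2 * pi)\<close> modulo 1. The path keeps \<open>g\<close> fixed because
        \<open>flow_lim_diff\<close> compares flows with a common \<open>w0\<close>.\<close>
      define y where "y = 4 + frac (\<theta> / (2 * pi))"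
      have y: "4 \<le> y" "y \<le> 5" using frac_ge_0[of "\<theta> / (2 * pi)"] frac_lt_1[of "\<theta> / (2 * pi)"] by (auto simp: y_def)
      have cont: "continuous_on {2..3} (\<lambda>f. l (f, g))"
      proof (rule continuous_onI)
        fix x e :: real assume x: "x \<in> {2..3}" and e: "0 < e"
        show "\<exists>d>0. \<forall>x'\<in>{2..3}. dist x' x < d \<longrightarrow> dist (l (x', g)) (l (x, g)) \<le> e"
        proof (intro exI[of _ "e / 4"] conjI ballI impI)
          fix x' assume x': "x' \<in> {2..3}" "dist x' x < e / 4"
          have m: "(x', g) \<in> ?U" "(x, g) \<in> ?U" using lin x x' by auto
          have "\<bar>l (x', g) - l (x, g)\<bar> \<le> 2 * \<bar>2 * x' - 2 * x\<bar>"
            using flow_lim_diff[OF _ fl[OF m(1), simplified] fl[OF m(2), simplified] l(1)[OF m(1)] l(1)[OF m(2)]] g by simp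
          also have "\<bar>2 * x' - 2 * x\<bar> = 2 * \<bar>x' - x\<bar>" unfolding right_diff_distrib[symmetric] abs_mult by simp
          also have "2 * (2 * \<bar>x' - x\<bar>) \<le> e" using x'(2) by (simp add: dist_real_def)
          finally show "dist (l (x', g)) (l (x, g)) \<le> e" by (simp add: dist_real_def)
        qed (use e in simp)
      qed
      have "\<exists>f\<ge>2. f \<le> 3 \<and> l (f, g) = y"
        by (rule IVT'[OF _ _ _ cont]) (use y l(2)[OF lin[of 2]] l(2)[OF lin[of 3]] in auto)
      then obtain f where f: "2 \<le> f" "l (f, g) = y" by blast
      have "2 * pi * y = \<theta> + 2 * pi * real_of_int (4 - \<lfloor>\<theta> / (2 * pi)\<rfloor>)"
        by (simp add: y_def frac_def field_simps)
      then have "H (f, g) = expT1 \<theta>"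
        using cis_multiple_2pi[of "real_of_int (4 - \<lfloor>\<theta> / (2 * pi)\<rfloor>)"]
        by (simp add: H_def f(2) expT1_def cis_mult[symmetric] del: of_int_diff)
      then show "c \<in> H ` ?U" unfolding c using lin[OF f(1)] by (intro image_eqI[of _ _ "(f, g)"]) auto
    qed
  qed
  have "?U \<noteq> {}" using lin[of 2] by auto
  moreover have "gauge_class_at ` ?U \<subseteq> moduli_space"
    unfolding moduli_space_def using cls irr by (auto intro: quotientI)
  moreover have "\<forall>\<pi>\<in>?U. \<forall>A. instanton_at \<pi> A \<longrightarrow> quadratic_curvature_decay A"
  proof (intro ballI allI impI)
    fix \<pi> A assume p: "\<pi> \<in> ?U" "instanton_at \<pi> A"
    show "quadratic_curvature_decay A"
      by (rule instanton_decay[of "fst \<pi>" "snd \<pi>", OF _ fl[OF p(1)]]) (use p(2) in simp)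
  qed
  moreover have "\<forall>\<pi>\<in>?U. \<forall>A. instanton_at \<pi> A \<longrightarrow> ((\<lambda>t. holonomy A (circle_at t)) \<longlongrightarrow> H \<pi>) at_top"
  proof (intro ballI allI impI)
    fix \<pi> A assume p: "\<pi> \<in> ?U" "instanton_at \<pi> A"
    show "((\<lambda>t. holonomy A (circle_at t)) \<longlongrightarrow> H \<pi>) at_top" unfolding H_def
      by (rule holonomy_limit[of "fst \<pi>" "snd \<pi>", OF _ fl[OF p(1)] l(1)[OF p(1)]]) (use p(2) in simp)
  qed
  ultimately show ?thesis using param_region_topology inj Hsurj by blast
qed

end
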